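(* Let $m\ge 2$ be an integer and let $h_1,\dots,h_m$ be integrable real-valued even functions on $\mathbb{R}$. Put $$\Delta(T):=\left|\frac1T\,\mathrm{tr}\Big[\prod_{i=1}^m W_T(h_i)\Big]-(2\pi)^{m-1}\int_{-\infty}^{\infty}\prod_{i=1}^m h_i(\lambda)\,d\lambda\right|,$$ and $$\varphi(\mathbf u):=\int_{-\infty}^{\infty}h_1(\lambda)h_2(\lambda-u_1)h_3(\lambda-u_2)\cdots h_m(\lambda-u_{m-1})\,d\lambda,\qquad \mathbf u=(u_1,\dots,u_{m-1})\in\mathbb{R}^{m-1}.$$ Then: (B1) If $h_i\in\mathcal F_1(\mathbb{R})$ for $i=1,\dots,m$, then $\Delta(T)=O(T^{-1})$ as $T\to\infty$. (B2) If $\varphi\in L^\infty(\mathbb{R}^{m-1})$ and for some constants $C>0$ and $\gamma\in(0,1]$ one has $|\varphi(\mathbf u)-\varphi(\mathbf 0)|\le C|\mathbf u|^\gamma$ for all $\mathbf u\in\mathbb{R}^{m-1}$, where $|\mathbf u|=|u_1|+\dots+|u_{m-1}|$, then for any $\varepsilon>0$, $\Delta(T)=O(T^{-\gamma+\varepsilon})$ as $T\to\infty$. (B3) If $h_i\in\mathrm{Lip}(\mathbb{R};p_i,\gamma)$, $i=1,\dots,m$, with $1/p_1+\dots+1/p_m\le 1$ and $\gamma\in(0,1]$, then for any $\varepsilon>0$, $\Delta(T)=O(T^{-\gamma+\varepsilon})$ as $T\to\infty$. (B4) Suppose each $h_i$ is differentiable on $\mathbb{R}\setminus\{0\}$ and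 there are constants $C_i>0$, $\sigma_i>0$, $\delta_i>1$ ($i=1,\dots,m$) with $\sigma:=\sum_{i=1}^m\sigma_i<1$ such that for all $\lambda\ne0$ $$|h_i(\lambda)|\le\begin{cases}C_i|\lambda|^{-\sigma_i},&|\lambda|\le1,\\ C_i|\lambda|^{-\delta_i},&|\lambda|>1,\end{cases}\qquad |h_i'(\lambda)|\le\begin{cases}C_i|\lambda|^{-\sigma_i-1},&|\lambda|\le1,\\ C_i|\lambda|^{-\delta_i-1},&|\lambda|>1.\end{cases}$$ Then for any $\varepsilon>0$, $\Delta(T)=O(T^{-\gamma+\varepsilon})$ as $T\to\infty$ with $\gamma=\frac1m(1-\sigma)$.
   Context: For an integrable real even function $f$ on $\mathbb{R}$, $\hat f(t)=\int_{\mathbb{R}}e^{i\lambda t}f(\lambda)\,d\lambda$, and for $T>0$ the $T$-truncated Toeplitz operator $W_T(f)$ on $L^2[0,T]$ is $[W_T(f)u](t)=\int_0^T\hat f(t-s)u(s)\,ds$; $\mathrm{tr}$ is the operator trace. $\mathcal F_1(\mathbb{R}):=\{f\in L^1(\mathbb{R}):\int_{-\infty}^\infty|t|\,|\hat f(t)|\,dt<\infty\}$. For $\psi\in L^p(\mathbb{R})$, $1\le p\le\infty$, $\omega_p(\psi,\delta):=\sup_{0<h\le\delta}\|\psi(\cdot+h)-\psi(\cdot)\|_p$, and for $0<\gamma\le1$, $\mathrm{Lip}(\mathbb{R};p,\gamma):=\{\psi\in L^p(\mathbb{R}):\omega_p(\psi,\delta)=O(\delta^\gamma)\text{ as }\delta\to0\}$.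 *)

theory Defs
  imports "HOL-Probability.Probability" "HOL-Library.Landau_Symbols"
begin

definition ft :: "(real \<Rightarrow> real) \<Rightarrow> real \<Rightarrow> complex" where
  "ft f t = (LINT l|lborel. exp (\<i> * complex_of_real (l * t)) * complex_of_real (f l))"

definition toeplitz :: "real \<Rightarrow> (real \<Rightarrow> real) \<Rightarrow> (real \<Rightarrow> complex) \<Rightarrow> real \<Rightarrow> complex" where
  "toeplitz T f u = (\<lambda>t. LINT s:{0..T}|lborel. ft f (t - s) * u s)"

definition toeplitz_prod :: "real \<Rightarrow> nat \<Rightarrow> (nat \<Rightarrow> real \<Rightarrow> real) \<Rightarrow> (real \<Rightarrow> complex) \<Rightarrow> real \<Rightarrow> complex" where
  "toeplitz_prod T m h u = foldr (\<lambda>i v. toeplitz T (h i) v) [1..<m+1] u"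

definition onb :: "real \<Rightarrow> int \<Rightarrow> real \<Rightarrow> complex" where
  "onb T k t = exp (2 * complex_of_real pi * \<i> * of_int k * complex_of_real (t / T)) / complex_of_real (sqrt T)"

definition op_trace :: "real \<Rightarrow> ((real \<Rightarrow> complex) \<Rightarrow> real \<Rightarrow> complex) \<Rightarrow> complex" where
  "op_trace T A = (\<Sum>\<^sub>\<infinity>k\<in>(UNIV::int set). LINT t:{0..T}|lborel. A (onb T k) t * cnj (onb T k t))"

definition Delta :: "nat \<Rightarrow> (nat \<Rightarrow> real \<Rightarrow> real) \<Rightarrow> real \<Rightarrow> real" where
  "Delta m h T = norm (op_trace T (toeplitz_prod T m h) / complex_of_real T
      - complex_of_real ((2 * pi) ^ (m - 1) * (LINT l|lborel. (\<Prod>i\<in>{1..m}. h i l))))"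

text \<open>phi(u) for u = (u_1,...,u_{m-1}), represented as u :: nat => real (only u 1 .. u (m-1) matter).\<close>
definition phi :: "nat \<Rightarrow> (nat \<Rightarrow> real \<Rightarrow> real) \<Rightarrow> (nat \<Rightarrow> real) \<Rightarrow> real" where
  "phi m h u = (LINT l|lborel. h 1 l * (\<Prod>i\<in>{2..m}. h i (l - u (i - 1))))"

definition F1 :: "(real \<Rightarrow> real) set" where
  "F1 = {f. integrable lborel f \<and> integrable lborel (\<lambda>t. \<bar>t\<bar> * norm (ft f t))}"

text \<open>L^p membership and norm on R, 1 <= p <= infinity (p :: ennreal, p = top meaning infinity).\<close>
definition in_Lp :: "ennreal \<Rightarrow> (real \<Rightarrow> real) \<Rightarrow> bool" where
  "in_Lp p f \<longleftrightarrow> f \<in> borel_measurable lborel \<and>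
     (if p = \<top> then esssup lborel (\<lambda>x. ereal \<bar>f x\<bar>) < \<infinity>
      else integrable lborel (\<lambda>x. \<bar>f x\<bar> powr enn2real p))"

definition Lp_norm :: "ennreal \<Rightarrow> (real \<Rightarrow> real) \<Rightarrow> real" where
  "Lp_norm p f = (if p = \<top> then real_of_ereal (esssup lborel (\<lambda>x. ereal \<bar>f x\<bar>))
      else (LINT x|lborel. \<bar>f x\<bar> powr enn2real p) powr (1 / enn2real p))"

definition omega :: "ennreal \<Rightarrow> (real \<Rightarrow> real) \<Rightarrow> real \<Rightarrow> real" where
  "omega p \<psi> \<delta> = (SUP h\<in>{0<..\<delta>}. Lp_norm p (\<lambda>x. \<psi> (x + h) - \<psi> x))"

definition Lip :: "ennreal \<Rightarrow> real \<Rightarrow> (real \<Rightarrow> real) set" where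
  "Lip p \<gamma> = {\<psi>. in_Lp p \<psi> \<and> (\<lambda>\<delta>. omega p \<psi> \<delta>) \<in> O[at_right 0](\<lambda>\<delta>. \<delta> powr \<gamma>)}"

end

(* Writing the symbols as integrals, the trace becomes the integral over (l_1, ..., l_m) of
   h_1(l_1) ... h_m(l_m) times a cyclic product of kernels D_T(l_(i+1) - l_i), where D_T(x) is the
   integral of exp(i x t) over [0, T].  With l_i = x - u_(i-1) this is the integral of phi against a
   kernel Phi_T(u) of total mass (2 pi)^(m-1) T, because D_T * D_T = 2 pi D_T.  Since
   |D_T(x)| <= 3 T / (1 + T |x|), the integral of |u|^g |Phi_T(u)| is O(T^(1-g)) for every g < 1, so
   any bound |phi(u) - phi(0)| <= C |u|^g gives an error O(T^(-g)).  This is (B2); (B3) reduces to it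
   by Hoelder's inequality, where the factor carrying the increment keeps its exponent p_j and the
   other exponents are lowered (all h_i are in L^1) until the reciprocals add up to 1; (B4) is (B3)
   with 1/p_i = sigma_i + gamma.  For (B1) one works in the time domain instead: the trace is the
   integral over v of a product of the transforms of the h_i, weighted by the length of the
   intersection of the translates of [0, T] by v, which differs from T by at most |v|. *)

theory Submission
  imports Defs
begin

section \<open>Fourier transforms and the Parseval formula\<close>

text \<open>\<open>op_trace\<close> sums over one concrete basis, the exponentials
  \<open>onb T k\<close>. Two reproducing identities are therefore needed: the integral one, D_T *
  D_T = 2 pi D_T, and a discrete one over the frequencies 2 pi k / T, which closes the cycle of
  kernels. The discrete identity comes from the partial fractions of the cotangent, together with a
  bound uniform in the two free frequencies that allows the sum over k and the frequency integral to
  be exchanged. D_T decays only like 1/|x| and is not dominated by an integrable function, whereas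
  the product of the m >= 2 kernels is integrable over the m - 1 differences. A weight |u|^g uses up
  g of this decay, and at g = 1 the majorant just fails to be integrable. The proof therefore always
  passes to some g strictly below \<gamma>, which is the origin of \<epsilon>. In (B1) the limit
  comes from Fourier inversion. It holds only almost everywhere, which suffices under the integral
  over the frequency.\<close>

lemma borel_measurable_cis [measurable (raw)]:
  "f \<in> borel_measurable M \<Longrightarrow> (\<lambda>x. cis (f x)) \<in> borel_measurable M"
  by (intro borel_measurable_continuous_on[where f = cis]) (auto intro: continuous_intros)

lemma (in pair_sigma_finite) integrable_pair_prod_bound:
  fixes F :: "'a \<times> 'b \<Rightarrow> 'c::{banach, second_countable_topology}"
  assumes f: "integrable M1 (f :: 'a \<Rightarrow> 'd::{banach, second_countable_topology})"
    and g: "integrable M2 (g :: 'b \<Rightarrow> 'e::{banach, second_countable_topology})"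
    and F[measurable]: "F \<in> borel_measurable (M1 \<Otimes>\<^sub>M M2)"
    and le: "\<And>x y. norm (F (x, y)) \<le> norm (f x) * norm (g y)"
  shows "integrable (M1 \<Otimes>\<^sub>M M2) F"
proof -
  have [measurable]: "f \<in> borel_measurable M1" "g \<in> borel_measurable M2"
    using f g by auto
  have "(\<integral>\<^sup>+z. ennreal (norm (F z)) \<partial>(M1 \<Otimes>\<^sub>M M2)) = (\<integral>\<^sup>+x. \<integral>\<^sup>+y. ennreal (norm (F (x, y))) \<partial>M2 \<partial>M1)"
    by (subst M2.nn_integral_fst[symmetric]) auto
  also have "\<dots> \<le> (\<integral>\<^sup>+x. \<integral>\<^sup>+y. ennreal (norm (f x)) * ennreal (norm (g y)) \<partial>M2 \<partial>M1)"
    by (intro nn_integral_mono) (simp add: le ennreal_mult[symmetric] ennreal_leI)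
  also have "\<dots> = (\<integral>\<^sup>+x. ennreal (norm (f x)) \<partial>M1) * (\<integral>\<^sup>+y. ennreal (norm (g y)) \<partial>M2)"
    by (simp add: nn_integral_cmult nn_integral_multc)
  also have "\<dots> < \<infinity>"
    using f g by (auto simp: integrable_iff_bounded ennreal_mult_less_top)
  finally show ?thesis
    by (simp add: integrable_iff_bounded)
qed

text \<open>The form in which almost all integrals are exchanged below: phases have modulus 1 and
  kernels are bounded, so the norm of the integrand is at most a product of two integrable functions
  of separate variables.\<close>

lemma (in pair_sigma_finite) Fubini_pair:
  fixes F :: "'a \<Rightarrow> 'b \<Rightarrow> 'c::{banach, second_countable_topology}"
  assumes "integrable M1 (f :: 'a \<Rightarrow> 'd::{banach, second_countable_topology})"
    and "integrable M2 (g :: 'b \<Rightarrow> 'e::{banach, second_countable_topology})"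
    and "(\<lambda>(x, y). F x y) \<in> borel_measurable (M1 \<Otimes>\<^sub>M M2)"
    and "\<And>x y. norm (F x y) \<le> norm (f x) * norm (g y)"
  shows "(LINT x|M1. LINT y|M2. F x y) = (LINT y|M2. LINT x|M1. F x y)"
  by (rule Fubini_integral[symmetric], rule integrable_pair_prod_bound[OF assms(1,2)]) (use assms in auto)

text \<open>A complex version of \<open>ft\<close>: Parseval is applied to modulated indicators, and
  inversion transforms \<open>ft h\<close> once more.\<close>

definition cft :: "(real \<Rightarrow> complex) \<Rightarrow> real \<Rightarrow> complex" where
  "cft f t = (LINT l|lborel. cis (l * t) * f l)"

lemma measurable_cft [measurable]:
  assumes [measurable]: "f \<in> borel_measurable borel"
  shows "cft f \<in> borel_measurable borel"
  unfolding cft_def by measurable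

lemma norm_cft_le:
  shows "norm (cft f t) \<le> (LINT l|lborel. norm (f l))"
  unfolding cft_def using integral_norm_bound[of lborel "\<lambda>l. cis (l * t) * f l"]
  by (simp add: norm_mult)

lemma integrable_cis_mult:
  assumes "integrable M (f :: _ \<Rightarrow> complex)" and [measurable]: "q \<in> borel_measurable M"
  shows "integrable M (\<lambda>x. cis (q x) * f x)"
  by (rule Bochner_Integration.integrable_bound[OF assms(1)]) (use assms in \<open>auto simp: norm_mult\<close>)

text \<open>Fubini for the symmetric kernel cis (s y t). The parameter s covers both signs of the
  phase, s = 1 and s = -1.\<close>

lemma cft_multiplication:
  fixes f g :: "real \<Rightarrow> complex"
  assumes f: "integrable lborel f" and g: "integrable lborel g"
  shows "(LINT t|lborel. cft f (s * t) * g t) = (LINT y|lborel. f y * cft g (s * y))"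
proof -
  have [measurable]: "f \<in> borel_measurable borel" "g \<in> borel_measurable borel"
    using f g by auto
  have "(LINT t|lborel. cft f (s * t) * g t) = (LINT t|lborel. LINT y|lborel. cis (y * (s * t)) * f y * g t)"
    unfolding cft_def by simp
  also have "\<dots> = (LINT y|lborel. LINT t|lborel. cis (y * (s * t)) * f y * g t)"
    by (rule lborel_pair.Fubini_pair[OF g f]) (auto simp: norm_mult)
  also have "\<dots> = (LINT y|lborel. f y * cft g (s * y))"
    unfolding cft_def by (subst integral_mult_right_zero[symmetric]) (simp add: mult_ac)
  finally show ?thesis .
qed

lemma cft_gaussian:
  "(LINT t|lborel. cis (w * t) * of_real (exp (- (t^2 / 2)))) = 2 * pi * std_normal_density w"
proof -
  have "exp (- (w^2) / 2) = char std_normal_distribution w"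
    by (simp add: char_std_normal_distribution)
  also have "\<dots> = (LINT x|lborel. std_normal_density x *\<^sub>R cis (w * x))"
    unfolding char_def by (subst integral_density) (auto simp: normal_density_nonneg cis_conv_exp)
  also have "\<dots> = (LINT x|lborel. complex_of_real (1 / sqrt (2 * pi)) * (cis (w * x) * of_real (exp (- (x^2 / 2)))))"
    by (intro Bochner_Integration.integral_cong) (auto simp: std_normal_density_def scaleR_conv_of_real)
  also have "\<dots> = complex_of_real (1 / sqrt (2 * pi)) * (LINT t|lborel. cis (w * t) * of_real (exp (- (t^2 / 2))))"
    by simp
  finally have *: "complex_of_real (exp (- (w^2) / 2)) = complex_of_real (1 / sqrt (2 * pi)) * (LINT t|lborel. cis (w * t) * of_real (exp (- (t^2 / 2))))" .
  have "2 * pi * std_normal_density w = complex_of_real (sqrt (2 * pi)) * complex_of_real (exp (- (w^2) / 2))"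
    unfolding std_normal_density_def of_real_mult[symmetric]
    by (intro arg_cong[where f = of_real]) (simp add: field_simps)
  also have "\<dots> = (LINT t|lborel. cis (w * t) * of_real (exp (- (t^2 / 2))))"
    unfolding * by simp
  finally show ?thesis ..
qed

lemma integrable_gaussian: "integrable lborel (\<lambda>t::real. complex_of_real (exp (- (t^2 / 2))))"
proof -
  have "integrable lborel (\<lambda>t::real. sqrt (2 * pi) * std_normal_density t)"
    by (intro integrable_mult_right integrable_normal_density) auto
  also have "(\<lambda>t::real. sqrt (2 * pi) * std_normal_density t) = (\<lambda>t. exp (- (t^2 / 2)))"
    by (auto simp: std_normal_density_def)
  finally show ?thesis by (simp add: integrable_of_real)
qed

text \<open>Only the product of the two transforms is assumed integrable: transforms of indicators
  decay like 1/|t|, so neither is integrable alone. The proof inserts a Gaussian damping and removes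
  it in the limit, on the left by dominated convergence, on the right by continuity of f at almost
  every point.\<close>

lemma cft_parseval:
  fixes h f :: "real \<Rightarrow> complex"
  assumes h: "integrable lborel h" and f: "integrable lborel f"
    and B: "\<And>x. norm (f x) \<le> B" and cont: "AE x in lborel. isCont f x"
    and int: "integrable lborel (\<lambda>t. cft h t * cft f (- t))"
  shows "(LINT t|lborel. cft h t * cft f (- t)) = 2 * pi * (LINT x|lborel. h x * f x)"
proof -
  have [measurable]: "f \<in> borel_measurable borel" "h \<in> borel_measurable borel"
    using f h by auto
  define e :: "nat \<Rightarrow> real" where "e k = inverse (real (Suc k))" for k
  have e0: "e k > 0" for k by (simp add: e_def)
  have elim: "e \<longlonglongrightarrow> 0" unfolding e_def by (rule LIMSEQ_inverse_real_of_nat)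
  \<comment> \<open>The damping factor; it tends to 1 pointwise as \<open>e k\<close> tends to
    0.\<close>
  define G where "G k t = complex_of_real (exp (- ((e k * t)^2 / 2)))" for k t
  have [measurable]: "G k \<in> borel_measurable borel" for k unfolding G_def by measurable
  have normG: "norm (G k t) \<le> 1" for k t by (simp add: G_def)
  have intG: "integrable lborel (G k)" for k
    using lborel_integrable_real_affine[OF integrable_gaussian, of "e k" 0] e0[of k] by (simp add: G_def[abs_def])
  have ftG: "(LINT t|lborel. cis (w * t) * G k t) = 2 * pi / e k * std_normal_density (w / e k)" for w k
  proof -
    have "(LINT t|lborel. cis ((w / e k) * t) * of_real (exp (- (t^2 / 2)))) 
      = \<bar>e k\<bar> *\<^sub>R (LINT t|lborel. cis ((w / e k) * (0 + e k * t)) * of_real (exp (- ((0 + e k * t)^2 / 2))))"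
      using e0[of k] by (intro lborel_integral_real_affine) auto
    also have "\<dots> = e k *\<^sub>R (LINT t|lborel. cis (w * t) * G k t)"
      using e0[of k] by (simp add: G_def)
    finally show ?thesis
      using e0[of k] unfolding cft_gaussian by (simp add: scaleR_conv_of_real field_simps)
  qed
  \<comment> \<open>What the damping turns into on the other side: the average of f over a Gaussian
    of width \<open>e k\<close> around x.\<close>
  define F where "F k x = (LINT z|lborel. std_normal_density z *\<^sub>R f (x + e k * z))" for k x
  have [measurable]: "F k \<in> borel_measurable borel" for k unfolding F_def by measurable
  have intn: "integrable lborel std_normal_density"
    by (rule integrable_normal_density) auto
  have nB: "norm (std_normal_density z *\<^sub>R f y) \<le> B * std_normal_density z" for z y
    using mult_right_mono[OF B[of y] normal_density_nonneg[of 0 1 z]] by (simp add: normal_density_nonneg mult.commute)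
  have normF: "norm (F k x) \<le> B" for k x
  proof -
    have B0: "B \<ge> 0" using B[of 0] norm_ge_zero order_trans by blast
    have "norm (F k x) \<le> (LINT z|lborel. B * std_normal_density z)"
      unfolding F_def using B0
      by (intro order_trans[OF integral_norm_bound] integral_mono' integrable_mult_right intn nB)
         (auto simp: normal_density_nonneg)
    thus ?thesis by (simp add: integral_normal_density)
  qed
  \<comment> \<open>The damped identity: the multiplication formula is used once with s = -1 to
    identify the transform of the damped factor, and once with s = 1 to move the transform off
    h.\<close>
  have key: "(LINT t|lborel. G k t * (cft h t * cft f (- t))) = 2 * pi * (LINT x|lborel. h x * F k x)" for k
  proof -
    let ?g = "\<lambda>t. G k t * cft f (- t)"
    have ig: "integrable lborel ?g"
    proof (rule Bochner_Integration.integrable_bound)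
      show "integrable lborel (\<lambda>t. (LINT l|lborel. norm (f l)) * norm (G k t))"
        by (intro integrable_mult_right integrable_norm intG)
      have "norm (?g t) \<le> norm ((LINT l|lborel. norm (f l)) * norm (G k t))" for t
        using mult_left_mono[OF norm_cft_le[of f "-t"] norm_ge_zero[of "G k t"]]
        by (simp add: norm_mult mult.commute)
      thus "AE t in lborel. norm (?g t) \<le> norm ((LINT l|lborel. norm (f l)) * norm (G k t))"
        by simp
    qed simp
    have inner: "cft ?g x = 2 * pi * F k x" for x
    proof -
      have ig2: "integrable lborel (\<lambda>t. cis (x * t) * G k t)"
        by (rule integrable_cis_mult[OF intG]) auto
      have "cft ?g x = (LINT t|lborel. cft f ((-1) * t) * (cis (x * t) * G k t))"
        unfolding cft_def[of ?g] by (simp add: mult_ac)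
      also have "\<dots> = (LINT y|lborel. f y * cft (\<lambda>t. cis (x * t) * G k t) ((-1) * y))"
        by (rule cft_multiplication[OF f ig2])
      also have "\<dots> = (LINT y|lborel. f y * (LINT t|lborel. cis ((x - y) * t) * G k t))"
        unfolding cft_def mult.assoc[symmetric] cis_mult
        by (intro Bochner_Integration.integral_cong refl arg_cong2[where f = "(*)"] arg_cong[where f = cis])
           (simp add: algebra_simps)
      also have "\<dots> = (LINT y|lborel. f y * (2 * pi / e k * std_normal_density ((x - y) / e k)))"
        unfolding ftG by simp
      also have "\<dots> = \<bar>e k\<bar> *\<^sub>R (LINT z|lborel. f (x + e k * z) * (2 * pi / e k * std_normal_density ((x - (x + e k * z)) / e k)))"
        using e0[of k] by (intro lborel_integral_real_affine) auto
      also have "\<dots> = e k *\<^sub>R (LINT z|lborel. complex_of_real (2 * pi / e k) * (std_normal_density z *\<^sub>R f (x + e k * z)))"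
        using e0[of k] by (simp add: scaleR_conv_of_real mult_ac std_normal_density_def)
      also have "\<dots> = 2 * pi * F k x"
        using e0[of k] by (simp add: F_def scaleR_conv_of_real)
      finally show ?thesis .
    qed
    have "(LINT t|lborel. G k t * (cft h t * cft f (- t))) = (LINT t|lborel. cft h (1 * t) * ?g t)"
      by (simp add: mult_ac)
    also have "\<dots> = (LINT x|lborel. h x * cft ?g (1 * x))"
      by (rule cft_multiplication[OF h ig])
    also have "\<dots> = (LINT x|lborel. 2 * pi * (h x * F k x))"
      by (simp add: inner mult_ac)
    finally show ?thesis by simp
  qed
  have L: "(\<lambda>k. LINT t|lborel. G k t * (cft h t * cft f (- t))) \<longlonglongrightarrow> (LINT t|lborel. cft h t * cft f (- t))"
  proof (rule integral_dominated_convergence[where w = "\<lambda>t. norm (cft h t * cft f (- t))"])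
    show "AE t in lborel. (\<lambda>k. G k t * (cft h t * cft f (- t))) \<longlonglongrightarrow> cft h t * cft f (- t)"
    proof (intro AE_I2)
      fix t
      have "(\<lambda>k. G k t * (cft h t * cft f (- t))) \<longlonglongrightarrow> complex_of_real (exp (- ((0 * t)^2 / 2))) * (cft h t * cft f (- t))"
        unfolding G_def by (intro tendsto_intros elim) auto
      thus "(\<lambda>k. G k t * (cft h t * cft f (- t))) \<longlonglongrightarrow> cft h t * cft f (- t)" by simp
    qed
    show "AE t in lborel. norm (G k t * (cft h t * cft f (- t))) \<le> norm (cft h t * cft f (- t))" for k
      by (intro AE_I2) (metis normG norm_mult mult_left_le_one_le norm_ge_zero)
  qed (use int in auto)
  have Flim: "AE x in lborel. (\<lambda>k. F k x) \<longlonglongrightarrow> f x"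
    using cont
  proof eventually_elim
    case (elim x)
    have "(\<lambda>k. F k x) \<longlonglongrightarrow> (LINT z|lborel. std_normal_density z *\<^sub>R f x)"
      unfolding F_def
    proof (rule integral_dominated_convergence[where w = "\<lambda>z. B * std_normal_density z"])
      show "AE z in lborel. (\<lambda>k. std_normal_density z *\<^sub>R f (x + e k * z)) \<longlonglongrightarrow> std_normal_density z *\<^sub>R f x"
      proof (intro AE_I2 tendsto_scaleR tendsto_const)
        fix z
        have "(\<lambda>k. x + e k * z) \<longlonglongrightarrow> x + 0 * z"
          by (intro tendsto_intros \<open>e \<longlonglongrightarrow> 0\<close>)
        thus "(\<lambda>k. f (x + e k * z)) \<longlonglongrightarrow> f x"
          using elim by (intro isCont_tendsto_compose[where g = f]) auto
      qed
      show "AE z in lborel. norm (std_normal_density z *\<^sub>R f (x + e k * z)) \<le> B * std_normal_density z" for k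
        by (intro AE_I2 nB)
    qed (auto intro!: intn)
    thus ?case by (simp add: integral_normal_density)
  qed
  have R: "(\<lambda>k. LINT x|lborel. h x * F k x) \<longlonglongrightarrow> (LINT x|lborel. h x * f x)"
  proof (rule integral_dominated_convergence[where w = "\<lambda>x. B * norm (h x)"])
    show "AE x in lborel. (\<lambda>k. h x * F k x) \<longlonglongrightarrow> h x * f x"
      using Flim by eventually_elim (intro tendsto_intros)
    show "AE x in lborel. norm (h x * F k x) \<le> B * norm (h x)" for k
      by (intro AE_I2) (metis normF norm_mult mult.commute mult_right_mono norm_ge_zero)
  qed (use h in auto)
  have "(\<lambda>k. 2 * pi * (LINT x|lborel. h x * F k x)) \<longlonglongrightarrow> 2 * pi * (LINT x|lborel. h x * f x)"
    by (intro tendsto_intros R)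
  with L show ?thesis unfolding key by (rule LIMSEQ_unique)
qed

section \<open>The Dirichlet kernel of an interval\<close>

definition dirichlet :: "real \<Rightarrow> real \<Rightarrow> complex" where
  "dirichlet T x = (LINT t|lborel. indicator {0..T} t *\<^sub>R cis (x * t))"

lemma measurable_dirichlet [measurable]: "dirichlet T \<in> borel_measurable borel"
  unfolding dirichlet_def by measurable

lemma integrable_indicator_Icc: "integrable lborel (indicator {a..b::real} :: real \<Rightarrow> real)"
  by (cases "a \<le> b") auto

lemma integrable_indicator_cis: "integrable lborel (\<lambda>t. indicator {0..T::real} t *\<^sub>R cis (x * t))"
  by (rule Bochner_Integration.integrable_bound[OF integrable_indicator_Icc[of 0 T]])
     (auto simp: indicator_def)

lemma dirichlet_0: "T \<ge> 0 \<Longrightarrow> dirichlet T 0 = of_real T"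
  by (simp add: dirichlet_def scaleR_conv_of_real)

lemma norm_dirichlet_le: "T \<ge> 0 \<Longrightarrow> norm (dirichlet T x) \<le> T"
proof -
  assume T: "T \<ge> 0"
  have "norm (dirichlet T x) \<le> (LINT t|lborel. norm (indicator {0..T} t *\<^sub>R cis (x * t)))"
    unfolding dirichlet_def by (rule integral_norm_bound)
  also have "\<dots> = T" using T by simp
  finally show ?thesis .
qed

lemma dirichlet_closed_form:
  assumes "x \<noteq> 0" "T \<ge> 0"
  shows "dirichlet T x = (cis (x * T) - 1) / (\<i> * of_real x)"
proof -
  have "(LINT t|lborel. indicator {0..T} t *\<^sub>R cis (x * t)) = cis (x * T) / (\<i> * of_real x) - cis (x * 0) / (\<i> * of_real x)"
  proof (rule integral_FTC_Icc)
    fix t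
    show "((\<lambda>t. cis (x * t) / (\<i> * of_real x)) has_vector_derivative cis (x * t)) (at t within {0..T})"
      unfolding has_vector_derivative_def using assms
      by (auto intro!: derivative_eq_intros ext simp: scaleR_conv_of_real field_simps)
  qed (use assms in \<open>auto intro!: continuous_intros\<close>)
  thus ?thesis by (simp add: dirichlet_def diff_divide_distrib)
qed

text \<open>The trivial bound T and the bound 2 / |x| from the closed form are added after
  multiplying the second by T |x|; hence the constant 3.\<close>

lemma norm_dirichlet_bound:
  assumes "T > 0"
  shows "norm (dirichlet T x) \<le> 3 * T / (1 + T * \<bar>x\<bar>)"
proof -
  have "norm (dirichlet T x) * (T * \<bar>x\<bar>) \<le> 2 * T"
  proof (cases "x = 0")
    case False
    have "norm (cis (x * T) - 1) \<le> 2"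
      using norm_triangle_ineq4[of "cis (x * T)" 1] by simp
    hence "norm (cis (x * T) - 1) * T \<le> 2 * T" using assms by simp
    thus ?thesis using False assms dirichlet_closed_form[of x T] by (simp add: norm_divide norm_mult)
  qed (use assms in auto)
  moreover have "norm (dirichlet T x) \<le> T" using assms by (intro norm_dirichlet_le) simp
  ultimately have "norm (dirichlet T x) * (1 + T * \<bar>x\<bar>) \<le> 3 * T" by (simp add: algebra_simps)
  thus ?thesis using assms by (subst pos_le_divide_eq) (auto intro: add_pos_nonneg)
qed

lemma dirichlet_eq_cft: "dirichlet T (x - b) = cft (\<lambda>t. indicator {0..T} t *\<^sub>R cis (- b * t)) x"
  unfolding dirichlet_def cft_def
  by (intro Bochner_Integration.integral_cong) (auto simp: cis_mult algebra_simps)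

lemma integrable_inverse_square: "integrable lborel (\<lambda>x::real. 1 / (1 + x^2))"
  using integrable_inverse_1_plus_square by (simp add: set_integrable_def divide_inverse)

text \<open>The product is at most the sum of the two squares, and each square decays like 1 / (1 +
  (T y)^2).\<close>

lemma integrable_dirichlet_dirichlet:
  assumes "T > 0"
  shows "integrable lborel (\<lambda>x. dirichlet T (a - x) * dirichlet T (x - b))"
proof (rule Bochner_Integration.integrable_bound)
  let ?k = "\<lambda>y. 1 / (1 + (T * (y::real))^2)"
  have i: "integrable lborel (\<lambda>x. ?k (c + 1 * x))" for c :: real
    using lborel_integrable_real_affine[OF integrable_inverse_square, of T "T * c"] assms by (simp add: algebra_simps)
  show "integrable lborel (\<lambda>x. 9 * T^2 * (?k (-a + 1 * x) + ?k (-b + 1 * x)))"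
    by (intro integrable_mult_right Bochner_Integration.integrable_add i)
  have k: "norm (dirichlet T y) ^ 2 \<le> 9 * T^2 * ?k y" for y
  proof -
    have "norm (dirichlet T y) ^ 2 \<le> (3 * T / (1 + T * \<bar>y\<bar>))^2"
      by (intro power_mono norm_dirichlet_bound assms) auto
    also have "\<dots> = 9 * T^2 / (1 + T * \<bar>y\<bar>)^2" by (simp add: power_divide power_mult_distrib)
    also have "\<dots> \<le> 9 * T^2 / (1 + (T * y)^2)"
      using assms by (intro divide_left_mono mult_pos_pos) (auto simp: power2_eq_square algebra_simps add_pos_nonneg abs_mult_self_eq intro!: add_pos_nonneg)
    finally show ?thesis by simp
  qed
  have s: "norm (dirichlet T (a - x) * dirichlet T (x - b)) \<le> norm (9 * T^2 * (?k (-a + 1 * x) + ?k (-b + 1 * x)))" for x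
  proof -
    have "norm (dirichlet T (a - x) * dirichlet T (x - b)) \<le> norm (dirichlet T (a - x))^2 + norm (dirichlet T (x - b))^2"
      unfolding norm_mult using sum_squares_bound[of "norm (dirichlet T (a - x))" "norm (dirichlet T (x - b))"]
      mult_nonneg_nonneg[OF norm_ge_zero[of "dirichlet T (a - x)"] norm_ge_zero[of "dirichlet T (x - b)"]]
      by linarith
    also have "\<dots> \<le> 9 * T^2 * ?k (a - x) + 9 * T^2 * ?k (x - b)" by (intro add_mono k)
    also have "?k (a - x) = ?k (-a + 1 * x)" by (simp add: power2_eq_square algebra_simps)
    also have "9 * T^2 * ?k (-a + 1 * x) + 9 * T^2 * ?k (x - b) = 9 * T^2 * (?k (-a + 1 * x) + ?k (-b + 1 * x))"
      by (simp add: algebra_simps)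
    also have "\<dots> \<le> norm \<dots>" unfolding real_norm_def by (rule abs_ge_self)
    finally show ?thesis .
  qed
  show "AE x in lborel. norm (dirichlet T (a - x) * dirichlet T (x - b)) \<le> norm (9 * T^2 * (?k (-a + 1 * x) + ?k (-b + 1 * x)))"
    by (intro AE_I2 s)
qed simp

lemma isCont_cis_mult: "isCont (\<lambda>t. cis (a * t)) x"
proof -
  have "continuous_on UNIV (\<lambda>t. cis (a * t))" by (intro continuous_intros)
  thus ?thesis by (simp add: continuous_on_eq_continuous_at)
qed

lemma isCont_indicator_Icc:
  fixes g :: "real \<Rightarrow> complex"
  assumes "isCont g x" "x \<noteq> a" "x \<noteq> b"
  shows "isCont (\<lambda>t. indicator {a..b} t *\<^sub>R g t) x"
proof -
  have "isCont (indicat_real {a..b}) x"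
    using assms by (subst isCont_indicator) (auto simp: frontier_def)
  thus ?thesis using assms by (intro continuous_intros)
qed

text \<open>The indicator of [0, T] is its own square, so its transform reproduces itself under
  convolution. Formally this is Parseval for exp (- i b t) and exp (i a t), both cut off to
  [0, T].\<close>

lemma dirichlet_reproducing:
  assumes "T > 0"
  shows "(LINT x|lborel. dirichlet T (a - x) * dirichlet T (x - b)) = 2 * pi * dirichlet T (a - b)"
proof -
  let ?h = "\<lambda>t. indicator {0..T} t *\<^sub>R cis (- b * t)" and ?f = "\<lambda>t. indicator {0..T} t *\<^sub>R cis (a * t)"
  have 1: "cft ?f (- x) = dirichlet T (a - x)" for x
    using dirichlet_eq_cft[of T "-x" "-a"] by simp
  have 2: "cft ?h x = dirichlet T (x - b)" for x
    using dirichlet_eq_cft[of T x b] by simp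
  have "(LINT x|lborel. cft ?h x * cft ?f (- x)) = 2 * pi * (LINT t|lborel. ?h t * ?f t)"
  proof (rule cft_parseval[where B = 1])
    show "AE x in lborel. isCont ?f x"
      using AE_lborel_singleton[of "0::real"] AE_lborel_singleton[of T]
      by eventually_elim (intro isCont_indicator_Icc isCont_cis_mult)
    show "integrable lborel (\<lambda>t. cft ?h t * cft ?f (- t))"
      unfolding 1 2 using integrable_dirichlet_dirichlet[OF assms, of a b] by (simp add: mult.commute)
    show "integrable lborel ?h" using integrable_indicator_cis[of T "-b"] by simp
    show "integrable lborel ?f" by (rule integrable_indicator_cis)
  qed (auto split: split_indicator)
  also have "(LINT t|lborel. ?h t * ?f t) = dirichlet T (a - b)"
    unfolding dirichlet_def by (intro Bochner_Integration.integral_cong) (auto simp: cis_mult indicator_def algebra_simps)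
  finally show ?thesis unfolding 1 2 by (simp add: mult.commute)
qed

section \<open>Partial fractions of the cotangent and kernel sums over the dual lattice\<close>

text \<open>The logarithmic derivative of Gamma(z) Gamma(1 - z) = pi / sin (pi z). Through the
  series of \<open>Digamma\<close> it becomes the partial fraction expansion of the
  cotangent.\<close>

lemma Digamma_reflection:
  fixes z :: complex
  assumes z: "z \<notin> \<int>"
  shows "Digamma (1 - z) - Digamma z = of_real pi * cot (of_real pi * z)"
proof -
  have z': "z \<notin> \<int>\<^sub>\<le>\<^sub>0" "1 - z \<notin> \<int>\<^sub>\<le>\<^sub>0"
    using z by (auto elim!: nonpos_Ints_cases) (metis Ints_1 Ints_diff Ints_of_int diff_diff_eq2 add_diff_cancel_left')
  have s: "sin (of_real pi * z) \<noteq> 0"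
    using z by (auto simp: sin_eq_0 mult.commute)
  have "((\<lambda>z. Gamma z * Gamma (1 - z)) has_field_derivative
     Gamma z * Digamma z * Gamma (1 - z) + - (Gamma (1 - z) * Digamma (1 - z)) * Gamma z) (at z)"
    using z' by (auto intro!: derivative_eq_intros)
  moreover have "((\<lambda>z. of_real pi / sin (of_real pi * z)) has_field_derivative
     - (of_real pi * (cos (of_real pi * z) * of_real pi)) / (sin (of_real pi * z) * sin (of_real pi * z))) (at z)"
    using s by (auto intro!: derivative_eq_intros)
  ultimately have "Gamma z * Digamma z * Gamma (1 - z) + - (Gamma (1 - z) * Digamma (1 - z)) * Gamma z = 
     - (of_real pi * (cos (of_real pi * z) * of_real pi)) / (sin (of_real pi * z) * sin (of_real pi * z))"
    unfolding Gamma_reflection_complex by (rule DERIV_unique)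
  moreover have "Gamma z * Digamma z * Gamma (1 - z) + - (Gamma (1 - z) * Digamma (1 - z)) * Gamma z
     = (Gamma z * Gamma (1 - z)) * (Digamma z - Digamma (1 - z))" by (simp add: algebra_simps)
  ultimately have "of_real pi / sin (of_real pi * z) * (Digamma z - Digamma (1 - z)) =
     - (of_real pi * (cos (of_real pi * z) * of_real pi)) / (sin (of_real pi * z) * sin (of_real pi * z))"
    unfolding Gamma_reflection_complex by simp
  hence "Digamma z - Digamma (1 - z) = - (of_real pi * cos (of_real pi * z)) / sin (of_real pi * z)"
  proof -
    have c: "d = - (q * c) / s" if "q / s * d = - (q * (c * q)) / (s * s)" "q \<noteq> 0" "s \<noteq> 0" for q s c d :: complex
    proof -
      have "q / s * d = q / s * (- (q * c) / s)" using that(1) by (simp add: mult_ac)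
      moreover have "q / s \<noteq> 0" using that(2,3) by simp
      ultimately show ?thesis using mult_left_cancel by blast
    qed
    assume *: "of_real pi / sin (of_real pi * z) * (Digamma z - Digamma (1 - z)) =
     - (of_real pi * (cos (of_real pi * z) * of_real pi)) / (sin (of_real pi * z) * sin (of_real pi * z))"
    show ?thesis by (rule c[OF * _ s]) simp
  qed
  hence "- (Digamma z - Digamma (1 - z)) = of_real pi * cot (of_real pi * z)"
    by (simp add: cot_def)
  thus ?thesis by simp
qed

text \<open>The difference of two cotangent expansions, since 1/(x + k) - 1/(y + k) = (y - x) / ((x
  + k)(y + k)). The k-th term collects the lattice points -k and k + 1.\<close>

lemma frac_sums_cot:
  fixes x y :: real
  assumes x: "x \<notin> \<int>" and y: "y \<notin> \<int>" and xy: "x \<noteq> y"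
  shows "(\<lambda>k. 1 / ((x + real k) * (y + real k)) + 1 / ((1 - x + real k) * (1 - y + real k)))
           sums (pi * (cot (pi * x) - cot (pi * y)) / (y - x))"
proof -
  have c: "(\<lambda>k. inverse (z + real k) - inverse (1 - z + real k)) sums (pi * cot (pi * z))" if z: "z \<notin> \<int>" for z :: real
  proof -
    have z0: "z \<noteq> 0" "1 - z \<noteq> 0" using z by auto
    have "complex_of_real (Digamma (1 - z) - Digamma z) = Digamma (1 - of_real z) - Digamma (of_real z)"
      using Polygamma_of_real[OF z0(1), of 0, where ?'a = complex] Polygamma_of_real[OF z0(2), of 0, where ?'a = complex] by simp
    also have "\<dots> = of_real pi * cot (of_real pi * of_real z)"
      by (rule Digamma_reflection) (use z in auto)
    also have "\<dots> = complex_of_real (pi * cot (pi * z))"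
      by (simp add: cot_of_real)
    finally have 1: "Digamma (1 - z) - Digamma z = pi * cot (pi * z)"
      unfolding of_real_eq_iff .
    have s: "(\<lambda>k. inverse (real (Suc k)) - inverse (w + real k)) sums (Digamma w + euler_mascheroni)" if "w \<noteq> 0" for w :: real
      using summable_sums[OF summable_Digamma[OF that]] by (simp add: Digamma_def)
    have "(\<lambda>k. (inverse (real (Suc k)) - inverse ((1 - z) + real k)) - (inverse (real (Suc k)) - inverse (z + real k)))
       sums ((Digamma (1 - z) + euler_mascheroni) - (Digamma z + euler_mascheroni))"
      by (intro sums_diff s z0)
    thus ?thesis by (simp add: 1)
  qed
  have "(\<lambda>k. ((inverse (x + real k) - inverse (1 - x + real k)) - (inverse (y + real k) - inverse (1 - y + real k))) / (y - x))
      sums ((pi * cot (pi * x) - pi * cot (pi * y)) / (y - x))"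
    by (intro sums_divide sums_diff c x y)
  moreover have "((inverse (x + real k) - inverse (1 - x + real k)) - (inverse (y + real k) - inverse (1 - y + real k))) / (y - x)
      = 1 / ((x + real k) * (y + real k)) + 1 / ((1 - x + real k) * (1 - y + real k))" for k
  proof -
    have nz: "z + real k \<noteq> 0" "1 - z + real k \<noteq> 0" if z: "z \<notin> \<int>" for z
    proof -
      show "z + real k \<noteq> 0"
      proof
        assume "z + real k = 0"
        hence "z = - real k" by simp
        with z show False by simp
      qed
      show "1 - z + real k \<noteq> 0"
      proof
        assume "1 - z + real k = 0"
        hence "z = 1 + real k" by simp
        with z show False by simp
      qed
    qed
    have e: "(inverse A - inverse C - (inverse B - inverse D)) / e = 1 / (A * B) + 1 / (C * D)"
      if "A \<noteq> 0" "B \<noteq> 0" "C \<noteq> 0" "D \<noteq> 0" "e \<noteq> 0" "B - A = e" "C - D = e" for A B C D e :: real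
    proof -
      have "inverse A - inverse B = e / (A * B)" "inverse D - inverse C = e / (C * D)"
        using that by (simp_all add: field_simps)
      hence "inverse A - inverse C - (inverse B - inverse D) = e / (A * B) + e / (C * D)" by simp
      thus ?thesis using that(5) by (simp add: add_divide_distrib)
    qed
    show ?thesis by (rule e) (use nz[OF x] nz[OF y] xy in auto)
  qed
  ultimately show ?thesis by (simp add: right_diff_distrib)
qed

text \<open>The confluent case of the previous sum: the difference quotient of the cotangent is
  replaced by its derivative, and the terms become those of \<open>Polygamma 1\<close>.\<close>

lemma frac_sums_csc:
  fixes x :: real
  assumes x: "x \<notin> \<int>"
  shows "(\<lambda>k. 1 / ((x + real k) * (x + real k)) + 1 / ((1 - x + real k) * (1 - x + real k)))
           sums (pi^2 / (sin (pi * x))^2)"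
proof -
  define z where "z = complex_of_real x"
  have z: "z \<notin> \<int>" using x by (simp add: z_def)
  have z': "z \<notin> \<int>\<^sub>\<le>\<^sub>0" "1 - z \<notin> \<int>\<^sub>\<le>\<^sub>0"
    using z by (auto elim!: nonpos_Ints_cases) (metis Ints_1 Ints_diff Ints_of_int diff_diff_eq2 add_diff_cancel_left')
  have sz: "sin (of_real pi * z) \<noteq> 0"
    using z by (auto simp: sin_eq_0 mult.commute)
  have "((\<lambda>z. Digamma (1 - z) - Digamma z) has_field_derivative - Polygamma 1 (1 - z) - Polygamma 1 z) (at z)"
    using z' by (auto intro!: derivative_eq_intros)
  moreover have "((\<lambda>z. Digamma (1 - z) - Digamma z) has_field_derivative
      of_real pi * (- inverse ((sin (of_real pi * z))^2) * of_real pi)) (at z)"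
  proof (rule has_field_derivative_transform_within_open[where S = "- \<int>"])
    show "((\<lambda>z. of_real pi * cot (of_real pi * z)) has_field_derivative
      of_real pi * (- inverse ((sin (of_real pi * z))^2) * of_real pi)) (at z)"
      by (intro DERIV_cmult DERIV_chain2[where f = cot and g = "\<lambda>z. of_real pi * z"] DERIV_cot[OF sz])
         (auto intro!: derivative_eq_intros)
  qed (use z Digamma_reflection in auto)
  ultimately have "- Polygamma 1 (1 - z) - Polygamma 1 z = of_real pi * (- inverse ((sin (of_real pi * z))^2) * of_real pi)"
    by (rule DERIV_unique)
  hence "Polygamma 1 z + Polygamma 1 (1 - z) = of_real pi * (inverse ((sin (of_real pi * z))^2) * of_real pi)"
    by (simp add: algebra_simps)
  also have "\<dots> = complex_of_real (pi^2 / (sin (pi * x))^2)"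
    unfolding z_def by (simp add: sin_of_real[symmetric] power2_eq_square field_simps)
  finally have "Polygamma 1 z + Polygamma 1 (1 - z) = complex_of_real (pi^2 / (sin (pi * x))^2)" .
  moreover have x0: "x \<noteq> 0" "1 - x \<noteq> 0" using x by auto
  hence "Polygamma 1 z + Polygamma 1 (1 - z) = complex_of_real (Polygamma 1 x + Polygamma 1 (1 - x))"
    using Polygamma_of_real[OF x0(1), of 1, where ?'a = complex] Polygamma_of_real[OF x0(2), of 1, where ?'a = complex] by (simp add: z_def)
  ultimately have 1: "Polygamma 1 x + Polygamma 1 (1 - x) = pi^2 / (sin (pi * x))^2"
    by (metis of_real_eq_iff)
  have s: "(\<lambda>k. 1 / ((w + real k) * (w + real k))) sums Polygamma 1 w" if "w \<noteq> 0" for w :: real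
    using summable_sums[OF Polygamma_converges'[OF that, of 2]] by (simp add: Polygamma_def divide_inverse power2_eq_square)
  show ?thesis unfolding 1[symmetric] by (rule sums_add[OF s[OF x0(1)] s[OF x0(2)]])
qed

text \<open>The value is computed from an ordinary series that pairs -k with k + 1; absolute
  convergence of the two half series turns it into the unordered sum that \<open>op_trace\<close>
  requires.\<close>

lemma has_sum_int_split:
  fixes f :: "int \<Rightarrow> 'a::banach"
  assumes s1: "summable (\<lambda>k. norm (f (- int k)))" and s2: "summable (\<lambda>k. norm (f (1 + int k)))"
    and S: "(\<lambda>k. f (- int k) + f (1 + int k)) sums S"
  shows "(f has_sum S) UNIV"
proof -
  have a: "(\<lambda>k. f (- int k)) sums (\<Sum>k. f (- int k))" and b: "(\<lambda>k. f (1 + int k)) sums (\<Sum>k. f (1 + int k))"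
    using s1 s2 by (auto intro: summable_sums summable_norm_cancel)
  have A: "(f has_sum (\<Sum>k. f (- int k))) (range (\<lambda>k. - int k))"
    using norm_summable_imp_has_sum[OF s1 a] by (subst has_sum_reindex) (auto simp: inj_def o_def)
  have B: "(f has_sum (\<Sum>k. f (1 + int k))) (range (\<lambda>k. 1 + int k))"
    using norm_summable_imp_has_sum[OF s2 b] by (subst has_sum_reindex) (auto simp: inj_def o_def)
  have "range (\<lambda>k. - int k) \<union> range (\<lambda>k. 1 + int k) = UNIV"
  proof -
    have "i \<in> range (\<lambda>k. - int k) \<union> range (\<lambda>k. 1 + int k)" for i
    proof (cases "i \<le> 0")
      case True
      hence "i = - int (nat (- i))" by simp
      thus ?thesis by blast
    next
      case False
      hence "i = 1 + int (nat (i - 1))" by simp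
      thus ?thesis by blast
    qed
    thus ?thesis by blast
  qed
  moreover have "range (\<lambda>k. - int k) \<inter> range (\<lambda>k. 1 + int k) = {}" by auto
  moreover have "S = (\<Sum>k. f (- int k)) + (\<Sum>k. f (1 + int k))"
    using sums_add[OF a b] S sums_unique2 by blast
  ultimately show ?thesis using has_sum_Un_disjoint[OF A B] by simp
qed

lemma has_sum_frac:
  fixes x y :: real
  assumes x: "x \<notin> \<int>" and y: "y \<notin> \<int>" 
  shows "((\<lambda>k::int. 1 / ((x - of_int k) * (y - of_int k))) has_sum
      (if x = y then pi^2 / (sin (pi * x))^2 else pi * (cot (pi * x) - cot (pi * y)) / (y - x))) UNIV"
proof (rule has_sum_int_split)
  have sq: "summable (\<lambda>k. norm (1 / ((a + real k) * (b + real k))))" if "a \<noteq> 0" "b \<noteq> 0" for a b :: real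
  proof (rule summable_comparison_test')
    show "summable (\<lambda>k. inverse ((a + real k)^2) + inverse ((b + real k)^2))"
      using that by (intro summable_add Polygamma_converges') auto
    fix k :: nat
    have "\<bar>u * v\<bar> \<le> u^2 + v^2" for u v :: real
    proof -
      have "2 * (\<bar>u\<bar> * \<bar>v\<bar>) \<le> u^2 + v^2" using sum_squares_bound[of "\<bar>u\<bar>" "\<bar>v\<bar>"] by simp
      moreover have "\<bar>u\<bar> * \<bar>v\<bar> \<ge> 0" by simp
      ultimately show ?thesis unfolding abs_mult by linarith
    qed
    from this[of "inverse (a + real k)" "inverse (b + real k)"]
    show "norm (norm (1 / ((a + real k) * (b + real k)))) \<le> inverse ((a + real k)^2) + inverse ((b + real k)^2)"
      by (simp add: divide_inverse power_inverse)
  qed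
  have nz: "x \<noteq> 0" "y \<noteq> 0" "1 - x \<noteq> 0" "1 - y \<noteq> 0" using x y by auto
  show "summable (\<lambda>k. norm (1 / ((x - of_int (- int k)) * (y - of_int (- int k)))))"
    using sq[OF nz(1,2)] by simp
  have m: "(x - of_int (1 + int k)) * (y - of_int (1 + int k)) = (1 - x + real k) * (1 - y + real k)" for k
    by (simp add: algebra_simps)
  show "summable (\<lambda>k. norm (1 / ((x - of_int (1 + int k)) * (y - of_int (1 + int k)))))"
    unfolding m by (rule sq[OF nz(3,4)])
  show "(\<lambda>k. 1 / ((x - of_int (- int k)) * (y - of_int (- int k))) + 1 / ((x - of_int (1 + int k)) * (y - of_int (1 + int k))))
    sums (if x = y then pi^2 / (sin (pi * x))^2 else pi * (cot (pi * x) - cot (pi * y)) / (y - x))"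
    unfolding m using frac_sums_cot[OF x y] frac_sums_csc[OF x] by auto
qed

lemma cis_minus_1: "cis (2 * w) - 1 = 2 * \<i> * of_real (sin w) * cis w"
proof -
  have "cis (2 * w) - 1 = (cis w - cis (- w)) * cis w"
    by (simp add: cis_mult left_diff_distrib)
  also have "cis w - cis (- w) = 2 * \<i> * of_real (sin w)"
    by (simp add: complex_eq_iff)
  finally show ?thesis .
qed

text \<open>Orthogonality of the exponentials \<open>onb T k\<close>, up to normalization.\<close>

lemma dirichlet_lattice:
  assumes T: "T > 0"
  shows "dirichlet T (2 * pi * of_int j / T) = (if j = 0 then of_real T else 0)"
proof (cases "j = 0")
  case False
  have "cis (2 * pi * of_int j / T * T) = cis (2 * pi * of_int j)" using T by simp
  also have "\<dots> = 1" by (rule cis_multiple_2pi) auto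
  finally show ?thesis using False T by (subst dirichlet_closed_form) auto
qed (use T dirichlet_0 in auto)

text \<open>Parseval's identity for the exponentials \<open>exp (i a t)\<close> and \<open>exp (i b t)\<close> on \<open>[0, T]\<close>: off the
  dual lattice it is the partial fraction expansion of the cotangent.\<close>

lemma dirichlet_discrete_reproducing:
  assumes T: "T > 0"
  shows "((\<lambda>k::int. dirichlet T (a - 2 * pi * of_int k / T) * dirichlet T (2 * pi * of_int k / T - b)) has_sum (T * dirichlet T (a - b))) UNIV"
proof -
  \<comment> \<open>Frequencies measured in units of the lattice spacing 2 pi / T. If x or y is an
    integer, only one term of the sum is nonzero.\<close>
  define x y where "x = a * T / (2 * pi)" and "y = b * T / (2 * pi)"
  have a: "a = 2 * pi * x / T" and b: "b = 2 * pi * y / T" using T by (simp_all add: x_def y_def)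
  consider j where "x = of_int j" | j where "y = of_int j" | "x \<notin> \<int>" "y \<notin> \<int>"
    by (auto elim!: Ints_cases)
  thus ?thesis
  proof cases
    case 1
    have "dirichlet T (a - 2 * pi * of_int k / T) = (if k = j then of_real T else 0)" for k
      using dirichlet_lattice[OF T, of "j - k"] by (auto simp: a 1 diff_divide_distrib right_diff_distrib)
    thus ?thesis by (intro has_sum_finite_neutralI[where B = "{j}"]) (auto simp: a 1 dirichlet_0 less_imp_le[OF T])
  next
    case 2
    have "dirichlet T (2 * pi * of_int k / T - b) = (if k = j then of_real T else 0)" for k
      using dirichlet_lattice[OF T, of "k - j"] by (auto simp: b 2 diff_divide_distrib right_diff_distrib)
    thus ?thesis by (intro has_sum_finite_neutralI[where B = "{j}"]) (auto simp: b 2 dirichlet_0 less_imp_le[OF T])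
  next
    case 3
    \<comment> \<open>The part of each summand that does not depend on k: the two phases multiply to
      one without k, and the two sines have a product without k.\<close>
    define c where "c = complex_of_real (T^2 / pi^2 * sin (pi * x) * sin (pi * y)) * cis (pi * (x - y))"
    have e: "dirichlet T (2 * pi * w / T) = of_real (T * sin (pi * w) / (pi * w)) * cis (pi * w)" if "w \<noteq> 0" for w
    proof -
      have "dirichlet T (2 * pi * w / T) = (cis (2 * (pi * w)) - 1) / (\<i> * of_real (2 * pi * w / T))"
        using T that by (subst dirichlet_closed_form) (auto simp: mult_ac)
      also have "\<dots> = of_real (T * sin (pi * w) / (pi * w)) * cis (pi * w)"
        unfolding cis_minus_1 using T that by (simp add: field_simps)
      finally show ?thesis .
    qed
    have summand: "dirichlet T (a - 2 * pi * of_int k / T) * dirichlet T (2 * pi * of_int k / T - b) = c * of_real (1 / ((x - of_int k) * (y - of_int k)))" for k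
    proof -
      have nz: "x - of_int k \<noteq> 0" "of_int k - y \<noteq> 0" using 3 by auto
      have 1: "a - 2 * pi * of_int k / T = 2 * pi * (x - of_int k) / T" "2 * pi * of_int k / T - b = 2 * pi * (of_int k - y) / T"
        by (simp_all add: a b diff_divide_distrib right_diff_distrib)
      \<comment> \<open>Translation by k multiplies each sine by cos (pi k), and the square of this
        sign is 1.\<close>
      have s: "sin (pi * (x - of_int k)) * sin (pi * (of_int k - y)) = - (sin (pi * x) * sin (pi * y))"
      proof -
        have s0: "sin (pi * of_int k) = 0" by (simp add: sin_zero_iff_int2 mult.commute)
        have c1: "cos (pi * of_int k) * cos (pi * of_int k) = 1"
          using sin_cos_squared_add[of "pi * of_int k"] by (simp add: power2_eq_square s0)
        have "sin (pi * (x - of_int k)) = sin (pi * x) * cos (pi * of_int k)" "sin (pi * (of_int k - y)) = - cos (pi * of_int k) * sin (pi * y)"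
          by (simp_all add: right_diff_distrib sin_diff s0)
        thus ?thesis using c1 by (simp add: algebra_simps)
      qed
      have "dirichlet T (a - 2 * pi * of_int k / T) * dirichlet T (2 * pi * of_int k / T - b) = 
        of_real (T * sin (pi * (x - of_int k)) / (pi * (x - of_int k)) * (T * sin (pi * (of_int k - y)) / (pi * (of_int k - y))))
         * (cis (pi * (x - of_int k)) * cis (pi * (of_int k - y)))"
        unfolding 1 e[OF nz(1)] e[OF nz(2)] by (simp add: mult_ac)
      also have "cis (pi * (x - of_int k)) * cis (pi * (of_int k - y)) = cis (pi * (x - y))"
        unfolding cis_mult by (simp add: algebra_simps)
      also have "T * sin (pi * (x - of_int k)) / (pi * (x - of_int k)) * (T * sin (pi * (of_int k - y)) / (pi * (of_int k - y)))
        = T^2 / pi^2 * (sin (pi * (x - of_int k)) * sin (pi * (of_int k - y))) / ((x - of_int k) * (of_int k - y))"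
        by (simp add: power2_eq_square mult_ac)
      also have "\<dots> = T^2 / pi^2 * (sin (pi * x) * sin (pi * y)) / ((x - of_int k) * (y - of_int k))"
        unfolding s using nz 3 by (simp add: divide_simps) (simp add: algebra_simps)
      finally show ?thesis by (simp add: c_def mult_ac)
    qed
    have sxy: "sin (pi * x) \<noteq> 0" "sin (pi * y) \<noteq> 0" using 3 by (auto simp: sin_zero_iff_int2 mult.commute)
    have fin: "c * of_real (if x = y then pi^2 / (sin (pi * x))^2 else pi * (cot (pi * x) - cot (pi * y)) / (y - x)) = T * dirichlet T (a - b)"
    proof (cases "x = y")
      case True
      thus ?thesis using sxy T by (simp add: c_def a b dirichlet_0 power2_eq_square)
    next
      case False
      have "sin (pi * x) * sin (pi * y) * (cot (pi * x) - cot (pi * y)) = sin (pi * y - pi * x)"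
        using sxy by (simp add: cot_def sin_diff field_simps)
      also have "\<dots> = sin (pi * (y - x))" by (simp add: right_diff_distrib)
      finally have "T^2 / pi^2 * sin (pi * x) * sin (pi * y) * (pi * (cot (pi * x) - cot (pi * y)) / (y - x)) = 
        T^2 / pi * sin (pi * (y - x)) / (y - x)" by (simp add: power2_eq_square mult_ac)
      also have "\<dots> = T * (T * sin (pi * (x - y)) / (pi * (x - y)))"
        using False sin_minus[of "pi * (x - y)"] by (simp add: power2_eq_square divide_simps algebra_simps)
      finally have r: "T^2 / pi^2 * sin (pi * x) * sin (pi * y) * (pi * (cot (pi * x) - cot (pi * y)) / (y - x)) = T * (T * sin (pi * (x - y)) / (pi * (x - y)))" .
      have "of_real A * z * of_real q = of_real (A * q) * z" for A q :: real and z :: complex by simp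
      hence "c * of_real (pi * (cot (pi * x) - cot (pi * y)) / (y - x)) = of_real (T * (T * sin (pi * (x - y)) / (pi * (x - y)))) * cis (pi * (x - y))"
        unfolding c_def r[symmetric] by blast
      also have "\<dots> = T * dirichlet T (2 * pi * (x - y) / T)"
        using False by (subst e) auto
      finally show ?thesis using False by (simp add: a b diff_divide_distrib right_diff_distrib)
    qed
    show ?thesis unfolding summand fin[symmetric]
      by (intro has_sum_cmult_right has_sum_of_real has_sum_frac 3)
  qed
qed

text \<open>B does not depend on a and b because translating k by the integer part of a T / (2 pi)
  reduces every sum to one fixed majorant g. This uniformity is what the exchange of sum and
  integral in the trace needs.\<close>

lemma dirichlet_discrete_bound:
  assumes T: "T > 0"
  shows "\<exists>B. \<forall>a b. (\<integral>\<^sup>+k. ennreal (norm (dirichlet T (a - 2 * pi * of_int k / T) * dirichlet T (2 * pi * of_int k / T - b))) \<partial>count_space (UNIV :: int set)) \<le> ennreal B"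
proof -
  \<comment> \<open>The maximum with 1 keeps the term l = 0 finite.\<close>
  define g where "g l = 1 / (max 1 \<bar>real_of_int l\<bar>)^2" for l
  have sg: "summable (\<lambda>k. norm (g (- int k)))" "summable (\<lambda>k. norm (g (1 + int k)))"
  proof -
    have q: "summable (\<lambda>k. 4 * inverse ((1 + real k)^2))"
      using Polygamma_converges'[of "1::real" 2] by (intro summable_mult) (auto simp: add.commute)
    have 1: "norm (norm (g (- int k))) \<le> 4 * inverse ((1 + real k)^2)" for k
    proof -
      have "1 + real k \<le> 2 * max 1 (real k)" by simp
      hence "(1 + real k)^2 \<le> (2 * max 1 (real k))^2" by (intro power_mono) auto
      hence "(1 + real k)^2 \<le> 4 * (max 1 (real k))^2" by (simp add: power_mult_distrib)
      thus ?thesis by (simp add: g_def field_simps)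
    qed
    have 2: "norm (norm (g (1 + int k))) \<le> 4 * inverse ((1 + real k)^2)" for k
      by (simp add: g_def field_simps max_def)
    show "summable (\<lambda>k. norm (g (- int k)))" by (rule summable_comparison_test'[OF q 1])
    show "summable (\<lambda>k. norm (g (1 + int k)))" by (rule summable_comparison_test'[OF q 2])
  qed
  have "summable (\<lambda>k. g (- int k) + g (1 + int k))"
    using sg by (intro summable_add) (auto intro: summable_norm_cancel)
  hence "g summable_on UNIV"
    using has_sum_int_split[OF sg summable_sums] by (auto simp: summable_on_def)
  moreover have "(\<lambda>l. norm (g l)) = g" by (auto simp: g_def)
  ultimately have "(\<lambda>l. norm (g l)) summable_on UNIV" by simp
  hence "integrable (count_space UNIV) g"
    using abs_summable_equivalent[of g UNIV] unfolding Infinite_Set_Sum.abs_summable_on_def by blast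
  hence fin: "(\<integral>\<^sup>+l. ennreal (g l) \<partial>count_space UNIV) < \<infinity>"
    by (simp add: integrable_iff_bounded g_def)
  have sh: "(\<integral>\<^sup>+k. ennreal (g (k - j)) \<partial>count_space UNIV) = (\<integral>\<^sup>+l. ennreal (g l) \<partial>count_space UNIV)" for j
    by (rule nn_integral_bij_count_space[where g = "\<lambda>k. k - j"])
       (rule bij_betwI[where g = "\<lambda>l. l + j"], auto)
  \<comment> \<open>The sign s serves both factors: the lattice point stands on the right of the
    difference in one and on the left in the other.\<close>
  have bd: "norm (dirichlet T (s * (a - 2 * pi * of_int k / T)))^2 \<le> 9 * T^2 * g (k - \<lfloor>a * T / (2 * pi)\<rfloor>)" if "\<bar>s\<bar> = 1" for a s k
  proof -
    define x j where "x = a * T / (2 * pi)" and "j = \<lfloor>a * T / (2 * pi)\<rfloor>"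
    have "T * \<bar>s * (a - 2 * pi * of_int k / T)\<bar> = \<bar>T * (a - 2 * pi * of_int k / T)\<bar>"
      using T that by (simp add: abs_mult)
    also have "T * (a - 2 * pi * of_int k / T) = 2 * pi * (x - of_int k)"
      using T by (simp add: x_def field_simps)
    also have "\<bar>2 * pi * (x - of_int k)\<bar> = (2 * pi) * \<bar>x - of_int k\<bar>" by (simp add: abs_mult)
    also have "\<dots> \<ge> 1 * \<bar>x - of_int k\<bar>"
      using pi_gt3 by (intro mult_right_mono) auto
    finally have *: "T * \<bar>s * (a - 2 * pi * of_int k / T)\<bar> \<ge> \<bar>x - of_int k\<bar>" by simp
    have "real_of_int j \<le> x" "x < real_of_int j + 1" unfolding x_def j_def by linarith+
    hence "max 1 \<bar>real_of_int (k - j)\<bar> \<le> 1 + \<bar>x - of_int k\<bar>" by (auto simp: max_def)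
    hence m: "max 1 \<bar>real_of_int (k - j)\<bar> \<le> 1 + T * \<bar>s * (a - 2 * pi * of_int k / T)\<bar>" using * by linarith
    have "norm (dirichlet T (s * (a - 2 * pi * of_int k / T)))^2 \<le> (3 * T / (1 + T * \<bar>s * (a - 2 * pi * of_int k / T)\<bar>))^2"
      by (intro power_mono norm_dirichlet_bound T) auto
    also have "\<dots> \<le> (3 * T / max 1 \<bar>real_of_int (k - j)\<bar>)^2"
      using m T by (intro power_mono divide_left_mono mult_pos_pos) (auto intro: add_pos_nonneg)
    also have "\<dots> = 9 * T^2 * g (k - j)" by (simp add: g_def power_divide power_mult_distrib)
    finally show ?thesis by (simp add: j_def)
  qed
  define B where "B = enn2real (ennreal (9 * T^2) * (\<integral>\<^sup>+l. ennreal (g l) \<partial>count_space UNIV) + ennreal (9 * T^2) * (\<integral>\<^sup>+l. ennreal (g l) \<partial>count_space UNIV))"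
  show ?thesis
  proof (intro exI allI)
    fix a b
    let ?ja = "\<lfloor>a * T / (2 * pi)\<rfloor>" and ?jb = "\<lfloor>b * T / (2 * pi)\<rfloor>"
    have pt: "norm (dirichlet T (a - 2 * pi * of_int k / T) * dirichlet T (2 * pi * of_int k / T - b)) \<le> 9 * T^2 * g (k - ?ja) + 9 * T^2 * g (k - ?jb)" for k
    proof -
      let ?p = "norm (dirichlet T (a - 2 * pi * of_int k / T))" and ?q = "norm (dirichlet T (2 * pi * of_int k / T - b))"
      have "?p^2 \<le> 9 * T^2 * g (k - ?ja)" "?q^2 \<le> 9 * T^2 * g (k - ?jb)"
        using bd[of 1 a k] bd[of "-1" b k] by simp_all
      moreover have "2 * ?p * ?q \<le> ?p^2 + ?q^2" "?p * ?q \<ge> 0" by (rule sum_squares_bound) simp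
      ultimately show ?thesis unfolding norm_mult by linarith
    qed
    have g0: "g l \<ge> 0" for l by (simp add: g_def)
    have "(\<integral>\<^sup>+k. ennreal (norm (dirichlet T (a - 2 * pi * of_int k / T) * dirichlet T (2 * pi * of_int k / T - b))) \<partial>count_space (UNIV :: int set))
      \<le> (\<integral>\<^sup>+k. ennreal (9 * T^2) * ennreal (g (k - ?ja)) + ennreal (9 * T^2) * ennreal (g (k - ?jb)) \<partial>count_space UNIV)"
      by (intro nn_integral_mono) (use pt g0 in \<open>simp add: ennreal_mult[symmetric] ennreal_plus[symmetric] ennreal_leI del: ennreal_plus\<close>)
    also have "\<dots> = ennreal (9 * T^2) * (\<integral>\<^sup>+l. ennreal (g l) \<partial>count_space UNIV) + ennreal (9 * T^2) * (\<integral>\<^sup>+l. ennreal (g l) \<partial>count_space UNIV)"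
      by (simp add: nn_integral_add nn_integral_cmult sh)
    also have "\<dots> = ennreal B"
      unfolding B_def using fin by (subst ennreal_enn2real) (auto simp: ennreal_mult_less_top)
    finally show "(\<integral>\<^sup>+k. ennreal (norm (dirichlet T (a - 2 * pi * of_int k / T) * dirichlet T (2 * pi * of_int k / T - b))) \<partial>count_space (UNIV :: int set)) \<le> ennreal B" .
  qed
qed

section \<open>The trace formula\<close>

abbreviation PL :: "nat set \<Rightarrow> (nat \<Rightarrow> real) measure" where
  "PL I \<equiv> PiM I (\<lambda>_. lborel)"

interpretation PL: product_sigma_finite "\<lambda>_::nat. lborel :: real measure" ..

lemma sigma_finite_PL: "finite I \<Longrightarrow> sigma_finite_measure (PL I)"
  by (intro PL.sigma_finite)

lemma measurable_component_PL: "i \<in> I \<Longrightarrow> (\<lambda>w. w i) \<in> borel_measurable (PL I)"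
  using measurable_component_singleton[of i I "\<lambda>_. lborel :: real measure"] by simp

lemma ft_cis: "ft f t = (LINT l|lborel. cis (l * t) * complex_of_real (f l))"
  by (simp add: ft_def cis_conv_exp)

lemma ft_eq_cft: "ft f = cft (\<lambda>l. complex_of_real (f l))"
  by (simp add: fun_eq_iff ft_cis cft_def)

lemma measurable_ft [measurable]: "f \<in> borel_measurable borel \<Longrightarrow> ft f \<in> borel_measurable borel"
  unfolding ft_eq_cft by (rule measurable_cft) simp

lemma norm_ft_le: "norm (ft f t) \<le> (LINT l|lborel. \<bar>f l\<bar>)"
  using norm_cft_le[of "\<lambda>l. complex_of_real (f l)" t] by (simp add: ft_eq_cft)

lemma ft_modulated_integral:
  assumes h: "integrable lborel h"
  shows "(LINT s|lborel. indicator {0..T} s *\<^sub>R (ft h (t - s) * cis (q * s)))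
    = (LINT l|lborel. cis (l * t) * of_real (h l) * dirichlet T (q - l))"
proof -
  have [measurable]: "h \<in> borel_measurable borel" using h by auto
  have "(LINT s|lborel. indicator {0..T} s *\<^sub>R (ft h (t - s) * cis (q * s)))
      = (LINT s|lborel. LINT l|lborel. indicator {0..T} s *\<^sub>R (cis (l * (t - s)) * of_real (h l) * cis (q * s)))"
    unfolding ft_cis by simp
  also have "\<dots> = (LINT l|lborel. LINT s|lborel. indicator {0..T} s *\<^sub>R (cis (l * (t - s)) * of_real (h l) * cis (q * s)))"
    by (rule lborel_pair.Fubini_pair[OF integrable_indicator_Icc[of 0 T] h]) (auto simp: norm_mult)
  also have "\<dots> = (LINT l|lborel. LINT s|lborel. (cis (l * t) * of_real (h l)) * (indicator {0..T} s *\<^sub>R cis ((q - l) * s)))"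
  proof (intro Bochner_Integration.integral_cong refl)
    fix l s :: real
    have "cis (l * (t - s)) * cis (q * s) = cis (l * t) * cis ((q - l) * s)"
      unfolding cis_mult by (simp add: algebra_simps)
    thus "indicator {0..T} s *\<^sub>R (cis (l * (t - s)) * complex_of_real (h l) * cis (q * s)) =
      cis (l * t) * complex_of_real (h l) * (indicator {0..T} s *\<^sub>R cis ((q - l) * s))"
      by (simp add: mult_ac scaleR_conv_of_real)
  qed
  also have "\<dots> = (LINT l|lborel. cis (l * t) * of_real (h l) * dirichlet T (q - l))"
    unfolding dirichlet_def by (simp only: integral_mult_right_zero)
  finally show ?thesis .
qed

text \<open>Superpositions of exponentials with an integrable density are mapped to such
  superpositions. Each operator adds one frequency l and one kernel that links l to the previous
  frequency, so a product of operators can be treated by induction.\<close>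

lemma toeplitz_integral:
  fixes R :: "'a \<Rightarrow> complex"
  assumes N: "sigma_finite_measure N" and R: "integrable N R" and q[measurable]: "q \<in> borel_measurable N"
    and h: "integrable lborel h"
  shows "toeplitz T h (\<lambda>s. LINT w|N. cis (q w * s) * R w) t
    = (LINT w|N. LINT l|lborel. cis (l * t) * (of_real (h l) * R w * dirichlet T (q w - l)))"
proof -
  have [measurable]: "h \<in> borel_measurable borel" "R \<in> borel_measurable N" using h R by auto
  interpret N: sigma_finite_measure N by fact
  interpret P: pair_sigma_finite lborel N ..
  have "toeplitz T h (\<lambda>s. LINT w|N. cis (q w * s) * R w) t
    = (LINT s|lborel. LINT w|N. indicator {0..T} s *\<^sub>R (ft h (t - s) * (cis (q w * s) * R w)))"
    unfolding toeplitz_def set_lebesgue_integral_def by simp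
  also have "\<dots> = (LINT w|N. LINT s|lborel. indicator {0..T} s *\<^sub>R (ft h (t - s) * (cis (q w * s) * R w)))"
  proof (rule P.Fubini_pair[where f = "\<lambda>s. indicator {0..T} s *\<^sub>R (LINT l|lborel. \<bar>h l\<bar>)" and g = R])
    show "norm (indicator {0..T} x *\<^sub>R (ft h (t - x) * (cis (q y * x) * R y))) \<le> norm (indicator {0..T} x *\<^sub>R (LINT l|lborel. \<bar>h l\<bar>)) * norm (R y)" for x y
    proof -
      have "norm (ft h (t - x)) * norm (R y) \<le> \<bar>LINT l|lborel. \<bar>h l\<bar>\<bar> * norm (R y)"
        by (intro mult_right_mono order_trans[OF norm_ft_le]) auto
      thus ?thesis by (auto simp: norm_mult split: split_indicator)
    qed
  qed (auto intro!: R integrable_indicator_Icc)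
  also have "\<dots> = (LINT w|N. R w * (LINT s|lborel. indicator {0..T} s *\<^sub>R (ft h (t - s) * cis (q w * s))))"
    by (subst integral_mult_right_zero[symmetric]) (simp add: mult_ac scaleR_conv_of_real)
  also have "\<dots> = (LINT w|N. LINT l|lborel. cis (l * t) * (of_real (h l) * R w * dirichlet T (q w - l)))"
    unfolding ft_modulated_integral[OF h]
    by (subst integral_mult_right_zero[symmetric]) (simp add: mult_ac)
  finally show ?thesis .
qed

lemma onb_cis: "onb T k t = cis (2 * pi * of_int k / T * t) / of_real (sqrt T)"
proof -
  have "2 * complex_of_real pi * \<i> * of_int k * complex_of_real (t / T) = \<i> * complex_of_real (2 * pi * of_int k / T * t)"
    by simp
  thus ?thesis unfolding onb_def cis_conv_exp by (simp only:)
qed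

text \<open>The density, in the frequencies w_j, ..., w_m, of the last m - j + 1 operators applied
  to a basis vector. The slot \<open>Suc m\<close> holds the frequency \<kappa> of that vector, and
  the square root of T is its normalization.\<close>

definition trace_weight :: "real \<Rightarrow> nat \<Rightarrow> (nat \<Rightarrow> real \<Rightarrow> real) \<Rightarrow> real \<Rightarrow> nat \<Rightarrow> (nat \<Rightarrow> real) \<Rightarrow> complex" where
  "trace_weight T m h \<kappa> j w = (\<Prod>i\<in>{j..m}. of_real (h i (w i)) * dirichlet T ((w(Suc m := \<kappa>)) (Suc i) - w i)) / of_real (sqrt T)"

lemma measurable_update_component:
  assumes "finite I" "i \<in> insert j I"
  shows "(\<lambda>w. (w(j := \<kappa>)) i) \<in> borel_measurable (PL I)"
proof (cases "i = j")
  case False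
  hence "i \<in> I" using assms by auto
  hence "(\<lambda>w. w i) \<in> borel_measurable (PL I)" by (rule measurable_component_PL)
  thus ?thesis using False by simp
qed simp

lemma integrable_trace_weight:
  assumes T: "T > 0" and h: "\<forall>i\<in>{1..m}. integrable lborel (h i)" and j: "j \<ge> 1"
  shows "integrable (PL {j..m}) (trace_weight T m h \<kappa> j)"
proof (rule Bochner_Integration.integrable_bound)
  have [measurable]: "h i \<in> borel_measurable borel" if "i \<in> {j..m}" for i
    using h j that by force
  show "integrable (PL {j..m}) (\<lambda>w. (\<Prod>i\<in>{j..m}. T * \<bar>h i (w i)\<bar>) / sqrt T)"
    using h j by (intro integrable_divide PL.product_integrable_prod integrable_mult_right integrable_abs) auto
  have m1: "(\<lambda>w. (w(Suc m := \<kappa>)) (Suc i) - w i) \<in> borel_measurable (PL {j..m})" if "i \<in> {j..m}" for i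
    using that by (intro borel_measurable_diff measurable_update_component) (auto intro!: measurable_component_singleton)
  have m2: "(\<lambda>w. complex_of_real (h i (w i))) \<in> borel_measurable (PL {j..m})" if "i \<in> {j..m}" for i
    using that by measurable
  show "trace_weight T m h \<kappa> j \<in> borel_measurable (PL {j..m})"
    unfolding trace_weight_def
    by (intro borel_measurable_divide borel_measurable_prod borel_measurable_times m2
          measurable_compose[OF m1 measurable_dirichlet]) auto
  have "norm (trace_weight T m h \<kappa> j w) \<le> norm ((\<Prod>i\<in>{j..m}. T * \<bar>h i (w i)\<bar>) / sqrt T)" for w
  proof -
    have "norm (trace_weight T m h \<kappa> j w) = (\<Prod>i\<in>{j..m}. \<bar>h i (w i)\<bar> * norm (dirichlet T ((w(Suc m := \<kappa>)) (Suc i) - w i))) / sqrt T"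
      using T by (simp add: trace_weight_def norm_divide prod_norm[symmetric] norm_mult)
    also have "\<dots> \<le> (\<Prod>i\<in>{j..m}. T * \<bar>h i (w i)\<bar>) / sqrt T"
    proof (intro divide_right_mono prod_mono conjI)
      fix i
      have "\<bar>h i (w i)\<bar> * norm (dirichlet T ((w(Suc m := \<kappa>)) (Suc i) - w i)) \<le> \<bar>h i (w i)\<bar> * T"
        using T by (intro mult_left_mono norm_dirichlet_le) auto
      thus "\<bar>h i (w i)\<bar> * norm (dirichlet T ((w(Suc m := \<kappa>)) (Suc i) - w i)) \<le> T * \<bar>h i (w i)\<bar>" by (simp add: mult.commute)
    qed (use T in auto)
    also have "\<dots> \<le> norm \<dots>" unfolding real_norm_def by (rule abs_ge_self)
    finally show ?thesis .
  qed
  thus "AE w in PL {j..m}. norm (trace_weight T m h \<kappa> j w) \<le> norm ((\<Prod>i\<in>{j..m}. T * \<bar>h i (w i)\<bar>) / sqrt T)" by simp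
qed

text \<open>Downward induction on j, since \<open>foldr\<close> applies the last operator first. At
  j = m + 1 the integral is over the one-point space \<open>PL {}\<close> and returns the basis
  vector itself.\<close>

lemma foldr_toeplitz_onb:
  fixes k :: int
  assumes T: "T > 0" and h: "\<forall>i\<in>{1..m}. integrable lborel (h i)" and j: "1 \<le> j" "j \<le> Suc m"
  defines "\<kappa> \<equiv> 2 * pi * of_int k / T"
  shows "foldr (\<lambda>i v. toeplitz T (h i) v) [j..<m+1] (onb T k) =
    (\<lambda>t. LINT w|PL {j..m}. cis ((w(Suc m := \<kappa>)) j * t) * trace_weight T m h \<kappa> j w)"
  using j(2) j(1)
proof (induction rule: inc_induct)
  case base
  show ?case
    by (auto simp: fun_eq_iff onb_cis trace_weight_def PiM_empty lebesgue_integral_count_space_finite \<kappa>_def[symmetric])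
next
  case (step n)
  have n: "n \<in> {1..m}" using step by auto
  have hn: "integrable lborel (h n)" using h n by auto
  have ins: "{n..m} = insert n {Suc n..m}" using n by auto
  show ?case
  proof
    fix t
    have "foldr (\<lambda>i v. toeplitz T (h i) v) [n..<m+1] (onb T k) t
      = toeplitz T (h n) (\<lambda>s. LINT w|PL {Suc n..m}. cis ((w(Suc m := \<kappa>)) (Suc n) * s) * trace_weight T m h \<kappa> (Suc n) w) t"
      using step n by (subst upt_conv_Cons) auto
    also have "\<dots> = (LINT w|PL {Suc n..m}. LINT l|lborel. cis (l * t) * (of_real (h n l) * trace_weight T m h \<kappa> (Suc n) w * dirichlet T ((w(Suc m := \<kappa>)) (Suc n) - l)))"
      using n by (intro toeplitz_integral sigma_finite_PL integrable_trace_weight T h hn measurable_update_component) auto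
    also have "\<dots> = (LINT w|PL {Suc n..m}. LINT l|lborel. cis (((w(n := l))(Suc m := \<kappa>)) n * t) * trace_weight T m h \<kappa> n (w(n := l)))"
    proof (intro Bochner_Integration.integral_cong refl arg_cong2[where f = "(*)"])
      fix w :: "nat \<Rightarrow> real" and l :: real
      show "cis (l * t) = cis (((w(n := l))(Suc m := \<kappa>)) n * t)" using n by simp
      have "trace_weight T m h \<kappa> n (w(n := l)) = of_real (h n l) * dirichlet T ((w(Suc m := \<kappa>)) (Suc n) - l) *
         (\<Prod>i\<in>{Suc n..m}. of_real (h i ((w(n := l)) i)) * dirichlet T (((w(n := l))(Suc m := \<kappa>)) (Suc i) - (w(n := l)) i)) / of_real (sqrt T)"
        unfolding trace_weight_def ins using n by (subst prod.insert) auto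
      also have "(\<Prod>i\<in>{Suc n..m}. of_real (h i ((w(n := l)) i)) * dirichlet T (((w(n := l))(Suc m := \<kappa>)) (Suc i) - (w(n := l)) i))
        = (\<Prod>i\<in>{Suc n..m}. of_real (h i (w i)) * dirichlet T ((w(Suc m := \<kappa>)) (Suc i) - w i))"
        by (intro prod.cong) auto
      finally show "of_real (h n l) * trace_weight T m h \<kappa> (Suc n) w * dirichlet T ((w(Suc m := \<kappa>)) (Suc n) - l) = trace_weight T m h \<kappa> n (w(n := l))"
        unfolding trace_weight_def[of T m h \<kappa> "Suc n"] by (simp only: mult_ac times_divide_eq_left times_divide_eq_right)
    qed
    also have "\<dots> = (LINT w|PL {n..m}. cis ((w(Suc m := \<kappa>)) n * t) * trace_weight T m h \<kappa> n w)"
    proof -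
      have "integrable (PL {n..m}) (\<lambda>w. cis ((w(Suc m := \<kappa>)) n * t) * trace_weight T m h \<kappa> n w)"
        using n by (intro integrable_cis_mult integrable_trace_weight T h borel_measurable_times measurable_update_component) auto
      thus ?thesis unfolding ins by (subst PL.product_integral_insert) auto
    qed
    finally show "foldr (\<lambda>i v. toeplitz T (h i) v) [n..<m+1] (onb T k) t = \<dots>" .
  qed
qed

text \<open>Pairing with the same basis vector joins w_1 to \<kappa>, and the first operator applied
  had already joined \<kappa> to w_m. These two kernels are kept apart because the sum over k
  concerns nothing else; the two normalizations multiply to 1 / T.\<close>

lemma trace_summand:
  fixes k :: int
  assumes T: "T > 0" and m: "m \<ge> 1" and h: "\<forall>i\<in>{1..m}. integrable lborel (h i)"
  defines "\<kappa> \<equiv> 2 * pi * of_int k / T"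
  shows "(LINT t:{0..T}|lborel. toeplitz_prod T m h (onb T k) t * cnj (onb T k t)) =
    (LINT w|PL {1..m}. (\<Prod>i\<in>{1..m}. of_real (h i (w i))) * (\<Prod>i\<in>{1..<m}. dirichlet T (w (Suc i) - w i)) / of_real T
       * (dirichlet T (w 1 - \<kappa>) * dirichlet T (\<kappa> - w m)))"
proof -
  interpret N: sigma_finite_measure "PL {1..m}" by (rule sigma_finite_PL) simp
  interpret P: pair_sigma_finite lborel "PL {1..m}" ..
  let ?R = "trace_weight T m h \<kappa> 1"
  have R: "integrable (PL {1..m}) ?R" by (rule integrable_trace_weight[OF T h]) simp
  hence [measurable]: "?R \<in> borel_measurable (PL {1..m})" by auto
  have [measurable]: "(\<lambda>w. w 1) \<in> borel_measurable (PL {1..m})"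
    using m by (intro measurable_component_PL) auto
  have tp: "toeplitz_prod T m h (onb T k) t = (LINT w|PL {1..m}. cis (w 1 * t) * ?R w)" for t
    unfolding toeplitz_prod_def using foldr_toeplitz_onb[OF T h, of 1 k] m by (simp add: \<kappa>_def)
  have sT: "complex_of_real (sqrt T) * complex_of_real (sqrt T) = of_real T"
    using T by (simp flip: of_real_mult)
  have "(LINT t:{0..T}|lborel. toeplitz_prod T m h (onb T k) t * cnj (onb T k t))
     = (LINT t|lborel. LINT w|PL {1..m}. indicator {0..T} t *\<^sub>R (cis (w 1 * t) * ?R w * (cis (- (\<kappa> * t)) / of_real (sqrt T))))"
    unfolding set_lebesgue_integral_def tp onb_cis \<kappa>_def[symmetric] by (simp add: cis_cnj)
  also have "\<dots> = (LINT w|PL {1..m}. LINT t|lborel. indicator {0..T} t *\<^sub>R (cis (w 1 * t) * ?R w * (cis (- (\<kappa> * t)) / of_real (sqrt T))))"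
  proof (rule P.Fubini_pair[where f = "\<lambda>t. indicator {0..T} t *\<^sub>R (1 / sqrt T)", OF _ R])
    show "integrable lborel (\<lambda>t. indicator {0..T} t *\<^sub>R (1 / sqrt T))"
      using T by auto
    show "(\<lambda>(t, w). indicator {0..T} t *\<^sub>R (cis (w 1 * t) * ?R w * (cis (- (\<kappa> * t)) / of_real (sqrt T)))) \<in> borel_measurable (lborel \<Otimes>\<^sub>M PL {1..m})"
      by measurable
  qed (use T in \<open>auto simp: norm_mult norm_divide split: split_indicator\<close>)
  also have "\<dots> = (LINT w|PL {1..m}. LINT t|lborel. (?R w / of_real (sqrt T)) * (indicator {0..T} t *\<^sub>R cis ((w 1 - \<kappa>) * t)))"
  proof (intro Bochner_Integration.integral_cong refl)
    fix w :: "nat \<Rightarrow> real" and t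
    have "cis (w 1 * t) * cis (- (\<kappa> * t)) = cis ((w 1 - \<kappa>) * t)" unfolding cis_mult by (simp add: algebra_simps)
    thus "indicator {0..T} t *\<^sub>R (cis (w 1 * t) * ?R w * (cis (- (\<kappa> * t)) / of_real (sqrt T))) =
      (?R w / of_real (sqrt T)) * (indicator {0..T} t *\<^sub>R cis ((w 1 - \<kappa>) * t))"
      by (simp add: mult_ac scaleR_conv_of_real)
  qed
  also have "\<dots> = (LINT w|PL {1..m}. (?R w / of_real (sqrt T)) * dirichlet T (w 1 - \<kappa>))"
    unfolding dirichlet_def by (simp only: integral_mult_right_zero)
  also have "\<dots> = (LINT w|PL {1..m}. (\<Prod>i\<in>{1..m}. of_real (h i (w i))) * (\<Prod>i\<in>{1..<m}. dirichlet T (w (Suc i) - w i)) / of_real T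
       * (dirichlet T (w 1 - \<kappa>) * dirichlet T (\<kappa> - w m)))"
  proof (intro Bochner_Integration.integral_cong refl)
    fix w :: "nat \<Rightarrow> real"
    have ins: "{1..m} = insert m {1..<m}" using m by auto
    have "(\<Prod>i\<in>{1..m}. dirichlet T ((w(Suc m := \<kappa>)) (Suc i) - w i)) = dirichlet T (\<kappa> - w m) * (\<Prod>i\<in>{1..<m}. dirichlet T ((w(Suc m := \<kappa>)) (Suc i) - w i))"
      unfolding ins by (subst prod.insert) auto
    also have "(\<Prod>i\<in>{1..<m}. dirichlet T ((w(Suc m := \<kappa>)) (Suc i) - w i)) = (\<Prod>i\<in>{1..<m}. dirichlet T (w (Suc i) - w i))"
      by (intro prod.cong) auto
    finally have "?R w / of_real (sqrt T) = (\<Prod>i\<in>{1..m}. of_real (h i (w i))) * (dirichlet T (\<kappa> - w m) * (\<Prod>i\<in>{1..<m}. dirichlet T (w (Suc i) - w i))) / of_real T"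
      unfolding trace_weight_def prod.distrib using sT by (simp add: divide_divide_eq_left)
    thus "(?R w / of_real (sqrt T)) * dirichlet T (w 1 - \<kappa>) = (\<Prod>i\<in>{1..m}. of_real (h i (w i))) * (\<Prod>i\<in>{1..<m}. dirichlet T (w (Suc i) - w i)) / of_real T
       * (dirichlet T (w 1 - \<kappa>) * dirichlet T (\<kappa> - w m))"
      by (simp add: mult_ac)
  qed
  finally show ?thesis .
qed

text \<open>Fubini for the counting measure: because B is uniform in w, integrability of A alone
  gives integrability on the product space.\<close>

lemma infsum_integral_swap:
  fixes A :: "'a \<Rightarrow> complex" and c :: "int \<Rightarrow> 'a \<Rightarrow> complex"
  assumes N: "sigma_finite_measure N" and A: "integrable N A" and c[measurable]: "\<And>k. c k \<in> borel_measurable N"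
    and B: "\<And>w. (\<integral>\<^sup>+k. ennreal (norm (c k w)) \<partial>count_space UNIV) \<le> ennreal B"
    and S: "\<And>w. ((\<lambda>k. c k w) has_sum S w) UNIV"
  shows "(\<Sum>\<^sub>\<infinity>k. LINT w|N. A w * c k w) = (LINT w|N. A w * S w)"
proof -
  interpret N: sigma_finite_measure N by fact
  have sc: "sigma_finite_measure (count_space (UNIV :: int set))"
    by (rule sigma_finite_measure_count_space)
  interpret P: pair_sigma_finite "count_space (UNIV :: int set)" N
    by (intro pair_sigma_finite.intro sc N)
  have [measurable]: "A \<in> borel_measurable N" using A by auto
  have m: "(\<lambda>(k, w). A w * c k w) \<in> borel_measurable (count_space UNIV \<Otimes>\<^sub>M N)"
    by (rule measurable_pair_measure_countable1) auto
  have "(\<integral>\<^sup>+z. ennreal (norm (case z of (k, w) \<Rightarrow> A w * c k w)) \<partial>(count_space UNIV \<Otimes>\<^sub>M N)) = 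
     (\<integral>\<^sup>+w. \<integral>\<^sup>+k. ennreal (norm (A w * c k w)) \<partial>count_space UNIV \<partial>N)"
    using m by (subst P.nn_integral_snd[symmetric]) auto
  also have "\<dots> = (\<integral>\<^sup>+w. ennreal (norm (A w)) * (\<integral>\<^sup>+k. ennreal (norm (c k w)) \<partial>count_space UNIV) \<partial>N)"
    by (simp add: norm_mult ennreal_mult nn_integral_cmult)
  also have "\<dots> \<le> (\<integral>\<^sup>+w. ennreal (norm (A w)) * ennreal B \<partial>N)"
    by (intro nn_integral_mono mult_left_mono B) auto
  also have "\<dots> = (\<integral>\<^sup>+w. ennreal (norm (A w)) \<partial>N) * ennreal B"
    by (simp add: nn_integral_multc)
  also have "\<dots> < \<infinity>" using A by (auto simp: integrable_iff_bounded ennreal_mult_less_top)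
  finally have i: "integrable (count_space UNIV \<Otimes>\<^sub>M N) (\<lambda>(k, w). A w * c k w)"
    using m by (simp add: integrable_iff_bounded)
  have ck: "integrable (count_space UNIV) (\<lambda>k. c k w)" for w
    using B[of w] by (auto simp: integrable_iff_bounded intro: le_less_trans)
  have inner: "(LINT k|count_space UNIV. A w * c k w) = A w * S w" for w
  proof -
    have "(LINT k|count_space UNIV. c k w) = (\<Sum>\<^sub>\<infinity>k. c k w)"
      using infsetsum_infsum[of "\<lambda>k. c k w" UNIV] ck[of w] by (simp add: infsetsum_def Infinite_Set_Sum.abs_summable_on_def)
    also have "\<dots> = S w" by (rule infsumI[OF S])
    finally show ?thesis by simp
  qed
  have "integrable (count_space UNIV) (\<lambda>k. LINT w|N. A w * c k w)"
    using P.integrable_fst[OF i] .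
  hence "(\<Sum>\<^sub>\<infinity>k. LINT w|N. A w * c k w) = (LINT k|count_space UNIV. LINT w|N. A w * c k w)"
    using infsetsum_infsum[of "\<lambda>k. LINT w|N. A w * c k w" UNIV] by (simp add: infsetsum_def Infinite_Set_Sum.abs_summable_on_def)
  also have "\<dots> = (LINT w|N. LINT k|count_space UNIV. A w * c k w)"
    by (rule P.Fubini_integral[OF i, symmetric])
  finally show ?thesis unfolding inner .
qed

lemma integrable_prod_components:
  assumes "\<And>i. i \<in> {1..m} \<Longrightarrow> integrable lborel (f i)"
    and "q \<in> borel_measurable (PL {1..m})" "\<And>w. norm (q w) \<le> B"
  shows "integrable (PL {1..m}) (\<lambda>w. (\<Prod>i\<in>{1..m}. f i (w i) :: complex) * (q w :: complex))"
proof (rule Bochner_Integration.integrable_bound)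
  show i: "integrable (PL {1..m}) (\<lambda>w. B * norm (\<Prod>i\<in>{1..m}. f i (w i)))"
    using assms by (intro integrable_mult_right integrable_norm PL.product_integrable_prod) auto
  have "integrable (PL {1..m}) (\<lambda>w. (\<Prod>i\<in>{1..m}. f i (w i)))"
    using assms by (intro PL.product_integrable_prod) auto
  thus "(\<lambda>w. (\<Prod>i\<in>{1..m}. f i (w i)) * q w) \<in> borel_measurable (PL {1..m})"
    using assms(2) by (intro borel_measurable_times) auto
  have "norm ((\<Prod>i\<in>{1..m}. f i (w i)) * q w) \<le> norm (B * norm (\<Prod>i\<in>{1..m}. f i (w i)))" for w
  proof -
    have "0 \<le> B" using assms(3)[of w] norm_ge_zero[of "q w"] by linarith
    thus ?thesis using mult_left_mono[OF assms(3)[of w] norm_ge_zero[of "\<Prod>i\<in>{1..m}. f i (w i)"]]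
      by (simp add: norm_mult mult.commute)
  qed
  thus "AE w in PL {1..m}. norm ((\<Prod>i\<in>{1..m}. f i (w i)) * q w) \<le> norm (B * norm (\<Prod>i\<in>{1..m}. f i (w i)))" by simp
qed

definition cyc_dirichlet :: "real \<Rightarrow> nat \<Rightarrow> (nat \<Rightarrow> real) \<Rightarrow> complex" where
  "cyc_dirichlet T m w = (\<Prod>i\<in>{1..<m}. dirichlet T (w (Suc i) - w i)) * dirichlet T (w 1 - w m)"

text \<open>Summing over k eliminates the basis: the two kernels at \<kappa> collapse to T times the
  kernel from w_m to w_1, and this T cancels the normalization 1 / T.\<close>

lemma trace_formula:
  assumes T: "T > 0" and m: "m \<ge> 1" and h: "\<forall>i\<in>{1..m}. integrable lborel (h i)"
  shows "op_trace T (toeplitz_prod T m h) = (LINT w|PL {1..m}. (\<Prod>i\<in>{1..m}. of_real (h i (w i))) * cyc_dirichlet T m w)"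
proof -
  obtain B where B: "\<And>a b. (\<integral>\<^sup>+k. ennreal (norm (dirichlet T (a - 2 * pi * of_int k / T) * dirichlet T (2 * pi * of_int k / T - b))) \<partial>count_space (UNIV :: int set)) \<le> ennreal B"
    using dirichlet_discrete_bound[OF T] by auto
  have [measurable]: "(\<lambda>w. w 1) \<in> borel_measurable (PL {1..m})" "(\<lambda>w. w m) \<in> borel_measurable (PL {1..m})"
    using m by (auto intro!: measurable_component_PL)
  have q: "(\<lambda>w. \<Prod>i\<in>{1..<m}. dirichlet T (w (Suc i) - w i)) \<in> borel_measurable (PL {1..m})"
    by (intro borel_measurable_prod measurable_compose[OF _ measurable_dirichlet] borel_measurable_diff measurable_component_PL) auto
  have "norm (\<Prod>i\<in>{1..<m}. dirichlet T (w (Suc i) - w i)) \<le> (\<Prod>i\<in>{1..<m}. T)" for w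
    unfolding prod_norm[symmetric] by (intro prod_mono) (use T norm_dirichlet_le in auto)
  from integrable_prod_components[OF _ q this, of "\<lambda>i x. of_real (h i x)"]
  have A: "integrable (PL {1..m}) (\<lambda>w. (\<Prod>i\<in>{1..m}. of_real (h i (w i))) * (\<Prod>i\<in>{1..<m}. dirichlet T (w (Suc i) - w i)) / of_real T)"
    using h by (intro integrable_divide) auto
  have "op_trace T (toeplitz_prod T m h) = (LINT w|PL {1..m}. (\<Prod>i\<in>{1..m}. of_real (h i (w i))) * (\<Prod>i\<in>{1..<m}. dirichlet T (w (Suc i) - w i)) / of_real T
     * (T * dirichlet T (w 1 - w m)))"
    unfolding op_trace_def trace_summand[OF T m h]
  proof (rule infsum_integral_swap[OF _ A _ B])
    show "(\<lambda>w. dirichlet T (w 1 - 2 * pi * of_int k / T) * dirichlet T (2 * pi * of_int k / T - w m)) \<in> borel_measurable (PL {1..m})" for k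
      by measurable
  qed (auto intro: sigma_finite_PL dirichlet_discrete_reproducing[OF T])
  thus ?thesis using T by (simp add: cyc_dirichlet_def mult_ac)
qed

section \<open>Differences as integration variables\<close>

text \<open>Throughout, \<open>u(0 := 0)\<close> implements the convention \<open>u_0 = 0\<close>.\<close>

definition anchored :: "nat \<Rightarrow> real \<Rightarrow> (nat \<Rightarrow> real) \<Rightarrow> nat \<Rightarrow> real" where
  "anchored n x u = (\<lambda>i\<in>{1..Suc n}. x - (u(0 := 0)) (i - 1))"

lemma measurable_anchored [measurable]:
  "(\<lambda>(x, u). anchored n x u) \<in> measurable (lborel \<Otimes>\<^sub>M PL {1..n}) (PL {1..Suc n})"
proof -
  have "(\<lambda>z. fst z - ((snd z)(0 := 0)) (i - 1)) \<in> measurable (lborel \<Otimes>\<^sub>M PL {1..n}) lborel" if "i \<in> {1..Suc n}" for i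
  proof -
    have "(\<lambda>u. (u(0 := 0)) (i - 1)) \<in> borel_measurable (PL {1..n})"
      using that by (intro measurable_update_component) auto
    from borel_measurable_diff[OF measurable_compose[OF measurable_fst measurable_ident] measurable_compose[OF measurable_snd this]]
    show ?thesis by simp
  qed
  thus ?thesis unfolding anchored_def case_prod_unfold by (rule measurable_restrict)
qed

lemma emeasure_lborel_reflect:
  assumes [measurable]: "A \<in> sets borel"
  shows "emeasure lborel {y. x - y \<in> A} = emeasure lborel (A :: real set)"
proof -
  have "emeasure lborel A = (\<integral>\<^sup>+y. indicator A y \<partial>lborel)" by simp
  also have "\<dots> = ennreal \<bar>-1::real\<bar> * (\<integral>\<^sup>+y. indicator A (x + (-1) * y) \<partial>lborel)"
    by (rule nn_integral_real_affine) auto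
  also have "\<dots> = (\<integral>\<^sup>+y. indicator {y. x - y \<in> A} y \<partial>lborel)"
    by (simp add: indicator_def)
  also have "\<dots> = emeasure lborel {y. x - y \<in> A}" by (rule nn_integral_indicator) simp
  finally show ?thesis ..
qed

text \<open>The change of variables (x, u) to w preserves Lebesgue measure: for fixed x the section
  of a box is empty or a box whose sides are reflected translates of the old ones.\<close>

lemma distr_anchored:
  "distr (lborel \<Otimes>\<^sub>M PL {1..n}) (PL {1..Suc n}) (\<lambda>(x, u). anchored n x u) = PL {1..Suc n}"
proof (rule PL.PiM_eqI)
  fix A :: "nat \<Rightarrow> real set" assume A: "\<And>i. i \<in> {1..Suc n} \<Longrightarrow> A i \<in> sets lborel"
  interpret N: sigma_finite_measure "PL {1..n}" by (rule sigma_finite_PL) simp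
  let ?P = "lborel \<Otimes>\<^sub>M PL {1..n}"
  have box: "Pi\<^sub>E {1..Suc n} A \<in> sets (PL {1..Suc n})"
    using A by (intro sets_PiM_I_finite) auto
  let ?X = "(\<lambda>(x, u). anchored n x u) -` Pi\<^sub>E {1..Suc n} A \<inter> space ?P"
  have X: "?X \<in> sets ?P" by (rule measurable_sets[OF measurable_anchored box])
  have split: "(\<forall>i\<in>{1..Suc n}. P i) \<longleftrightarrow> P 1 \<and> (\<forall>j\<in>{1..n}. P (Suc j))" for P
  proof -
    have "{1..Suc n} = insert 1 (Suc ` {1..n})" by (auto simp: image_iff)
    thus ?thesis by (simp del: image_Suc_atLeastAtMost)
  qed
  have sl: "Pair x -` ?X = (if x \<in> A 1 then Pi\<^sub>E {1..n} (\<lambda>j. {y. x - y \<in> A (Suc j)}) else {})" for x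
  proof (rule set_eqI)
    fix u
    have "u \<in> Pair x -` ?X \<longleftrightarrow> anchored n x u \<in> Pi\<^sub>E {1..Suc n} A \<and> u \<in> space (PL {1..n})"
      by (auto simp: space_pair_measure)
    also have "\<dots> \<longleftrightarrow> (\<forall>i\<in>{1..Suc n}. x - (u(0 := 0)) (i - 1) \<in> A i) \<and> u \<in> extensional {1..n}"
      by (auto simp: anchored_def space_PiM PiE_def Pi_def)
    also have "\<dots> \<longleftrightarrow> (x - (u(0 := 0)) 0 \<in> A 1 \<and> (\<forall>j\<in>{1..n}. x - (u(0 := 0)) j \<in> A (Suc j))) \<and> u \<in> extensional {1..n}"
      unfolding split by simp
    also have "(\<forall>j\<in>{1..n}. x - (u(0 := 0)) j \<in> A (Suc j)) \<longleftrightarrow> (\<forall>j\<in>{1..n}. x - u j \<in> A (Suc j))"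
      by (intro ball_cong) auto
    also have "(x - (u(0 := 0)) 0 \<in> A 1 \<and> (\<forall>j\<in>{1..n}. x - u j \<in> A (Suc j))) \<and> u \<in> extensional {1..n}
        \<longleftrightarrow> u \<in> (if x \<in> A 1 then Pi\<^sub>E {1..n} (\<lambda>j. {y. x - y \<in> A (Suc j)}) else {})"
      by (auto simp: PiE_def Pi_def)
    finally show "u \<in> Pair x -` ?X \<longleftrightarrow> u \<in> (if x \<in> A 1 then Pi\<^sub>E {1..n} (\<lambda>j. {y. x - y \<in> A (Suc j)}) else {})" .
  qed
  have em: "emeasure (PL {1..n}) (Pair x -` ?X) = (\<Prod>j\<in>{1..n}. emeasure lborel (A (Suc j))) * indicator (A 1) x" for x
  proof -
    have "emeasure (PL {1..n}) (Pi\<^sub>E {1..n} (\<lambda>j. {y. x - y \<in> A (Suc j)})) = (\<Prod>j\<in>{1..n}. emeasure lborel {y. x - y \<in> A (Suc j)})"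
    proof (rule PL.emeasure_PiM)
      fix j assume "j \<in> {1..n}"
      hence [measurable]: "A (Suc j) \<in> sets borel" using A[of "Suc j"] by auto
      show "{y. x - y \<in> A (Suc j)} \<in> sets lborel" by simp
    qed simp
    also have "\<dots> = (\<Prod>j\<in>{1..n}. emeasure lborel (A (Suc j)))"
    proof (intro prod.cong refl emeasure_lborel_reflect)
      fix j assume "j \<in> {1..n}"
      thus "A (Suc j) \<in> sets borel" using A[of "Suc j"] by auto
    qed
    finally show ?thesis unfolding sl by auto
  qed
  have "emeasure (distr ?P (PL {1..Suc n}) (\<lambda>(x, u). anchored n x u)) (Pi\<^sub>E {1..Suc n} A) = emeasure ?P ?X"
    by (rule emeasure_distr[OF measurable_anchored box])
  also have "\<dots> = (\<integral>\<^sup>+x. emeasure (PL {1..n}) (Pair x -` ?X) \<partial>lborel)"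
    by (rule N.emeasure_pair_measure_alt[OF X])
  also have "\<dots> = (\<Prod>j\<in>{1..n}. emeasure lborel (A (Suc j))) * emeasure lborel (A 1)"
    unfolding em using A[of 1] by (subst nn_integral_cmult_indicator) auto
  also have "\<dots> = (\<Prod>i\<in>{1..Suc n}. emeasure lborel (A i))"
    by (subst prod.atLeast_Suc_atMost) (auto simp: prod.shift_bounds_cl_Suc_ivl mult.commute simp del: prod.cl_ivl_Suc)
  finally show "emeasure (distr ?P (PL {1..Suc n}) (\<lambda>(x, u). anchored n x u)) (Pi\<^sub>E {1..Suc n} A) = (\<Prod>i\<in>{1..Suc n}. emeasure lborel (A i))" .
qed auto

text \<open>The variable x is placed inside because the kernels depend on differences only and leave
  its integral.\<close>

lemma
  fixes F :: "(nat \<Rightarrow> real) \<Rightarrow> complex"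
  assumes F: "integrable (PL {1..Suc n}) F"
  shows integrable_anchored: "integrable (PL {1..n}) (\<lambda>u. LINT x|lborel. F (anchored n x u))"
    and integral_anchored: "(LINT w|PL {1..Suc n}. F w) = (LINT u|PL {1..n}. LINT x|lborel. F (anchored n x u))"
proof -
  interpret N: sigma_finite_measure "PL {1..n}" by (rule sigma_finite_PL) simp
  interpret P: pair_sigma_finite lborel "PL {1..n}" ..
  have Fm: "F \<in> borel_measurable (PL {1..Suc n})" using F by auto
  have "integrable (distr (lborel \<Otimes>\<^sub>M PL {1..n}) (PL {1..Suc n}) (\<lambda>(x, u). anchored n x u)) F"
    unfolding distr_anchored by (rule F)
  from integrable_distr[OF measurable_anchored this]
  have i: "integrable (lborel \<Otimes>\<^sub>M PL {1..n}) (\<lambda>(x, u). F (anchored n x u))"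
    by (simp add: case_prod_unfold)
  show "integrable (PL {1..n}) (\<lambda>u. LINT x|lborel. F (anchored n x u))"
    by (rule P.integrable_snd[OF i])
  have "(LINT w|PL {1..Suc n}. F w) = (LINT w|(distr (lborel \<Otimes>\<^sub>M PL {1..n}) (PL {1..Suc n}) (\<lambda>(x, u). anchored n x u)). F w)"
    unfolding distr_anchored ..
  also have "\<dots> = (LINT z|(lborel \<Otimes>\<^sub>M PL {1..n}). F (case z of (x, u) \<Rightarrow> anchored n x u))"
    by (rule integral_distr[OF measurable_anchored Fm])
  also have "\<dots> = (LINT u|PL {1..n}. LINT x|lborel. F (anchored n x u))"
    using P.integral_snd[OF i] by (simp add: case_prod_unfold)
  finally show "(LINT w|PL {1..Suc n}. F w) = (LINT u|PL {1..n}. LINT x|lborel. F (anchored n x u))" .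
qed

lemma prod_anchored:
  fixes f :: "nat \<Rightarrow> real \<Rightarrow> 'a::comm_monoid_mult"
  shows "(\<Prod>i\<in>{1..Suc n}. f i (anchored n x u i)) = f 1 x * (\<Prod>i\<in>{2..Suc n}. f i (x - u (i - 1)))"
proof -
  have "(\<Prod>i\<in>{1..Suc n}. f i (anchored n x u i)) = f 1 (anchored n x u 1) * (\<Prod>i\<in>{2..Suc n}. f i (anchored n x u i))"
    by (subst prod.atLeast_Suc_atMost) (auto simp: numeral_2_eq_2 simp del: prod.cl_ivl_Suc)
  also have "(\<Prod>i\<in>{2..Suc n}. f i (anchored n x u i)) = (\<Prod>i\<in>{2..Suc n}. f i (x - u (i - 1)))"
    by (intro prod.cong) (auto simp: anchored_def)
  finally show ?thesis by (simp add: anchored_def)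
qed

lemma phi_anchored: "phi (Suc n) h u = (LINT x|lborel. (\<Prod>i\<in>{1..Suc n}. h i (anchored n x u i)))"
  unfolding phi_def prod_anchored ..

text \<open>At b = 0 this is the kernel Phi_T of the overview, with n = m - 1. A free end point
  exhibits it as an iterated convolution: integrated over all u it is a multiple of D_T(-
  b).\<close>

definition chain_dirichlet :: "real \<Rightarrow> nat \<Rightarrow> (nat \<Rightarrow> real) \<Rightarrow> real \<Rightarrow> complex" where
  "chain_dirichlet T n u b = (\<Prod>i\<in>{1..n}. dirichlet T ((u(0 := 0)) (i - 1) - u i)) * dirichlet T ((u(0 := 0)) n - b)"

lemma cyc_dirichlet_anchored: "cyc_dirichlet T (Suc n) (anchored n x u) = chain_dirichlet T n u 0"
proof -
  have "(\<Prod>i\<in>{1..<Suc n}. dirichlet T (anchored n x u (Suc i) - anchored n x u i)) = (\<Prod>i\<in>{1..n}. dirichlet T ((u(0 := 0)) (i - 1) - u i))"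
    by (intro prod.cong) (auto simp: anchored_def)
  moreover have "anchored n x u 1 - anchored n x u (Suc n) = (u(0 := 0)) n - 0"
    by (simp add: anchored_def)
  ultimately show ?thesis by (simp add: cyc_dirichlet_def chain_dirichlet_def)
qed

lemma measurable_cyc_dirichlet: "m \<ge> 1 \<Longrightarrow> cyc_dirichlet T m \<in> borel_measurable (PL {1..m})"
  unfolding cyc_dirichlet_def[abs_def]
  by (intro borel_measurable_times borel_measurable_prod measurable_compose[OF _ measurable_dirichlet] borel_measurable_diff measurable_component_PL) auto

lemma norm_cyc_dirichlet_le:
  assumes "T > 0"
  shows "norm (cyc_dirichlet T m w) \<le> (\<Prod>i\<in>{1..<m}. T) * T"
  unfolding cyc_dirichlet_def norm_mult prod_norm[symmetric]
  using assms by (intro mult_mono prod_mono) (auto simp: norm_dirichlet_le intro!: prod_nonneg)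

lemma integrable_trace_integrand:
  assumes T: "T > 0" and h: "\<forall>i\<in>{1..Suc n}. integrable lborel (h i)"
  shows "integrable (PL {1..Suc n}) (\<lambda>w. (\<Prod>i\<in>{1..Suc n}. complex_of_real (h i (w i))) * cyc_dirichlet T (Suc n) w)"
  using h by (intro integrable_prod_components[OF _ measurable_cyc_dirichlet norm_cyc_dirichlet_le[OF T]]) auto

text \<open>In the variables (x, u) the cyclic kernel is a function of u alone, so integrating over
  x first collects the symbols into \<open>phi\<close>.\<close>

lemma
  assumes T: "T > 0" and h: "\<forall>i\<in>{1..Suc n}. integrable lborel (h i)"
  shows trace_eq_phi: "op_trace T (toeplitz_prod T (Suc n) h) = (LINT u|PL {1..n}. of_real (phi (Suc n) h u) * chain_dirichlet T n u 0)"
    and integrable_phi_chain: "integrable (PL {1..n}) (\<lambda>u. of_real (phi (Suc n) h u) * chain_dirichlet T n u 0)"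
proof -
  have e: "(LINT x|lborel. (\<Prod>i\<in>{1..Suc n}. complex_of_real (h i (anchored n x u i))) * cyc_dirichlet T (Suc n) (anchored n x u))
      = of_real (phi (Suc n) h u) * chain_dirichlet T n u 0" for u
    unfolding phi_anchored cyc_dirichlet_anchored
    by (simp only: integral_mult_left_zero of_real_prod[symmetric] integral_complex_of_real)
  show "op_trace T (toeplitz_prod T (Suc n) h) = (LINT u|PL {1..n}. of_real (phi (Suc n) h u) * chain_dirichlet T n u 0)"
    using trace_formula[OF T _ h] unfolding integral_anchored[OF integrable_trace_integrand[OF T h]] e by simp
  show "integrable (PL {1..n}) (\<lambda>u. of_real (phi (Suc n) h u) * chain_dirichlet T n u 0)"
    using integrable_anchored[OF integrable_trace_integrand[OF T h]] unfolding e .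
qed

section \<open>Polynomial decay and its convolutions\<close>

definition decay :: "real \<Rightarrow> real \<Rightarrow> real" where
  "decay a x = (1 + \<bar>x\<bar>) powr (- a)"

lemma measurable_decay [measurable]: "decay a \<in> borel_measurable borel"
  unfolding decay_def by measurable

lemma decay_nonneg [simp]: "decay a x \<ge> 0" by (simp add: decay_def)

lemma decay_0 [simp]: "decay 0 x = 1" by (auto simp: decay_def)

lemma nn_integral_decay_finite:
  assumes s: "s > 1"
  shows "(\<integral>\<^sup>+x. ennreal (decay s x) \<partial>lborel) < \<infinity>"
proof -
  let ?f = "\<lambda>x::real. (1 + x) powr (- s)" and ?F = "\<lambda>x::real. (1 + x) powr (1 - s) / (1 - s)"
  have lim: "(?F \<longlongrightarrow> 0 / (1 - s)) at_top"
  proof (intro tendsto_divide tendsto_const)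
    show "((\<lambda>x. (1 + x) powr (1 - s)) \<longlongrightarrow> 0) at_top"
      by (rule tendsto_neg_powr) (use s in \<open>auto intro!: filterlim_tendsto_add_at_top[OF tendsto_const] filterlim_ident\<close>)
  qed (use s in auto)
  have half: "(\<integral>\<^sup>+x. ennreal (?f x) * indicator {0..} x \<partial>lborel) < \<infinity>"
  proof -
    have "(\<integral>\<^sup>+x. ennreal (?f x) * indicator {0..} x \<partial>lborel) = ennreal (0 / (1 - s) - ?F 0)"
    proof (rule nn_integral_FTC_atLeast[OF _ _ _ lim])
      fix x :: real assume "0 \<le> x"
      hence "((\<lambda>x. (1 + x) powr (1 - s)) has_real_derivative (1 - s) * (1 + x) powr (1 - s - of_nat 1) * 1) (at x)"
        by (intro DERIV_fun_powr) (auto intro!: derivative_eq_intros)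
      from DERIV_cdivide[OF this, of "1 - s"] show "(?F has_real_derivative ?f x) (at x)"
        using s by simp
    qed auto
    thus ?thesis by simp
  qed
  have "(\<integral>\<^sup>+x. ennreal (decay s x) \<partial>lborel) \<le> (\<integral>\<^sup>+x. ennreal (?f x) * indicator {0..} x + ennreal (?f (0 + (-1) * x)) * indicator {0..} (0 + (-1) * x) \<partial>lborel)"
    by (intro nn_integral_mono) (auto simp: decay_def split: split_indicator)
  also have "\<dots> = (\<integral>\<^sup>+x. ennreal (?f x) * indicator {0..} x \<partial>lborel) + (\<integral>\<^sup>+x. ennreal (?f (0 + (-1) * x)) * indicator {0..} (0 + (-1) * x) \<partial>lborel)"
    by (rule nn_integral_add) measurable
  also have "(\<integral>\<^sup>+x. ennreal (?f (0 + (-1) * x)) * indicator {0..} (0 + (-1) * x) \<partial>lborel) = (\<integral>\<^sup>+x. ennreal (?f x) * indicator {0..} x \<partial>lborel)"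
    by (subst nn_integral_real_affine[of "\<lambda>x. ennreal (?f x) * indicator {0..} x" "-1" 0]) auto
  finally show ?thesis using half by (auto simp: less_top[symmetric] top_unique)
qed

text \<open>At least one of z - b and z is of size |b| / 2. The factor with the larger argument
  gives up the exponent c to produce decay in b; what is left of it is estimated at the smaller
  argument, where the exponents now add up to s = a1 + a2 - c > 1.\<close>

lemma decay_convolution:
  assumes c: "0 \<le> c" "c < a1 + a2 - 1" "c \<le> a1" "c \<le> a2"
  obtains C where "C \<ge> 0" "\<And>b. (\<integral>\<^sup>+z. ennreal (decay a1 (z - b) * decay a2 z) \<partial>lborel) \<le> ennreal (C * decay c b)"
proof -
  define s where "s = a1 + a2 - c"
  have s: "s > 1" using c by (simp add: s_def)
  define I where "I = enn2real (\<integral>\<^sup>+x. ennreal (decay s x) \<partial>lborel)"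
  have I: "(\<integral>\<^sup>+x. ennreal (decay s x) \<partial>lborel) = ennreal I"
    using nn_integral_decay_finite[OF s] by (simp add: I_def)
  have I0: "I \<ge> 0" by (simp add: I_def)
  have I': "(\<integral>\<^sup>+x. ennreal (decay s (x - b)) \<partial>lborel) = ennreal I" for b
    using nn_integral_real_affine[of "\<lambda>x. ennreal (decay s x)" 1 "-b"] by (simp add: I algebra_simps)
  have pt: "decay a1 (z - b) * decay a2 z \<le> 2 powr c * decay c b * (decay s (z - b) + decay s z)" for z b
  proof -
    \<comment> \<open>Here p is the larger and q the smaller of the two quantities 1 + |z - b| and 1
      + |z|.\<close>
    have aux: "p powr (- a) * q powr (- a') \<le> 2 powr c * (1 + \<bar>b\<bar>) powr (- c) * q powr (- s)"
      if "p \<ge> q" "q \<ge> 1" "1 + \<bar>b\<bar> \<le> 2 * p" "c \<le> a" "a + a' - c = s" for p q a a' :: real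
    proof -
      have "p powr (- a) = p powr (- c) * p powr (- (a - c))" by (simp add: powr_add[symmetric])
      also have "\<dots> \<le> (2 powr c * (1 + \<bar>b\<bar>) powr (- c)) * q powr (- (a - c))"
      proof (intro mult_mono)
        have "p powr (- c) \<le> ((1 + \<bar>b\<bar>) / 2) powr (- c)"
          using that c by (intro powr_mono2') auto
        also have "\<dots> = 2 powr c * (1 + \<bar>b\<bar>) powr (- c)" by (simp add: powr_divide powr_minus divide_simps)
        finally show "p powr (- c) \<le> 2 powr c * (1 + \<bar>b\<bar>) powr (- c)" .
        show "p powr (- (a - c)) \<le> q powr (- (a - c))" using that by (intro powr_mono2') auto
      qed auto
      finally have "p powr (- a) * q powr (- a') \<le> (2 powr c * (1 + \<bar>b\<bar>) powr (- c)) * q powr (- (a - c)) * q powr (- a')"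
        by (rule mult_right_mono) auto
      also have "\<dots> = 2 powr c * (1 + \<bar>b\<bar>) powr (- c) * q powr (- s)"
        using that by (simp add: powr_add[symmetric] mult.assoc algebra_simps)
      finally show ?thesis .
    qed
    let ?p = "1 + \<bar>z - b\<bar>" and ?q = "1 + \<bar>z\<bar>"
    have R: "2 powr c * decay c b * (decay s (z - b) + decay s z) = 2 powr c * (1 + \<bar>b\<bar>) powr (- c) * ?p powr (- s) + 2 powr c * (1 + \<bar>b\<bar>) powr (- c) * ?q powr (- s)"
      by (simp add: decay_def distrib_left)
    have nn: "2 powr c * (1 + \<bar>b\<bar>) powr (- c) * ?p powr (- s) \<ge> 0" "2 powr c * (1 + \<bar>b\<bar>) powr (- c) * ?q powr (- s) \<ge> 0" by auto
    have tri: "\<bar>b\<bar> \<le> \<bar>z\<bar> + \<bar>z - b\<bar>" by linarith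
    show ?thesis
    proof (cases "?p \<ge> ?q")
      case True
      have "?p powr (- a1) * ?q powr (- a2) \<le> 2 powr c * (1 + \<bar>b\<bar>) powr (- c) * ?q powr (- s)"
        by (rule aux) (use True c tri in \<open>auto simp: s_def\<close>)
      thus ?thesis unfolding R using nn unfolding decay_def by linarith
    next
      case False
      have "?q powr (- a2) * ?p powr (- a1) \<le> 2 powr c * (1 + \<bar>b\<bar>) powr (- c) * ?p powr (- s)"
        by (rule aux) (use False c tri in \<open>auto simp: s_def\<close>)
      hence "?p powr (- a1) * ?q powr (- a2) \<le> 2 powr c * (1 + \<bar>b\<bar>) powr (- c) * ?p powr (- s)" by (simp only: mult.commute)
      thus ?thesis unfolding R using nn unfolding decay_def by linarith
    qed
  qed
  show ?thesis
  proof (rule that[of "2 powr c * (2 * I)"])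
    show "2 powr c * (2 * I) \<ge> 0" using I0 by simp
    fix b
    have "(\<integral>\<^sup>+z. ennreal (decay a1 (z - b) * decay a2 z) \<partial>lborel) \<le> (\<integral>\<^sup>+z. ennreal (2 powr c * decay c b) * (ennreal (decay s (z - b)) + ennreal (decay s z)) \<partial>lborel)"
      by (intro nn_integral_mono) (use pt in \<open>simp add: ennreal_mult[symmetric] ennreal_plus[symmetric] ennreal_leI del: ennreal_plus\<close>)
    also have "\<dots> = ennreal (2 powr c * decay c b) * (ennreal I + ennreal I)"
      by (simp add: nn_integral_cmult nn_integral_add I I')
    also have "\<dots> = ennreal (2 powr c * (2 * I) * decay c b)"
      using I0 by (simp add: ennreal_mult[symmetric] ennreal_plus[symmetric] mult_ac del: ennreal_plus)
    finally show "(\<integral>\<^sup>+z. ennreal (decay a1 (z - b) * decay a2 z) \<partial>lborel) \<le> ennreal (2 powr c * (2 * I) * decay c b)" .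
  qed
qed

section \<open>Bounds for products of kernels along a chain\<close>

text \<open>The factors with exponents \<open>g i\<close> absorb a weight \<open>|u_j|^\<gamma>\<close>; they cost decay in the end point \<open>b\<close>
  but keep the chain integrable as long as the exponents add up to less than 1.\<close>

definition chain_decay :: "real \<Rightarrow> nat \<Rightarrow> (nat \<Rightarrow> real) \<Rightarrow> (nat \<Rightarrow> real) \<Rightarrow> real \<Rightarrow> real" where
  "chain_decay T n g u b = (\<Prod>i\<in>{1..n}. decay 1 (T * ((u(0 := 0)) (i - 1) - u i)) * (1 + T * \<bar>u i\<bar>) powr g i) * decay 1 (T * ((u(0 := 0)) n - b))"

lemma chain_decay_nonneg: "chain_decay T n g u b \<ge> 0"
  unfolding chain_decay_def by (intro mult_nonneg_nonneg prod_nonneg) auto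

lemma measurable_chain_decay:
  assumes "f \<in> borel_measurable (PL {1..n})"
  shows "(\<lambda>u. chain_decay T n g u (f u)) \<in> borel_measurable (PL {1..n})"
proof -
  have c: "(\<lambda>u. u i) \<in> borel_measurable (PL {1..n})" if "i \<in> {1..n}" for i
    using that by (rule measurable_component_PL)
  have c0: "(\<lambda>u. (u(0 := 0)) i) \<in> borel_measurable (PL {1..n})" if "i \<le> n" for i
    using that by (intro measurable_update_component) auto
  show ?thesis unfolding chain_decay_def
  proof (intro borel_measurable_times borel_measurable_prod)
    fix i assume i: "i \<in> {1..n}"
    show "(\<lambda>u. decay 1 (T * ((u(0 := 0)) (i - 1) - u i))) \<in> borel_measurable (PL {1..n})"
      using i by (intro measurable_compose[OF _ measurable_decay] borel_measurable_times borel_measurable_diff c c0) auto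
    have [measurable]: "(\<lambda>u. u i) \<in> borel_measurable (PL {1..n})" using i by (rule c)
    show "(\<lambda>u. (1 + T * \<bar>u i\<bar>) powr g i) \<in> borel_measurable (PL {1..n})" by measurable
  next
    show "(\<lambda>u. decay 1 (T * ((u(0 := 0)) n - f u))) \<in> borel_measurable (PL {1..n})"
      by (intro measurable_compose[OF _ measurable_decay] borel_measurable_times borel_measurable_diff c0 assms) auto
  qed
qed

lemma chain_decay_Suc:
  "chain_decay T (Suc n) g (u(Suc n := y)) b = chain_decay T n g u y * ((1 + T * \<bar>y\<bar>) powr g (Suc n) * decay 1 (T * (y - b)))"
proof -
  have "(\<Prod>i\<in>{1..n}. decay 1 (T * (((u(Suc n := y))(0 := 0)) (i - 1) - (u(Suc n := y)) i)) * (1 + T * \<bar>(u(Suc n := y)) i\<bar>) powr g i)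
    = (\<Prod>i\<in>{1..n}. decay 1 (T * ((u(0 := 0)) (i - 1) - u i)) * (1 + T * \<bar>u i\<bar>) powr g i)"
    by (intro prod.cong) auto
  thus ?thesis by (simp add: chain_decay_def mult_ac)
qed

lemma nn_integral_decay_scaled:
  assumes T: "T > 0"
  shows "(\<integral>\<^sup>+y. ennreal (decay a1 (T * (y - b)) * decay a2 (T * y)) \<partial>lborel) = ennreal (1 / T) * (\<integral>\<^sup>+z. ennreal (decay a1 (z - T * b) * decay a2 z) \<partial>lborel)"
proof -
  have "(\<integral>\<^sup>+z. ennreal (decay a1 (z - T * b) * decay a2 z) \<partial>lborel) = ennreal \<bar>T\<bar> * (\<integral>\<^sup>+y. ennreal (decay a1 (0 + T * y - T * b) * decay a2 (0 + T * y)) \<partial>lborel)"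
    using T by (intro nn_integral_real_affine) auto
  hence "ennreal (1 / T) * (\<integral>\<^sup>+z. ennreal (decay a1 (z - T * b) * decay a2 z) \<partial>lborel) = (ennreal (1 / T) * ennreal T) * (\<integral>\<^sup>+y. ennreal (decay a1 (T * y - T * b) * decay a2 (T * y)) \<partial>lborel)"
    using T by (simp add: mult.assoc)
  also have "ennreal (1 / T) * ennreal T = 1"
    using T by (simp add: ennreal_mult[symmetric])
  finally show ?thesis by (simp add: right_diff_distrib)
qed

text \<open>The last variable y is the end point of the shorter chain. The decay d in T y found
  there first pays for the weight with exponent \<open>g (Suc n)\<close>; the rest is convolved with
  the last kernel, which leaves any exponent c < d - g (Suc n). At exponent 1 such convolutions
  produce logarithms, hence the strict inequality and the induction over all c. Rescaling each
  variable by T gives a factor 1 / T.\<close>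

lemma chain_decay_bound:
  assumes g: "\<And>i. g i \<ge> 0" and c: "0 \<le> c" "c + (\<Sum>i\<in>{1..n}. g i) < 1"
  shows "\<exists>C\<ge>0. \<forall>T>0. \<forall>b. (\<integral>\<^sup>+u. ennreal (chain_decay T n g u b) \<partial>PL {1..n}) \<le> ennreal (C * (1 / T) ^ n * decay c (T * b))"
  using c
proof (induction n arbitrary: c)
  case 0
  have "decay 1 x \<le> decay c x" for x
    using 0 unfolding decay_def by (intro powr_mono) auto
  moreover have "decay 1 (T * (0 - b)) = decay 1 (T * b)" for T b by (simp add: decay_def)
  ultimately have "chain_decay T 0 g u b \<le> decay c (T * b)" for T u b
    by (simp add: chain_decay_def)
  thus ?case
    by (intro exI[of _ 1]) (auto simp: PiM_empty nn_integral_count_space_finite intro!: ennreal_leI)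
next
  case (Suc n)
  define G where "G = (\<Sum>i\<in>{1..n}. g i)"
  \<comment> \<open>The midpoint between c + g (Suc n), which the convolution has to exceed, and 1 -
    G, which the induction hypothesis must not reach.\<close>
  define d where "d = (1 - G + (c + g (Suc n))) / 2"
  have cG: "0 \<le> c" "c + g (Suc n) + G < 1" using Suc.prems by (auto simp: G_def)
  have G0: "G \<ge> 0" unfolding G_def by (intro sum_nonneg g)
  have d: "c + g (Suc n) < d" "d + G < 1" using cG by (auto simp: d_def field_simps)
  obtain C1 where C1: "C1 \<ge> 0" "\<And>T b. T > 0 \<Longrightarrow> (\<integral>\<^sup>+u. ennreal (chain_decay T n g u b) \<partial>PL {1..n}) \<le> ennreal (C1 * (1 / T) ^ n * decay d (T * b))"
    using Suc.IH[of d] d cG g[of "Suc n"] unfolding G_def by auto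
  obtain C2 where C2: "C2 \<ge> 0" "\<And>b. (\<integral>\<^sup>+z. ennreal (decay 1 (z - b) * decay (d - g (Suc n)) z) \<partial>lborel) \<le> ennreal (C2 * decay c b)"
    using d cG G0 g[of "Suc n"] by (rule_tac decay_convolution[of c 1 "d - g (Suc n)"]) auto
  have "(\<integral>\<^sup>+u. ennreal (chain_decay T (Suc n) g u b) \<partial>PL {1..Suc n}) \<le> ennreal (C1 * C2 * (1 / T) ^ Suc n * decay c (T * b))" if T: "T > 0" for T b
  proof -
    have ins: "{1..Suc n} = insert (Suc n) {1..n}" by auto
    have m: "(\<lambda>u. ennreal (chain_decay T (Suc n) g u b)) \<in> borel_measurable (PL (insert (Suc n) {1..n}))"
      using measurable_chain_decay[of "\<lambda>_. b" "Suc n" T g] unfolding ins by measurable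
    have mu: "(\<lambda>u. ennreal (chain_decay T n g u y)) \<in> borel_measurable (PL {1..n})" for y
      using measurable_chain_decay[of "\<lambda>_. y" n T g] by measurable
    have "(\<integral>\<^sup>+u. ennreal (chain_decay T (Suc n) g u b) \<partial>PL {1..Suc n}) = (\<integral>\<^sup>+y. \<integral>\<^sup>+u. ennreal (chain_decay T (Suc n) g (u(Suc n := y)) b) \<partial>PL {1..n} \<partial>lborel)"
      unfolding ins by (rule PL.product_nn_integral_insert_rev[OF _ _ m]) auto
    also have "\<dots> = (\<integral>\<^sup>+y. (\<integral>\<^sup>+u. ennreal (chain_decay T n g u y) \<partial>PL {1..n}) * ennreal ((1 + T * \<bar>y\<bar>) powr g (Suc n) * decay 1 (T * (y - b))) \<partial>lborel)"
      by (intro nn_integral_cong, subst nn_integral_multc[OF mu, symmetric])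
         (simp add: chain_decay_Suc ennreal_mult chain_decay_nonneg)
    also have "\<dots> \<le> (\<integral>\<^sup>+y. ennreal (C1 * (1 / T) ^ n * decay d (T * y)) * ennreal ((1 + T * \<bar>y\<bar>) powr g (Suc n) * decay 1 (T * (y - b))) \<partial>lborel)"
      by (intro nn_integral_mono mult_right_mono C1 T) auto
    also have "\<dots> = (\<integral>\<^sup>+y. ennreal (C1 * (1 / T) ^ n) * ennreal (decay 1 (T * (y - b)) * decay (d - g (Suc n)) (T * y)) \<partial>lborel)"
    proof (intro nn_integral_cong)
      fix y
      have "decay d (T * y) * (1 + T * \<bar>y\<bar>) powr g (Suc n) = decay (d - g (Suc n)) (T * y)"
        using T by (simp add: decay_def powr_add[symmetric] abs_mult)
      thus "ennreal (C1 * (1 / T) ^ n * decay d (T * y)) * ennreal ((1 + T * \<bar>y\<bar>) powr g (Suc n) * decay 1 (T * (y - b))) =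
        ennreal (C1 * (1 / T) ^ n) * ennreal (decay 1 (T * (y - b)) * decay (d - g (Suc n)) (T * y))"
        using C1 T by (simp add: ennreal_mult[symmetric] mult_ac)
    qed
    also have "\<dots> = ennreal (C1 * (1 / T) ^ n) * (ennreal (1 / T) * (\<integral>\<^sup>+z. ennreal (decay 1 (z - T * b) * decay (d - g (Suc n)) z) \<partial>lborel))"
      by (subst nn_integral_cmult) (auto simp: nn_integral_decay_scaled[OF T])
    also have "\<dots> \<le> ennreal (C1 * (1 / T) ^ n) * (ennreal (1 / T) * ennreal (C2 * decay c (T * b)))"
      by (intro mult_left_mono C2) auto
    also have "\<dots> = ennreal (C1 * C2 * (1 / T) ^ Suc n * decay c (T * b))"
      using C1 C2 T by (simp add: ennreal_mult[symmetric] mult_ac)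
    finally show ?thesis .
  qed
  thus ?case using C1 C2 by (intro exI[of _ "C1 * C2"]) auto
qed

lemma measurable_chain_dirichlet:
  assumes "f \<in> borel_measurable (PL {1..n})"
  shows "(\<lambda>u. chain_dirichlet T n u (f u)) \<in> borel_measurable (PL {1..n})"
  unfolding chain_dirichlet_def
  by (intro borel_measurable_times borel_measurable_prod measurable_compose[OF _ measurable_dirichlet]
        borel_measurable_diff measurable_update_component measurable_component_PL assms) auto

lemma norm_chain_dirichlet_le:
  assumes T: "T > 0"
  shows "norm (chain_dirichlet T n u b) \<le> (3 * T) ^ Suc n * chain_decay T n (\<lambda>_. 0) u b"
proof -
  have D: "norm (dirichlet T x) \<le> 3 * T * decay 1 (T * x)" for x
    using norm_dirichlet_bound[OF T, of x] T by (simp add: decay_def powr_minus abs_mult divide_inverse add_pos_nonneg)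
  have "norm (chain_dirichlet T n u b) \<le> (\<Prod>i\<in>{1..n}. 3 * T * decay 1 (T * ((u(0 := 0)) (i - 1) - u i))) * (3 * T * decay 1 (T * ((u(0 := 0)) n - b)))"
    unfolding chain_dirichlet_def norm_mult prod_norm[symmetric]
    using T by (intro mult_mono prod_mono conjI D norm_ge_zero prod_nonneg) auto
  also have "\<dots> = (3 * T) ^ Suc n * ((\<Prod>i\<in>{1..n}. decay 1 (T * ((u(0 := 0)) (i - 1) - u i))) * decay 1 (T * ((u(0 := 0)) n - b)))"
    by (simp add: prod.distrib mult_ac)
  also have "(\<Prod>i\<in>{1..n}. decay 1 (T * ((u(0 := 0)) (i - 1) - u i))) * decay 1 (T * ((u(0 := 0)) n - b)) = chain_decay T n (\<lambda>_. 0) u b"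
  proof -
    \<comment> \<open>\<open>x powr 0\<close> is 1 only for nonzero x; the weights with exponent 0
      are dropped on this ground.\<close>
    have "1 + T * \<bar>v\<bar> \<noteq> 0" for v using T by (smt (verit) mult_nonneg_nonneg abs_ge_zero)
    thus ?thesis unfolding chain_decay_def by simp
  qed
  finally show ?thesis .
qed

lemma integrable_chain_dirichlet:
  assumes T: "T > 0"
  shows "integrable (PL {1..n}) (\<lambda>u. chain_dirichlet T n u b)"
proof -
  obtain C where C: "(\<integral>\<^sup>+u. ennreal (chain_decay T n (\<lambda>_. 0) u b) \<partial>PL {1..n}) \<le> ennreal (C * (1 / T) ^ n * decay 0 (T * b))"
    using chain_decay_bound[of "\<lambda>_. 0" 0 n] T by auto
  have mu: "(\<lambda>u. chain_decay T n (\<lambda>_. 0) u b) \<in> borel_measurable (PL {1..n})"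
    using measurable_chain_decay[of "\<lambda>_. b" n T] by simp
  have "integrable (PL {1..n}) (\<lambda>u. chain_decay T n (\<lambda>_. 0) u b)"
    using mu le_less_trans[OF C] by (auto simp: integrable_iff_bounded chain_decay_nonneg)
  hence "integrable (PL {1..n}) (\<lambda>u. (3 * T) ^ Suc n * chain_decay T n (\<lambda>_. 0) u b)"
    by (rule integrable_mult_right)
  thus ?thesis
  proof (rule Bochner_Integration.integrable_bound)
    show "(\<lambda>u. chain_dirichlet T n u b) \<in> borel_measurable (PL {1..n})"
      using measurable_chain_dirichlet[of "\<lambda>_. b"] by simp
    show "AE u in PL {1..n}. norm (chain_dirichlet T n u b) \<le> norm ((3 * T) ^ Suc n * chain_decay T n (\<lambda>_. 0) u b)"
      unfolding real_norm_def by (intro AE_I2 order_trans[OF norm_chain_dirichlet_le[OF T] abs_ge_self])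
  qed
qed

lemma integral_chain_dirichlet:
  assumes T: "T > 0"
  shows "(LINT u|PL {1..n}. chain_dirichlet T n u b) = (2 * pi) ^ n * dirichlet T (- b)"
proof (induction n)
  case 0
  show ?case by (simp add: PiM_empty lebesgue_integral_count_space_finite chain_dirichlet_def)
next
  case (Suc n)
  have ins: "{1..Suc n} = insert (Suc n) {1..n}" by auto
  have "(LINT u|PL {1..Suc n}. chain_dirichlet T (Suc n) u b) = (LINT u|PL {1..n}. LINT y|lborel. chain_dirichlet T (Suc n) (u(Suc n := y)) b)"
    unfolding ins by (rule PL.product_integral_insert) (use integrable_chain_dirichlet[OF T, of "Suc n" b] in \<open>simp_all only: ins\<close>, auto)
  also have "\<dots> = (LINT u|PL {1..n}. LINT y|lborel. (\<Prod>i\<in>{1..n}. dirichlet T ((u(0 := 0)) (i - 1) - u i)) * (dirichlet T ((u(0 := 0)) n - y) * dirichlet T (y - b)))"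
  proof (intro Bochner_Integration.integral_cong refl)
    fix u :: "nat \<Rightarrow> real" and y
    have "(\<Prod>i\<in>{1..n}. dirichlet T (((u(Suc n := y))(0 := 0)) (i - 1) - (u(Suc n := y)) i)) = (\<Prod>i\<in>{1..n}. dirichlet T ((u(0 := 0)) (i - 1) - u i))"
      by (intro prod.cong) auto
    thus "chain_dirichlet T (Suc n) (u(Suc n := y)) b = (\<Prod>i\<in>{1..n}. dirichlet T ((u(0 := 0)) (i - 1) - u i)) * (dirichlet T ((u(0 := 0)) n - y) * dirichlet T (y - b))"
      by (simp add: chain_dirichlet_def mult_ac)
  qed
  also have "\<dots> = (LINT u|PL {1..n}. 2 * pi * chain_dirichlet T n u b)"
    by (intro Bochner_Integration.integral_cong refl, subst integral_mult_right_zero) (simp add: dirichlet_reproducing[OF T] chain_dirichlet_def)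
  also have "\<dots> = (2 * pi) ^ Suc n * dirichlet T (- b)"
    unfolding integral_mult_right_zero Suc.IH by simp
  finally show ?case .
qed

text \<open>Power count: n + 1 kernels give T^(n + 1), n integrations give T^(- n), and
  |u_j|^\<gamma> <= T^(- \<gamma>) (1 + T |u_j|)^\<gamma> gives T^(- \<gamma>). The remaining weight
  on u_j is admissible for \<open>chain_decay_bound\<close> because \<gamma> < 1.\<close>

lemma weighted_chain_dirichlet_bound:
  assumes \<gamma>: "0 \<le> \<gamma>" "\<gamma> < 1"
  shows "\<exists>C\<ge>0. \<forall>T>0. (\<integral>\<^sup>+u. ennreal ((\<Sum>j\<in>{1..n}. \<bar>u j\<bar> powr \<gamma>) * norm (chain_dirichlet T n u 0)) \<partial>PL {1..n}) \<le> ennreal (C * T powr (1 - \<gamma>))"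
proof -
  define g where "g j = (\<lambda>i::nat. if i = j then \<gamma> else 0)" for j
  have "\<exists>C\<ge>0. \<forall>T>0. \<forall>b. (\<integral>\<^sup>+u. ennreal (chain_decay T n (g j) u b) \<partial>PL {1..n}) \<le> ennreal (C * (1 / T) ^ n * decay 0 (T * b))" for j
  proof (rule chain_decay_bound)
    have "(\<Sum>i\<in>{1..n}. g j i) \<le> \<gamma>" using \<gamma> by (simp add: g_def)
    thus "0 + (\<Sum>i\<in>{1..n}. g j i) < 1" using \<gamma> by simp
  qed (use \<gamma> in \<open>auto simp: g_def\<close>)
  hence "\<exists>C. \<forall>j. C j \<ge> 0 \<and> (\<forall>T>0. \<forall>b. (\<integral>\<^sup>+u. ennreal (chain_decay T n (g j) u b) \<partial>PL {1..n}) \<le> ennreal (C j * (1 / T) ^ n * decay 0 (T * b)))"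
    by (intro choice allI) blast
  then obtain C where C': "\<And>j. C j \<ge> 0 \<and> (\<forall>T>0. \<forall>b. (\<integral>\<^sup>+u. ennreal (chain_decay T n (g j) u b) \<partial>PL {1..n}) \<le> ennreal (C j * (1 / T) ^ n * decay 0 (T * b)))"
    by blast
  have C: "C j \<ge> 0" "T > 0 \<Longrightarrow> (\<integral>\<^sup>+u. ennreal (chain_decay T n (g j) u 0) \<partial>PL {1..n}) \<le> ennreal (C j * (1 / T) ^ n)" for j T
    using C'[of j] by (auto dest: spec[of _ T])
  show ?thesis
  proof (intro exI[of _ "3 ^ Suc n * (\<Sum>j\<in>{1..n}. C j)"] conjI allI impI)
    show "3 ^ Suc n * (\<Sum>j\<in>{1..n}. C j) \<ge> 0" using C by (intro mult_nonneg_nonneg sum_nonneg) auto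
    fix T :: real assume T: "T > 0"
    define q where "q = (3 * T) ^ Suc n * T powr (- \<gamma>)"
    have q0: "q \<ge> 0" using T by (simp add: q_def)
    have pt: "\<bar>u j\<bar> powr \<gamma> * norm (chain_dirichlet T n u 0) \<le> q * chain_decay T n (g j) u 0" if j: "j \<in> {1..n}" for j u
    proof -
      have "\<bar>u j\<bar> powr \<gamma> = T powr (- \<gamma>) * (T * \<bar>u j\<bar>) powr \<gamma>"
        using T by (simp add: powr_mult powr_minus)
      also have "\<dots> \<le> T powr (- \<gamma>) * (1 + T * \<bar>u j\<bar>) powr \<gamma>"
        using T \<gamma> by (intro mult_left_mono powr_mono2) auto
      finally have "\<bar>u j\<bar> powr \<gamma> * norm (chain_dirichlet T n u 0) \<le> (T powr (- \<gamma>) * (1 + T * \<bar>u j\<bar>) powr \<gamma>) * ((3 * T) ^ Suc n * chain_decay T n (\<lambda>_. 0) u 0)"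
        by (intro mult_mono norm_chain_dirichlet_le T) auto
      also have "\<dots> = q * ((1 + T * \<bar>u j\<bar>) powr \<gamma> * chain_decay T n (\<lambda>_. 0) u 0)"
        by (simp only: q_def mult_ac)
      also have "(1 + T * \<bar>u j\<bar>) powr \<gamma> * chain_decay T n (\<lambda>_. 0) u 0 = chain_decay T n (g j) u 0"
      proof -
        have nz: "1 + T * \<bar>v\<bar> \<noteq> 0" for v using T by (smt (verit) mult_nonneg_nonneg abs_ge_zero)
        have "(\<Prod>i\<in>{1..n}. (1 + T * \<bar>u i\<bar>) powr g j i) = (\<Prod>i\<in>{1..n}. if i = j then (1 + T * \<bar>u i\<bar>) powr \<gamma> else 1)"
          by (intro prod.cong) (auto simp: g_def nz)
        also have "\<dots> = (1 + T * \<bar>u j\<bar>) powr \<gamma>" using j by simp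
        finally show ?thesis unfolding chain_decay_def prod.distrib by (simp add: nz)
      qed
      finally show ?thesis .
    qed
    have mu: "(\<lambda>u. ennreal (chain_decay T n (g j) u 0)) \<in> borel_measurable (PL {1..n})" for j
      using measurable_chain_decay[of "\<lambda>_. 0" n T "g j"] by measurable
    have "(\<integral>\<^sup>+u. ennreal ((\<Sum>j\<in>{1..n}. \<bar>u j\<bar> powr \<gamma>) * norm (chain_dirichlet T n u 0)) \<partial>PL {1..n})
      \<le> (\<integral>\<^sup>+u. (\<Sum>j\<in>{1..n}. ennreal q * ennreal (chain_decay T n (g j) u 0)) \<partial>PL {1..n})"
    proof (intro nn_integral_mono)
      fix u
      have "ennreal ((\<Sum>j\<in>{1..n}. \<bar>u j\<bar> powr \<gamma>) * norm (chain_dirichlet T n u 0)) \<le> ennreal (\<Sum>j\<in>{1..n}. q * chain_decay T n (g j) u 0)"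
        unfolding sum_distrib_right by (intro ennreal_leI sum_mono pt)
      also have "\<dots> = (\<Sum>j\<in>{1..n}. ennreal q * ennreal (chain_decay T n (g j) u 0))"
        using q0 by (subst sum_ennreal[symmetric]) (auto simp: ennreal_mult chain_decay_nonneg)
      finally show "ennreal ((\<Sum>j\<in>{1..n}. \<bar>u j\<bar> powr \<gamma>) * norm (chain_dirichlet T n u 0)) \<le> (\<Sum>j\<in>{1..n}. ennreal q * ennreal (chain_decay T n (g j) u 0))" .
    qed
    also have "\<dots> = (\<Sum>j\<in>{1..n}. ennreal q * (\<integral>\<^sup>+u. ennreal (chain_decay T n (g j) u 0) \<partial>PL {1..n}))"
      using mu by (simp add: nn_integral_sum nn_integral_cmult)
    also have "\<dots> \<le> (\<Sum>j\<in>{1..n}. ennreal q * ennreal (C j * (1 / T) ^ n))"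
      by (intro sum_mono mult_left_mono C T) auto
    also have "\<dots> = ennreal (\<Sum>j\<in>{1..n}. q * (C j * (1 / T) ^ n))"
      using q0 C T by (subst sum_ennreal[symmetric]) (auto simp: ennreal_mult)
    also have "(\<Sum>j\<in>{1..n}. q * (C j * (1 / T) ^ n)) = 3 ^ Suc n * (\<Sum>j\<in>{1..n}. C j) * T powr (1 - \<gamma>)"
    proof -
      have "(3 * T) ^ Suc n * T powr (- \<gamma>) * (1 / T) ^ n = 3 ^ Suc n * (T * T powr (- \<gamma>))"
        using T by (simp add: power_mult_distrib power_one_over field_simps)
      also have "T * T powr (- \<gamma>) = T powr (1 - \<gamma>)"
        using T powr_add[of T 1 "-\<gamma>"] by simp
      finally have e: "q * (1 / T) ^ n = 3 ^ Suc n * T powr (1 - \<gamma>)" by (simp only: q_def)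
      have "(\<Sum>j\<in>{1..n}. q * (C j * (1 / T) ^ n)) = (\<Sum>j\<in>{1..n}. C j * (q * (1 / T) ^ n))"
        by (simp only: mult_ac)
      also have "\<dots> = (\<Sum>j\<in>{1..n}. C j) * (3 ^ Suc n * T powr (1 - \<gamma>))" unfolding e by (simp only: sum_distrib_right)
      finally show ?thesis by (simp only: mult_ac)
    qed
    finally show "(\<integral>\<^sup>+u. ennreal ((\<Sum>j\<in>{1..n}. \<bar>u j\<bar> powr \<gamma>) * norm (chain_dirichlet T n u 0)) \<partial>PL {1..n}) \<le> ennreal (3 ^ Suc n * (\<Sum>j\<in>{1..n}. C j) * T powr (1 - \<gamma>))" .
  qed
qed

lemma phi_zero: "phi (Suc n) h (\<lambda>_. 0) = (LINT l|lborel. (\<Prod>i\<in>{1..Suc n}. h i l))"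
  unfolding phi_def
  by (intro Bochner_Integration.integral_cong refl, subst prod.atLeast_Suc_atMost) (auto simp: numeral_2_eq_2 simp del: prod.cl_ivl_Suc)

text \<open>The hypothesis has a sum of powers instead of a power of |u|, so that each term puts
  weight on a single variable of the chain.\<close>

lemma Delta_bound:
  assumes h: "\<forall>i\<in>{1..Suc n}. integrable lborel (h i)" and \<gamma>: "0 \<le> \<gamma>" "\<gamma> < 1" and K: "K \<ge> 0"
    and ae: "AE u in PL {1..n}. \<bar>phi (Suc n) h u - phi (Suc n) h (\<lambda>_. 0)\<bar> \<le> K * (\<Sum>j\<in>{1..n}. \<bar>u j\<bar> powr \<gamma>)"
  shows "\<exists>C. \<forall>T>0. Delta (Suc n) h T \<le> C * T powr (- \<gamma>)"
proof -
  obtain C where C: "C \<ge> 0" "\<And>T. T > 0 \<Longrightarrow> (\<integral>\<^sup>+u. ennreal ((\<Sum>j\<in>{1..n}. \<bar>u j\<bar> powr \<gamma>) * norm (chain_dirichlet T n u 0)) \<partial>PL {1..n}) \<le> ennreal (C * T powr (1 - \<gamma>))"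
    using weighted_chain_dirichlet_bound[OF \<gamma>, of n] by auto
  show ?thesis
  proof (intro exI allI impI)
    fix T :: real assume T: "T > 0"
    let ?p = "\<lambda>u. phi (Suc n) h u" and ?z = "phi (Suc n) h (\<lambda>_. 0)"
    have i1: "integrable (PL {1..n}) (\<lambda>u. of_real (?p u) * chain_dirichlet T n u 0)" by (rule integrable_phi_chain[OF T h])
    have i2: "integrable (PL {1..n}) (\<lambda>u. of_real ?z * chain_dirichlet T n u 0)" by (intro integrable_mult_right integrable_chain_dirichlet[OF T])
    have "op_trace T (toeplitz_prod T (Suc n) h) - of_real ?z * ((2 * pi) ^ n * of_real T)
      = (LINT u|PL {1..n}. of_real (?p u) * chain_dirichlet T n u 0) - (LINT u|PL {1..n}. of_real ?z * chain_dirichlet T n u 0)"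
      unfolding trace_eq_phi[OF T h] using integral_chain_dirichlet[OF T, of n 0] T by (simp add: dirichlet_0)
    also have "\<dots> = (LINT u|PL {1..n}. of_real (?p u) * chain_dirichlet T n u 0 - of_real ?z * chain_dirichlet T n u 0)"
      by (rule Bochner_Integration.integral_diff[OF i1 i2, symmetric])
    finally have e: "op_trace T (toeplitz_prod T (Suc n) h) - of_real ?z * ((2 * pi) ^ n * of_real T) = \<dots>" .
    have "ennreal (norm (op_trace T (toeplitz_prod T (Suc n) h) - of_real ?z * ((2 * pi) ^ n * of_real T)))
      \<le> (\<integral>\<^sup>+u. ennreal (norm (of_real (?p u) * chain_dirichlet T n u 0 - of_real ?z * chain_dirichlet T n u 0)) \<partial>PL {1..n})"
      unfolding e by (rule integral_norm_bound_ennreal[OF Bochner_Integration.integrable_diff[OF i1 i2]])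
    also have "\<dots> \<le> (\<integral>\<^sup>+u. ennreal K * ennreal ((\<Sum>j\<in>{1..n}. \<bar>u j\<bar> powr \<gamma>) * norm (chain_dirichlet T n u 0)) \<partial>PL {1..n})"
    proof (intro nn_integral_mono_AE)
      show "AE u in PL {1..n}. ennreal (norm (of_real (?p u) * chain_dirichlet T n u 0 - of_real ?z * chain_dirichlet T n u 0)) \<le> ennreal K * ennreal ((\<Sum>j\<in>{1..n}. \<bar>u j\<bar> powr \<gamma>) * norm (chain_dirichlet T n u 0))"
        using ae
      proof eventually_elim
        case (elim u)
        have "norm (of_real (?p u) * chain_dirichlet T n u 0 - of_real ?z * chain_dirichlet T n u 0) = \<bar>?p u - ?z\<bar> * norm (chain_dirichlet T n u 0)"
          unfolding left_diff_distrib[symmetric] norm_mult of_real_diff[symmetric] norm_of_real ..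
        also have "\<dots> \<le> K * (\<Sum>j\<in>{1..n}. \<bar>u j\<bar> powr \<gamma>) * norm (chain_dirichlet T n u 0)"
          by (intro mult_right_mono elim) auto
        finally show ?case using K
          by (subst ennreal_mult[symmetric]) (auto intro!: ennreal_leI mult_nonneg_nonneg sum_nonneg simp: mult.assoc)
      qed
    qed
    also have "\<dots> = ennreal K * (\<integral>\<^sup>+u. ennreal ((\<Sum>j\<in>{1..n}. \<bar>u j\<bar> powr \<gamma>) * norm (chain_dirichlet T n u 0)) \<partial>PL {1..n})"
    proof (rule nn_integral_cmult)
      have [measurable]: "(\<lambda>u. chain_dirichlet T n u 0) \<in> borel_measurable (PL {1..n})"
        using measurable_chain_dirichlet[of "\<lambda>_. 0"] by simp
      have "(\<lambda>u. \<Sum>j\<in>{1..n}. \<bar>u j\<bar> powr \<gamma>) \<in> borel_measurable (PL {1..n})"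
      proof (rule borel_measurable_sum)
        fix j assume "j \<in> {1..n}"
        hence [measurable]: "(\<lambda>u. u j) \<in> borel_measurable (PL {1..n})" by (rule measurable_component_PL)
        show "(\<lambda>u. \<bar>u j\<bar> powr \<gamma>) \<in> borel_measurable (PL {1..n})" by measurable
      qed
      thus "(\<lambda>u. ennreal ((\<Sum>j\<in>{1..n}. \<bar>u j\<bar> powr \<gamma>) * norm (chain_dirichlet T n u 0))) \<in> borel_measurable (PL {1..n})" by measurable
    qed
    also have "\<dots> \<le> ennreal K * ennreal (C * T powr (1 - \<gamma>))" by (intro mult_left_mono C T) auto
    also have "\<dots> = ennreal (K * (C * T powr (1 - \<gamma>)))" using K C by (simp add: ennreal_mult)
    finally have b: "norm (op_trace T (toeplitz_prod T (Suc n) h) - of_real ?z * ((2 * pi) ^ n * of_real T)) \<le> K * (C * T powr (1 - \<gamma>))"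
      using K C by (subst (asm) ennreal_le_iff) auto
    have "Delta (Suc n) h T = norm ((op_trace T (toeplitz_prod T (Suc n) h) - of_real ?z * ((2 * pi) ^ n * of_real T)) / of_real T)"
      unfolding Delta_def phi_zero[symmetric] using T by (simp add: diff_divide_distrib mult_ac)
    also have "\<dots> = norm (op_trace T (toeplitz_prod T (Suc n) h) - of_real ?z * ((2 * pi) ^ n * of_real T)) / T"
      using T by (simp add: norm_divide)
    also have "\<dots> \<le> K * (C * T powr (1 - \<gamma>)) / T" using b T by (intro divide_right_mono) auto
    also have "\<dots> = K * C * T powr (- \<gamma>)" using T by (simp add: powr_diff powr_minus field_simps)
    finally show "Delta (Suc n) h T \<le> K * C * T powr (- \<gamma>)" .
  qed
qed

section \<open>Hoelder conditions\<close>

text \<open>Divided by their sum, the terms lie in [0, 1], where t <= t^g.\<close>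

lemma powr_sum_le_sum_powr:
  fixes x :: "'i \<Rightarrow> real"
  assumes A: "finite A" and x: "\<And>i. i \<in> A \<Longrightarrow> x i \<ge> 0" and g: "0 < g" "g \<le> 1"
  shows "(\<Sum>i\<in>A. x i) powr g \<le> (\<Sum>i\<in>A. x i powr g)"
proof (cases "(\<Sum>i\<in>A. x i) = 0")
  case False
  define S where "S = (\<Sum>i\<in>A. x i)"
  have S: "S > 0" using False x by (simp add: S_def sum_nonneg less_le)
  have "1 = (\<Sum>i\<in>A. x i / S)"
    using S by (simp add: sum_divide_distrib[symmetric] S_def[symmetric])
  also have "\<dots> \<le> (\<Sum>i\<in>A. (x i / S) powr g)"
  proof (intro sum_mono)
    fix i assume i: "i \<in> A"
    have "x i \<le> S" unfolding S_def using i x A by (intro member_le_sum) auto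
    hence "0 \<le> x i / S" "x i / S \<le> 1" using S x[OF i] by auto
    hence "(x i / S) powr 1 \<le> (x i / S) powr g" using g by (intro powr_mono') auto
    moreover have "(x i / S) powr 1 = x i / S" using \<open>0 \<le> x i / S\<close> by (rule powr_one)
    ultimately show "x i / S \<le> (x i / S) powr g" by simp
  qed
  also have "\<dots> = (\<Sum>i\<in>A. x i powr g) / S powr g"
    using S x by (simp add: powr_divide sum_divide_distrib)
  finally have "S powr g \<le> (\<Sum>i\<in>A. x i powr g)" using S by (simp add: field_simps)
  thus ?thesis by (simp add: S_def)
qed (simp add: sum_nonneg)

lemma Delta_nonneg: "Delta m h T \<ge> 0"
  by (simp add: Delta_def)

text \<open>The exponent is lowered from \<gamma> to g < \<gamma>. For |u| <= 1 this only weakens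
  the Hoelder bound; for |u| > 1 that bound grows too fast, and boundedness of \<open>phi\<close>
  replaces it.\<close>

lemma Delta_bigo_of_hoelder:
  assumes h: "\<forall>i\<in>{1..Suc n}. integrable lborel (h i)" and C: "C \<ge> 0" and \<gamma>: "0 < \<gamma>" "\<gamma> \<le> 1" and \<epsilon>: "\<epsilon> > 0"
    and hol: "\<And>u. \<bar>phi (Suc n) h u - phi (Suc n) h (\<lambda>_. 0)\<bar> \<le> C * (\<Sum>i\<in>{1..n}. \<bar>u i\<bar>) powr \<gamma>"
    and bdd: "AE u in PL {1..n}. \<bar>phi (Suc n) h u\<bar> \<le> B"
  shows "(\<lambda>T. Delta (Suc n) h T) \<in> O[at_top](\<lambda>T. T powr (\<epsilon> - \<gamma>))"
proof -
  \<comment> \<open>Close enough to \<gamma> for the given \<epsilon>, strictly below \<gamma> and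
    hence below 1; \<gamma> / 2 keeps g positive when \<epsilon> is large.\<close>
  define g where "g = max (\<gamma> - \<epsilon>) (\<gamma> / 2)"
  have g: "0 < g" "g < \<gamma>" "\<gamma> - \<epsilon> \<le> g" using \<gamma> \<epsilon> by (auto simp: g_def)
  define p0 where "p0 = phi (Suc n) h (\<lambda>_. 0)"
  define K where "K = C + \<bar>B\<bar> + \<bar>p0\<bar>"
  have "AE u in PL {1..n}. \<bar>phi (Suc n) h u - phi (Suc n) h (\<lambda>_. 0)\<bar> \<le> K * (\<Sum>j\<in>{1..n}. \<bar>u j\<bar> powr g)"
    using bdd
  proof eventually_elim
    case (elim u)
    define S where "S = (\<Sum>i\<in>{1..n}. \<bar>u i\<bar>)"
    have S: "S \<ge> 0" by (simp add: S_def sum_nonneg)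
    have "\<bar>phi (Suc n) h u - p0\<bar> \<le> K * S powr g"
    proof (cases "S \<le> 1")
      case True
      have "\<bar>phi (Suc n) h u - p0\<bar> \<le> C * S powr \<gamma>" using hol[of u] by (simp add: S_def p0_def)
      also have "\<dots> \<le> K * S powr g"
        using True S g C by (intro mult_mono powr_mono') (auto simp: K_def)
      finally show ?thesis .
    next
      case False
      have "\<bar>phi (Suc n) h u - p0\<bar> \<le> K * 1" using elim C by (simp add: K_def)
      also have "\<dots> \<le> K * S powr g"
        using False g C by (intro mult_left_mono ge_one_powr_ge_zero) (auto simp: K_def)
      finally show ?thesis .
    qed
    also have "\<dots> \<le> K * (\<Sum>j\<in>{1..n}. \<bar>u j\<bar> powr g)"
      unfolding S_def using g \<gamma> C by (intro mult_left_mono powr_sum_le_sum_powr) (auto simp: K_def)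
    finally show ?case by (simp add: p0_def)
  qed
  from Delta_bound[OF h _ _ _ this] obtain D where D: "\<And>T. T > 0 \<Longrightarrow> Delta (Suc n) h T \<le> D * T powr (- g)"
    using g \<gamma> C by (auto simp: K_def)
  have "norm (Delta (Suc n) h T) \<le> \<bar>D\<bar> * norm (T powr (\<epsilon> - \<gamma>))" if "T \<ge> 1" for T
  proof -
    have "Delta (Suc n) h T \<le> D * T powr (- g)" using that by (intro D) auto
    also have "\<dots> \<le> \<bar>D\<bar> * T powr (\<epsilon> - \<gamma>)"
      using that g by (intro mult_mono powr_mono) auto
    finally show ?thesis using Delta_nonneg[of "Suc n" h T] by simp
  qed
  thus ?thesis
    by (intro bigoI[where c = "\<bar>D\<bar>"] eventually_mono[OF eventually_ge_at_top[of 1]]) auto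
qed

section \<open>Hoelder's inequality for several factors\<close>

text \<open>Jensen's inequality for exp at the logarithms of the x i; a vanishing factor has no
  logarithm and is treated first.\<close>

lemma weighted_arith_geom_mean:
  fixes a x :: "'i \<Rightarrow> real"
  assumes A: "finite A" and a: "\<And>i. i \<in> A \<Longrightarrow> a i \<ge> 0" "(\<Sum>i\<in>A. a i) = 1" and x: "\<And>i. i \<in> A \<Longrightarrow> x i \<ge> 0"
  shows "(\<Prod>i\<in>A. x i powr a i) \<le> (\<Sum>i\<in>A. a i * x i)"
proof (cases "\<exists>i\<in>A. x i = 0")
  case True
  \<comment> \<open>\<open>0 powr a\<close> is 0 for every a, also for a = 0, so a vanishing x i
    always kills the product.\<close>
  hence "(\<Prod>i\<in>A. x i powr a i) = 0" using A by auto
  thus ?thesis using a x by (simp add: sum_nonneg)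
next
  case False
  hence pos: "x i > 0" if "i \<in> A" for i using x[OF that] that by force
  have ne: "A \<noteq> {}" using a(2) by auto
  have "(\<Prod>i\<in>A. x i powr a i) = (\<Prod>i\<in>A. exp (a i *\<^sub>R ln (x i)))"
  proof (intro prod.cong refl)
    fix i assume "i \<in> A"
    thus "x i powr a i = exp (a i *\<^sub>R ln (x i))" using pos[of i] by (simp add: powr_def)
  qed
  also have "\<dots> = exp (\<Sum>i\<in>A. a i *\<^sub>R ln (x i))" using A by (simp add: exp_sum)
  also have "\<dots> \<le> (\<Sum>i\<in>A. a i * exp (ln (x i)))"
    by (rule convex_on_sum[OF A ne exp_convex]) (use a in auto)
  also have "\<dots> = (\<Sum>i\<in>A. a i * x i)" using pos by (intro sum.cong) auto
  finally show ?thesis .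
qed

text \<open>Here \<open>a = 1 / p\<close>, so that \<open>a = 0\<close> stands for \<open>p = \<infinity>\<close>.\<close>

definition Lp_bounded :: "real \<Rightarrow> (real \<Rightarrow> real) \<Rightarrow> real \<Rightarrow> bool" where
  "Lp_bounded a f M \<longleftrightarrow> f \<in> borel_measurable borel \<and> M > 0 \<and>
    (if a = 0 then AE x in lborel. \<bar>f x\<bar> \<le> M
     else integrable lborel (\<lambda>x. \<bar>f x\<bar> powr (1 / a)) \<and> (LINT x|lborel. \<bar>f x\<bar> powr (1 / a)) \<le> M powr (1 / a))"

text \<open>Each factor is divided by its bound M i, and the weighted mean inequality is applied
  pointwise. The normalized powers have integral at most 1 and the weights add up to 1, so the
  majorant W has integral at most the product of the M i.\<close>

lemma hoelder_prod:
  assumes I: "finite I" and a: "\<And>i. i \<in> I \<Longrightarrow> a i \<ge> 0" "(\<Sum>i\<in>I. a i) = 1"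
    and f: "\<And>i. i \<in> I \<Longrightarrow> Lp_bounded (a i) (f i) (M i)"
  shows "integrable lborel (\<lambda>x. \<Prod>i\<in>I. f i x)" and "\<bar>LINT x|lborel. (\<Prod>i\<in>I. f i x)\<bar> \<le> (\<Prod>i\<in>I. M i)"
proof -
  \<comment> \<open>The indices with finite Lebesgue exponent. The others belong to essentially
    bounded factors, estimated directly by M i.\<close>
  define J where "J = {i\<in>I. a i > 0}"
  have J: "finite J" "J \<subseteq> I" using I by (auto simp: J_def)
  have sJ: "(\<Sum>i\<in>J. a i) = 1"
    using a I by (subst a(2)[symmetric]) (intro sum.mono_neutral_left, auto simp: J_def order.strict_iff_order)
  have M: "M i > 0" if "i \<in> I" for i using f[OF that] by (simp add: Lp_bounded_def)
  have [measurable]: "f i \<in> borel_measurable borel" if "i \<in> I" for i using f[OF that] by (simp add: Lp_bounded_def)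
  define P where "P = (\<Prod>i\<in>I. M i)"
  have P: "P > 0" unfolding P_def using M by (intro prod_pos) auto
  define W where "W x = P * (\<Sum>i\<in>J. a i * (\<bar>f i x\<bar> powr (1 / a i) / M i powr (1 / a i)))" for x
  have fJ: "integrable lborel (\<lambda>x. \<bar>f i x\<bar> powr (1 / a i))" "(LINT x|lborel. \<bar>f i x\<bar> powr (1 / a i)) \<le> M i powr (1 / a i)" if "i \<in> J" for i
    using f[of i] that by (auto simp: J_def Lp_bounded_def)
  have iW: "integrable lborel W"
    unfolding W_def by (intro integrable_mult_right Bochner_Integration.integrable_sum integrable_divide fJ)
  have W: "(LINT x|lborel. W x) \<le> P"
  proof -
    have "(LINT x|lborel. W x) = P * (\<Sum>i\<in>J. a i * ((LINT x|lborel. \<bar>f i x\<bar> powr (1 / a i)) / M i powr (1 / a i)))"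
      unfolding W_def by (simp add: Bochner_Integration.integral_sum fJ)
    also have "\<dots> \<le> P * (\<Sum>i\<in>J. a i * 1)"
    proof (intro mult_left_mono sum_mono)
      fix i assume i: "i \<in> J"
      hence "M i powr (1 / a i) > 0" using M[of i] J by auto
      thus "(LINT x|lborel. \<bar>f i x\<bar> powr (1 / a i)) / M i powr (1 / a i) \<le> 1" using fJ(2)[OF i] by simp
      show "a i \<ge> 0" using i by (simp add: J_def)
    qed (use P in auto)
    finally show ?thesis by (simp add: sJ)
  qed
  have "AE x in lborel. \<forall>i\<in>I - J. \<bar>f i x\<bar> \<le> M i"
  proof (rule AE_finite_allI)
    fix i assume "i \<in> I - J"
    hence "i \<in> I" "a i = 0" using a(1)[of i] by (auto simp: J_def)
    thus "AE x in lborel. \<bar>f i x\<bar> \<le> M i" using f[of i] by (simp add: Lp_bounded_def)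
  qed (use I in auto)
  hence le: "AE x in lborel. norm (\<Prod>i\<in>I. f i x) \<le> W x"
  proof eventually_elim
    case (elim x)
    have "norm (\<Prod>i\<in>I. f i x) = (\<Prod>i\<in>I. M i * (\<bar>f i x\<bar> / M i))"
      unfolding prod_norm[symmetric]
    proof (intro prod.cong refl)
      fix i assume "i \<in> I"
      thus "norm (f i x) = M i * (\<bar>f i x\<bar> / M i)" using M[of i] by simp
    qed
    also have "\<dots> = P * (\<Prod>i\<in>I. \<bar>f i x\<bar> / M i)" by (simp only: prod.distrib P_def)
    also have "(\<Prod>i\<in>I. \<bar>f i x\<bar> / M i) \<le> (\<Prod>i\<in>I. if i \<in> J then \<bar>f i x\<bar> / M i else 1)"
    proof (intro prod_mono conjI)
      fix i assume i: "i \<in> I"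
      show "\<bar>f i x\<bar> / M i \<ge> 0" using M[OF i] by simp
      show "\<bar>f i x\<bar> / M i \<le> (if i \<in> J then \<bar>f i x\<bar> / M i else 1)" using M[OF i] elim i by simp
    qed
    also have "(\<Prod>i\<in>I. if i \<in> J then \<bar>f i x\<bar> / M i else 1) = (\<Prod>i\<in>J. \<bar>f i x\<bar> / M i)"
      using J I by (simp add: prod.If_cases Int_absorb1)
    also have "\<dots> = (\<Prod>i\<in>J. (\<bar>f i x\<bar> powr (1 / a i) / M i powr (1 / a i)) powr a i)"
    proof (intro prod.cong refl)
      fix i assume i: "i \<in> J"
      hence ai: "a i > 0" and Mi: "M i > 0" using M J by (auto simp: J_def)
      have "(\<bar>f i x\<bar> powr (1 / a i) / M i powr (1 / a i)) = (\<bar>f i x\<bar> / M i) powr (1 / a i)"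
        using Mi by (simp add: powr_divide)
      thus "\<bar>f i x\<bar> / M i = (\<bar>f i x\<bar> powr (1 / a i) / M i powr (1 / a i)) powr a i"
        using ai Mi by (simp add: powr_powr)
    qed
    also have "\<dots> \<le> (\<Sum>i\<in>J. a i * (\<bar>f i x\<bar> powr (1 / a i) / M i powr (1 / a i)))"
      by (rule weighted_arith_geom_mean) (use J sJ in \<open>auto simp: J_def\<close>)
    finally show ?case using P by (simp add: W_def)
  qed
  show i: "integrable lborel (\<lambda>x. \<Prod>i\<in>I. f i x)"
  proof (rule Bochner_Integration.integrable_bound[OF iW])
    show "AE x in lborel. norm (\<Prod>i\<in>I. f i x) \<le> norm (W x)"
      using le by eventually_elim simp
  qed measurable
  have "\<bar>LINT x|lborel. (\<Prod>i\<in>I. f i x)\<bar> \<le> (LINT x|lborel. norm (\<Prod>i\<in>I. f i x))"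
    using integral_norm_bound[of lborel "\<lambda>x. \<Prod>i\<in>I. f i x"] by simp
  also have "\<dots> \<le> (LINT x|lborel. W x)"
    by (intro integral_mono_AE integrable_norm i iW le)
  finally show "\<bar>LINT x|lborel. (\<Prod>i\<in>I. f i x)\<bar> \<le> (\<Prod>i\<in>I. M i)" using W by (simp add: P_def)
qed

lemma Lp_bounded_shift:
  assumes "Lp_bounded a f M"
  shows "Lp_bounded a (\<lambda>x. f (x + t)) M"
proof -
  have [measurable]: "f \<in> borel_measurable borel" and M: "M > 0" using assms by (auto simp: Lp_bounded_def)
  show ?thesis
  proof (cases "a = 0")
    case True
    have "AE x in lborel. \<bar>f x\<bar> \<le> M" using assms True by (simp add: Lp_bounded_def)
    from AE_borel_affine[OF _ _ this, of 1 t] show ?thesis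
      using True M by (simp add: Lp_bounded_def add.commute)
  next
    case False
    have "integrable lborel (\<lambda>x. \<bar>f x\<bar> powr (1 / a))" and b: "(LINT x|lborel. \<bar>f x\<bar> powr (1 / a)) \<le> M powr (1 / a)"
      using assms False by (simp_all add: Lp_bounded_def)
    from lborel_integrable_real_affine[OF this(1), of 1 t]
    have i: "integrable lborel (\<lambda>x. \<bar>f (x + t)\<bar> powr (1 / a))" by (simp add: add.commute)
    have "(LINT x|lborel. \<bar>f x\<bar> powr (1 / a)) = (LINT x|lborel. \<bar>f (x + t)\<bar> powr (1 / a))"
      using lborel_integral_real_affine[of 1 "\<lambda>x. \<bar>f x\<bar> powr (1 / a)" t] by (simp add: add.commute)
    thus ?thesis using i b False M by (simp add: Lp_bounded_def)
  qed
qed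

lemma Lp_bounded_uminus: "Lp_bounded a f M \<Longrightarrow> Lp_bounded a (\<lambda>x. - f x) M"
  by (simp add: Lp_bounded_def)

text \<open>For t < 0 the increment by t at x is minus the increment by |t| at x + t, and the norm
  is invariant under translation.\<close>

lemma Lp_bounded_diff_symmetric:
  assumes pos: "\<And>t. t > 0 \<Longrightarrow> Lp_bounded a (\<lambda>x. f (x + t) - f x) (K t)" and t: "t \<noteq> 0"
  shows "Lp_bounded a (\<lambda>x. f (x + t) - f x) (K \<bar>t\<bar>)"
proof (cases "t > 0")
  case False
  hence "\<bar>t\<bar> > 0" using t by simp
  from Lp_bounded_uminus[OF Lp_bounded_shift[OF pos[OF this], of t]] show ?thesis using False by simp
qed (use pos in simp)

text \<open>The constant is 4 because Minkowski's inequality is replaced by |x - y|^r <= 2^r (|x|^r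
  + |y|^r), and 2 * 2^r <= 4^r for r >= 1.\<close>

lemma Lp_bounded_diff:
  assumes f: "Lp_bounded a f M" and g: "Lp_bounded a g M" and a: "0 \<le> a" "a \<le> 1"
  shows "Lp_bounded a (\<lambda>x. f x - g x) (4 * M)"
proof -
  have [measurable]: "f \<in> borel_measurable borel" "g \<in> borel_measurable borel" and M: "M > 0"
    using f g by (auto simp: Lp_bounded_def)
  show ?thesis
  proof (cases "a = 0")
    case True
    have "AE x in lborel. \<bar>f x\<bar> \<le> M" "AE x in lborel. \<bar>g x\<bar> \<le> M" using f g True by (auto simp: Lp_bounded_def)
    hence "AE x in lborel. \<bar>f x - g x\<bar> \<le> 4 * M" by eventually_elim (use M in linarith)
    thus ?thesis using True M by (simp add: Lp_bounded_def)
  next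
    case False
    define r where "r = 1 / a"
    have r: "r \<ge> 1" using a False by (simp add: r_def)
    have i: "integrable lborel (\<lambda>x. \<bar>f x\<bar> powr r)" "integrable lborel (\<lambda>x. \<bar>g x\<bar> powr r)"
      and b: "(LINT x|lborel. \<bar>f x\<bar> powr r) \<le> M powr r" "(LINT x|lborel. \<bar>g x\<bar> powr r) \<le> M powr r"
      using f g False by (simp_all add: Lp_bounded_def r_def)
    have pt: "\<bar>x - y\<bar> powr r \<le> 2 powr r * (\<bar>x\<bar> powr r + \<bar>y\<bar> powr r)" for x y :: real
    proof -
      have "\<bar>x - y\<bar> powr r \<le> (2 * max \<bar>x\<bar> \<bar>y\<bar>) powr r" using r by (intro powr_mono2) auto
      also have "\<dots> = 2 powr r * (max \<bar>x\<bar> \<bar>y\<bar>) powr r" by (simp add: powr_mult)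
      also have "\<dots> \<le> 2 powr r * (\<bar>x\<bar> powr r + \<bar>y\<bar> powr r)" by (intro mult_left_mono) (auto simp: max_def)
      finally show ?thesis .
    qed
    have i2: "integrable lborel (\<lambda>x. 2 powr r * (\<bar>f x\<bar> powr r + \<bar>g x\<bar> powr r))"
      by (intro integrable_mult_right Bochner_Integration.integrable_add i)
    have i3: "integrable lborel (\<lambda>x. \<bar>f x - g x\<bar> powr r)"
      by (rule Bochner_Integration.integrable_bound[OF i2]) (use pt in auto)
    have "(LINT x|lborel. \<bar>f x - g x\<bar> powr r) \<le> (LINT x|lborel. 2 powr r * (\<bar>f x\<bar> powr r + \<bar>g x\<bar> powr r))"
      by (intro integral_mono i2 i3 pt)
    also have "\<dots> = 2 powr r * ((LINT x|lborel. \<bar>f x\<bar> powr r) + (LINT x|lborel. \<bar>g x\<bar> powr r))" using i by simp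
    also have "\<dots> \<le> 2 powr r * (M powr r + M powr r)" by (intro mult_left_mono add_mono b) auto
    also have "\<dots> = 2 powr 1 * 2 powr r * M powr r" by simp
    also have "\<dots> \<le> 2 powr r * 2 powr r * M powr r" using r by (intro mult_right_mono powr_mono) auto
    also have "\<dots> = (4 * M) powr r" using M by (simp add: powr_mult[symmetric])
    finally show ?thesis using i3 False M by (simp add: Lp_bounded_def r_def)
  qed
qed

text \<open>Lowering a Lebesgue exponent towards 1 means raising a. For a > 0 it rests on |f|^r <=
  |f| + |f|^(1 / a) for 1 <= r <= 1 / a, for a = 0 on |f|^r <= M^(r - 1) |f|. The 1 added to the
  integral keeps the new bound positive when f vanishes almost everywhere.\<close>

lemma Lp_bounded_interpolate:
  assumes f: "Lp_bounded a f M" and i: "integrable lborel f" and a: "0 \<le> a" "a \<le> a'" "a' \<le> 1"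
  shows "\<exists>M'. Lp_bounded a' f M'"
proof (cases "a' = 0")
  case True
  thus ?thesis using f a by auto
next
  case a': False
  have [measurable]: "f \<in> borel_measurable borel" and M: "M > 0" using f by (auto simp: Lp_bounded_def)
  define r where "r = 1 / a'"
  have r: "r \<ge> 1" using a a' by (simp add: r_def)
  have "integrable lborel (\<lambda>x. \<bar>f x\<bar> powr r)"
  proof (cases "a = 0")
    case True
    have b: "AE x in lborel. \<bar>f x\<bar> \<le> M" using f True by (simp add: Lp_bounded_def)
    show ?thesis
    proof (rule Bochner_Integration.integrable_bound)
      show "integrable lborel (\<lambda>x. M powr (r - 1) * \<bar>f x\<bar>)" using i by auto
      show "AE x in lborel. norm (\<bar>f x\<bar> powr r) \<le> norm (M powr (r - 1) * \<bar>f x\<bar>)"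
        using b
      proof eventually_elim
        case (elim x)
        have "\<bar>f x\<bar> powr r = \<bar>f x\<bar> powr (r - 1) * \<bar>f x\<bar>"
          by (cases "f x = 0") (auto simp: powr_diff)
        also have "\<dots> \<le> M powr (r - 1) * \<bar>f x\<bar>" using elim r by (intro mult_right_mono powr_mono2) auto
        finally show ?case by simp
      qed
    qed measurable
  next
    case False
    have ia: "integrable lborel (\<lambda>x. \<bar>f x\<bar> powr (1 / a))" using f False by (simp add: Lp_bounded_def)
    have ra: "r \<le> 1 / a" using a a' False by (simp add: r_def divide_simps)
    show ?thesis
    proof (rule Bochner_Integration.integrable_bound)
      show "integrable lborel (\<lambda>x. \<bar>f x\<bar> + \<bar>f x\<bar> powr (1 / a))" using i ia by auto
      have "\<bar>f x\<bar> powr r \<le> \<bar>f x\<bar> + \<bar>f x\<bar> powr (1 / a)" for x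
      proof (cases "\<bar>f x\<bar> \<le> 1")
        case True
        hence "\<bar>f x\<bar> powr r \<le> \<bar>f x\<bar> powr 1" using r by (intro powr_mono') auto
        thus ?thesis by (simp add: add_increasing2)
      next
        case False
        hence "\<bar>f x\<bar> powr r \<le> \<bar>f x\<bar> powr (1 / a)" using ra by (intro powr_mono) auto
        thus ?thesis by (simp add: add_increasing)
      qed
      thus "AE x in lborel. norm (\<bar>f x\<bar> powr r) \<le> norm (\<bar>f x\<bar> + \<bar>f x\<bar> powr (1 / a))" by simp
    qed measurable
  qed
  moreover have "(LINT x|lborel. \<bar>f x\<bar> powr r) \<le> (((LINT x|lborel. \<bar>f x\<bar> powr r) + 1) powr a') powr r"
    using a' a by (simp add: powr_powr r_def add_nonneg_pos Bochner_Integration.integral_nonneg)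
  moreover have "((LINT x|lborel. \<bar>f x\<bar> powr r) + 1) powr a' > 0"
  proof -
    have "(LINT x|lborel. \<bar>f x\<bar> powr r) \<ge> 0" by (rule Bochner_Integration.integral_nonneg) simp
    hence "(LINT x|lborel. \<bar>f x\<bar> powr r) + 1 > 0" by linarith
    thus ?thesis unfolding powr_gt_zero by (rule less_imp_neq[THEN not_sym])
  qed
  ultimately show ?thesis using a'
    by (intro exI[of _ "((LINT x|lborel. \<bar>f x\<bar> powr r) + 1) powr a'"]) (simp add: Lp_bounded_def r_def del: powr_gt_zero)
qed

lemma prod_diff_telescope:
  fixes a b :: "nat \<Rightarrow> 'a::comm_ring_1"
  shows "(\<Prod>i\<in>{1..m}. a i) - (\<Prod>i\<in>{1..m}. b i) =
    (\<Sum>j\<in>{1..m}. \<Prod>i\<in>{1..m}. if i < j then a i else if i = j then a i - b i else b i)"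
proof (induction m)
  case (Suc m)
  have "(\<Sum>j\<in>{1..Suc m}. \<Prod>i\<in>{1..Suc m}. if i < j then a i else if i = j then a i - b i else b i)
    = (\<Sum>j\<in>{1..m}. (\<Prod>i\<in>{1..m}. if i < j then a i else if i = j then a i - b i else b i) * b (Suc m))
     + (\<Prod>i\<in>{1..m}. if i < Suc m then a i else if i = Suc m then a i - b i else b i) * (a (Suc m) - b (Suc m))"
    by simp
  also have "(\<Prod>i\<in>{1..m}. if i < Suc m then a i else if i = Suc m then a i - b i else b i) = (\<Prod>i\<in>{1..m}. a i)"
    by (intro prod.cong) auto
  also have "(\<Sum>j\<in>{1..m}. (\<Prod>i\<in>{1..m}. if i < j then a i else if i = j then a i - b i else b i) * b (Suc m))
    = ((\<Prod>i\<in>{1..m}. a i) - (\<Prod>i\<in>{1..m}. b i)) * b (Suc m)"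
    unfolding Suc.IH sum_distrib_right ..
  finally show ?case by (simp add: algebra_simps)
qed simp

lemma phi_prod:
  "phi (Suc n) h u = (LINT x|lborel. (\<Prod>i\<in>{1..Suc n}. h i (x + (- (u(0 := 0)) (i - 1)))))"
  unfolding phi_anchored by (intro Bochner_Integration.integral_cong prod.cong refl) (auto simp: anchored_def)

lemma Delta_bigo_of_Lp_hoelder:
  assumes n: "n \<ge> 1" and h: "\<forall>i\<in>{1..Suc n}. integrable lborel (h i)"
    and a: "\<And>i. i \<in> {1..Suc n} \<Longrightarrow> 0 \<le> a i \<and> a i \<le> 1" "(\<Sum>i\<in>{1..Suc n}. a i) \<le> 1"
    and M: "\<And>i. i \<in> {1..Suc n} \<Longrightarrow> Lp_bounded (a i) (h i) (M i)"
    and K: "\<And>i t. i \<in> {1..Suc n} \<Longrightarrow> t \<noteq> 0 \<Longrightarrow> Lp_bounded (a i) (\<lambda>x. h i (x + t) - h i x) (K i * \<bar>t\<bar> powr \<gamma>)"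
    and \<gamma>: "0 < \<gamma>" "\<gamma> \<le> 1" and \<epsilon>: "\<epsilon> > 0"
  shows "(\<lambda>T. Delta (Suc n) h T) \<in> O[at_top](\<lambda>T. T powr (\<epsilon> - \<gamma>))"
proof -
  let ?I = "{1..Suc n}"
  \<comment> \<open>The increment of h j is controlled at the exponent a j only, so the missing part
    of the sum goes to another index k, which exists because there are at least two factors. The
    exponents thus depend on j.\<close>
  have "\<exists>e N. (\<forall>i\<in>?I. 0 \<le> e i \<and> Lp_bounded (e i) (h i) (N i)) \<and> (\<Sum>i\<in>?I. e i) = 1 \<and> e j = a j" if j: "j \<in> ?I" for j
  proof -
    obtain k where k: "k \<in> ?I" "k \<noteq> j" using n by (cases "j = 1") (auto intro: that[of 1] that[of 2])
    define s where "s = (\<Sum>i\<in>?I - {k}. a i)"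
    have s: "a k + s \<le> 1" "s \<ge> 0"
      using a(2) sum.remove[of ?I k a] k a(1) unfolding s_def by (auto intro: sum_nonneg)
    have "\<exists>M'. Lp_bounded (1 - s) (h k) M'"
      by (rule Lp_bounded_interpolate[OF M[OF k(1)]]) (use h k a s in auto)
    then obtain M' where M': "Lp_bounded (1 - s) (h k) M'" ..
    have "(\<Sum>i\<in>?I. (a(k := 1 - s)) i) = (1 - s) + (\<Sum>i\<in>?I - {k}. (a(k := 1 - s)) i)"
      using k by (subst sum.remove[of _ k]) auto
    also have "(\<Sum>i\<in>?I - {k}. (a(k := 1 - s)) i) = s" unfolding s_def by (intro sum.cong) auto
    finally have sum: "(\<Sum>i\<in>?I. (a(k := 1 - s)) i) = 1" by simp
    have "a k \<ge> 0" using a(1)[OF k(1)] by simp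
    hence "1 - s \<ge> 0" using s by linarith
    thus ?thesis using k M' M a(1) sum
      by (intro exI[of _ "a(k := 1 - s)"] exI[of _ "M(k := M')"]) auto
  qed
  hence "\<forall>j\<in>?I. \<exists>e N. (\<forall>i\<in>?I. 0 \<le> e i \<and> Lp_bounded (e i) (h i) (N i)) \<and> (\<Sum>i\<in>?I. e i) = 1 \<and> e j = a j" by blast
  then obtain e where "\<forall>j\<in>?I. \<exists>N. (\<forall>i\<in>?I. 0 \<le> e j i \<and> Lp_bounded (e j i) (h i) (N i)) \<and> (\<Sum>i\<in>?I. e j i) = 1 \<and> e j j = a j"
    by (rule bchoice[THEN exE])
  then obtain N where eN: "\<forall>j\<in>?I. (\<forall>i\<in>?I. 0 \<le> e j i \<and> Lp_bounded (e j i) (h i) (N j i)) \<and> (\<Sum>i\<in>?I. e j i) = 1 \<and> e j j = a j"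
    by (rule bchoice[THEN exE])
  have one: "1 \<in> ?I" by simp
  \<comment> \<open>Any one of the exponent systems bounds \<open>phi\<close> uniformly in the
    shifts; the one for j = 1 is taken.\<close>
  have shifted: "integrable lborel (\<lambda>x. \<Prod>i\<in>?I. h i (x + v i))" "\<bar>LINT x|lborel. (\<Prod>i\<in>?I. h i (x + v i))\<bar> \<le> (\<Prod>i\<in>?I. N 1 i)" for v
  proof -
    have nn: "\<And>i. i \<in> ?I \<Longrightarrow> 0 \<le> e 1 i" and s1: "(\<Sum>i\<in>?I. e 1 i) = 1"
      and L: "\<And>i. i \<in> ?I \<Longrightarrow> Lp_bounded (e 1 i) (\<lambda>x. h i (x + v i)) (N 1 i)"
      using eN one by (blast intro: Lp_bounded_shift)+
    show "integrable lborel (\<lambda>x. \<Prod>i\<in>?I. h i (x + v i))" by (rule hoelder_prod(1)[OF finite_atLeastAtMost nn s1 L])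
    show "\<bar>LINT x|lborel. (\<Prod>i\<in>?I. h i (x + v i))\<bar> \<le> (\<Prod>i\<in>?I. N 1 i)" by (rule hoelder_prod(2)[OF finite_atLeastAtMost nn s1 L])
  qed
  define c where "c j = K j * (\<Prod>i\<in>?I - {j}. N j i)" for j
  have c0: "c j \<ge> 0" if j: "j \<in> ?I" for j
  proof -
    have "K j * \<bar>1\<bar> powr \<gamma> > 0" using K[OF j, of 1] by (simp add: Lp_bounded_def)
    hence "K j > 0" by simp
    moreover have "N j i > 0" if "i \<in> ?I" for i using eN j that by (auto simp: Lp_bounded_def)
    ultimately show ?thesis unfolding c_def by (intro mult_nonneg_nonneg prod_nonneg) (auto intro: less_imp_le)
  qed
  show ?thesis
  proof (rule Delta_bigo_of_hoelder[OF h _ \<gamma> \<epsilon>])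
    show "AE u in PL {1..n}. \<bar>phi (Suc n) h u\<bar> \<le> (\<Prod>i\<in>?I. N 1 i)"
      unfolding phi_prod by (intro AE_I2 shifted)
    show "(\<Sum>j\<in>?I. c j) \<ge> 0" by (intro sum_nonneg c0)
    fix u :: "nat \<Rightarrow> real"
    \<comment> \<open>The translation of the i-th factor; v 1 = 0 by the convention u_0 = 0.\<close>
    define v where "v i = - (u(0 := 0)) (i - 1)" for i
    define S where "S = (\<Sum>i\<in>{1..n}. \<bar>u i\<bar>)"
    have vS: "\<bar>v i\<bar> \<le> S" if "i \<in> ?I" for i
    proof (cases "i = 1")
      case False
      hence "i - 1 \<in> {1..n}" using that by auto
      hence "\<bar>u (i - 1)\<bar> \<le> S" unfolding S_def by (intro member_le_sum) auto
      thus ?thesis using False that by (simp add: v_def)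
    qed (simp add: v_def S_def sum_nonneg)
    let ?F = "\<lambda>j i x. if i < j then h i (x + v i) else if i = j then h i (x + v i) - h i x else h i x"
    have summand: "integrable lborel (\<lambda>x. \<Prod>i\<in>?I. ?F j i x) \<and> \<bar>LINT x|lborel. (\<Prod>i\<in>?I. ?F j i x)\<bar> \<le> c j * S powr \<gamma>" if j: "j \<in> ?I" for j
    \<comment> \<open>\<open>Lp_bounded\<close> asks for a positive bound, so the increment by 0 is
      treated separately.\<close>
    proof (cases "v j = 0")
      case True
      have z: "(\<Prod>i\<in>?I. ?F j i x) = 0" for x using True j by (intro prod_zero bexI[of _ j]) auto
      show ?thesis unfolding z using c0[OF j] by simp
    next
      case False
      let ?B = "\<lambda>i. if i = j then K j * \<bar>v j\<bar> powr \<gamma> else N j i"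
      have L: "Lp_bounded (e j i) (\<lambda>x. ?F j i x) (?B i)" if i: "i \<in> ?I" for i
      proof -
        have *: "Lp_bounded (e j i) (h i) (N j i)" "e j j = a j" using eN i j by auto
        consider "i < j" | "i = j" | "i > j" by linarith
        thus ?thesis
        proof cases
          case 1
          thus ?thesis using Lp_bounded_shift[OF *(1), of "v i"] by simp
        next
          case 2
          thus ?thesis using K[OF j False] * by simp
        next
          case 3
          thus ?thesis using *(1) by simp
        qed
      qed
      have "(\<Prod>i\<in>?I. ?B i) = (K j * \<bar>v j\<bar> powr \<gamma>) * (\<Prod>i\<in>?I - {j}. ?B i)"
        using j by (subst prod.remove[of _ j]) auto
      also have "(\<Prod>i\<in>?I - {j}. ?B i) = (\<Prod>i\<in>?I - {j}. N j i)" by (intro prod.cong) auto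
      finally have "(\<Prod>i\<in>?I. ?B i) = c j * \<bar>v j\<bar> powr \<gamma>" by (simp only: c_def mult_ac)
      also have "\<dots> \<le> c j * S powr \<gamma>" using vS[OF j] \<gamma> c0[OF j] by (intro mult_left_mono powr_mono2) auto
      finally have B: "(\<Prod>i\<in>?I. ?B i) \<le> c j * S powr \<gamma>" .
      have nn: "\<And>i. i \<in> ?I \<Longrightarrow> 0 \<le> e j i" and s1: "(\<Sum>i\<in>?I. e j i) = 1" using eN j by auto
      show ?thesis
        using hoelder_prod[OF finite_atLeastAtMost nn s1 L] B by (meson order_trans)
    qed
    have i1: "integrable lborel (\<lambda>x. \<Prod>i\<in>?I. h i (x + v i))" and i2: "integrable lborel (\<lambda>x. \<Prod>i\<in>?I. h i x)"
      using shifted(1)[of v] shifted(1)[of "\<lambda>_. 0"] by simp_all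
    have "phi (Suc n) h u - phi (Suc n) h (\<lambda>_. 0) = (LINT x|lborel. (\<Prod>i\<in>?I. h i (x + v i)) - (\<Prod>i\<in>?I. h i x))"
      unfolding phi_prod[of n h u] phi_zero v_def[symmetric] by (rule Bochner_Integration.integral_diff[OF i1 i2, symmetric])
    also have "\<dots> = (\<Sum>j\<in>?I. LINT x|lborel. (\<Prod>i\<in>?I. ?F j i x))"
      unfolding prod_diff_telescope by (rule Bochner_Integration.integral_sum) (use summand in blast)
    finally have "\<bar>phi (Suc n) h u - phi (Suc n) h (\<lambda>_. 0)\<bar> \<le> (\<Sum>j\<in>?I. \<bar>LINT x|lborel. (\<Prod>i\<in>?I. ?F j i x)\<bar>)"
      by (simp only: sum_abs)
    also have "\<dots> \<le> (\<Sum>j\<in>?I. c j * S powr \<gamma>)" using summand by (intro sum_mono) blast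
    also have "\<dots> = (\<Sum>j\<in>?I. c j) * S powr \<gamma>" by (simp only: sum_distrib_right)
    finally show "\<bar>phi (Suc n) h u - phi (Suc n) h (\<lambda>_. 0)\<bar> \<le> (\<Sum>j\<in>?I. c j) * (\<Sum>i\<in>{1..n}. \<bar>u i\<bar>) powr \<gamma>"
      by (simp only: S_def)
  qed
qed

section \<open>Lipschitz classes and power singularities\<close>

lemma ennreal_exponent_cases:
  fixes p :: ennreal
  assumes p: "1 \<le> p"
  obtains "p = \<top>" "enn2real (inverse p) = 0"
  | r where "r \<ge> 1" "p = ennreal r" "p \<noteq> \<top>" "enn2real p = r" "enn2real (inverse p) = 1 / r"
proof (cases p)
  case top
  thus ?thesis using that(1) by simp
next
  case (real r)
  hence r: "r \<ge> 1" using p by (simp add: ennreal_1[symmetric] del: ennreal_1)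
  hence "inverse p = ennreal (1 / r)" using real by (simp add: inverse_ennreal divide_inverse)
  thus ?thesis using that(2)[of r] real r by simp
qed

lemma Lp_bounded_of_in_Lp:
  assumes p: "1 \<le> p" and f: "in_Lp p f"
  shows "\<exists>M. Lp_bounded (enn2real (inverse p)) f M"
  using p
proof (cases rule: ennreal_exponent_cases)
  case 1
  let ?s = "esssup lborel (\<lambda>x. ereal \<bar>f x\<bar>)"
  have fin: "?s < \<infinity>" and m: "f \<in> borel_measurable borel" using f 1 by (auto simp: in_Lp_def)
  have "AE x in lborel. ereal \<bar>f x\<bar> \<le> ?s" by (rule esssup_AE)
  hence "AE x in lborel. \<bar>f x\<bar> \<le> max 1 (real_of_ereal ?s)"
  proof eventually_elim
    case (elim x)
    have "?s \<noteq> -\<infinity>" using elim by auto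
    then obtain s where "?s = ereal s" using fin by (cases ?s) auto
    thus ?case using elim by simp
  qed
  thus ?thesis using m 1 by (intro exI[of _ "max 1 (real_of_ereal ?s)"]) (auto simp: Lp_bounded_def)
next
  case (2 r)
  define N where "N = (LINT x|lborel. \<bar>f x\<bar> powr r)"
  have i: "integrable lborel (\<lambda>x. \<bar>f x\<bar> powr r)" and m: "f \<in> borel_measurable borel"
    using f 2 by (auto simp: in_Lp_def)
  have N: "N \<ge> 0" unfolding N_def by (rule Bochner_Integration.integral_nonneg) simp
  hence "N + 1 > 0" by linarith
  hence "N \<le> ((N + 1) powr (1 / r)) powr r" "(N + 1) powr (1 / r) > 0" using 2 by (simp_all add: powr_powr)
  thus ?thesis using i m 2 by (intro exI[of _ "(N + 1) powr (1 / r)"]) (auto simp: Lp_bounded_def N_def)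
qed

lemma Lp_norm_le_of_Lp_bounded:
  assumes p: "1 \<le> p" and f: "Lp_bounded (enn2real (inverse p)) f M"
  shows "Lp_norm p f \<le> M"
  using p
proof (cases rule: ennreal_exponent_cases)
  case 1
  have [measurable]: "f \<in> borel_measurable borel" and M: "M > 0" and ae: "AE x in lborel. \<bar>f x\<bar> \<le> M"
    using f 1 by (auto simp: Lp_bounded_def)
  let ?s = "esssup lborel (\<lambda>x. ereal \<bar>f x\<bar>)"
  have "?s \<le> ereal M" by (rule esssup_I) (use ae in auto)
  hence "real_of_ereal ?s \<le> M" using M by (cases ?s) auto
  thus ?thesis using 1 by (simp add: Lp_norm_def)
next
  case (2 r)
  have M: "M > 0" and b: "(LINT x|lborel. \<bar>f x\<bar> powr r) \<le> M powr r" using f 2 by (auto simp: Lp_bounded_def)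
  have "(LINT x|lborel. \<bar>f x\<bar> powr r) powr (1 / r) \<le> (M powr r) powr (1 / r)"
    using b 2 by (intro powr_mono2 Bochner_Integration.integral_nonneg) auto
  also have "\<dots> = M" using M 2 by (simp add: powr_powr)
  finally show ?thesis using 2 by (simp add: Lp_norm_def)
qed

text \<open>The a priori bound M0 guards against default values: \<open>Lp_norm\<close> is also 0
  when the integral diverges or the essential supremum is infinite.\<close>

lemma Lp_bounded_of_Lp_norm_le:
  assumes p: "1 \<le> p" and f: "Lp_bounded (enn2real (inverse p)) f M0" and M: "M > 0" and le: "Lp_norm p f \<le> M"
  shows "Lp_bounded (enn2real (inverse p)) f M"
  using p
proof (cases rule: ennreal_exponent_cases)
  case 1
  have [measurable]: "f \<in> borel_measurable borel" and ae: "AE x in lborel. \<bar>f x\<bar> \<le> M0"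
    using f 1 by (auto simp: Lp_bounded_def)
  let ?s = "esssup lborel (\<lambda>x. ereal \<bar>f x\<bar>)"
  have s: "?s \<le> ereal M0" by (rule esssup_I) (use ae in auto)
  have "AE x in lborel. ereal \<bar>f x\<bar> \<le> ?s" by (rule esssup_AE)
  hence "AE x in lborel. \<bar>f x\<bar> \<le> M"
  proof eventually_elim
    case (elim x)
    have "?s \<noteq> -\<infinity>" using elim by auto
    then obtain t where "?s = ereal t" using s by (cases ?s) auto
    thus ?case using elim le 1 by (simp add: Lp_norm_def)
  qed
  thus ?thesis using M 1 by (simp add: Lp_bounded_def)
next
  case (2 r)
  define N where "N = (LINT x|lborel. \<bar>f x\<bar> powr r)"
  have N: "N \<ge> 0" unfolding N_def by (rule Bochner_Integration.integral_nonneg) simp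
  have "N powr (1 / r) \<le> M" using le 2 by (simp add: Lp_norm_def N_def)
  hence "(N powr (1 / r)) powr r \<le> M powr r" using 2 by (intro powr_mono2) auto
  hence "N \<le> M powr r" using N 2 by (simp add: powr_powr)
  thus ?thesis using f M 2 by (simp add: Lp_bounded_def N_def)
qed

text \<open>\<open>Lip\<close> speaks of small increments only. For t >= d the crude bound 4 M is
  absorbed into K, since t^\<gamma> >= d^\<gamma>. The same crude bound shows that the supremum in
  \<open>omega\<close> is over a bounded set.\<close>

lemma Lip_imp_Lp_hoelder:
  assumes p: "1 \<le> p" and f: "f \<in> Lip p \<gamma>" and \<gamma>: "0 < \<gamma>"
  shows "\<exists>K. \<forall>t. t \<noteq> 0 \<longrightarrow> Lp_bounded (enn2real (inverse p)) (\<lambda>x. f (x + t) - f x) (K * \<bar>t\<bar> powr \<gamma>)"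
proof -
  let ?a = "enn2real (inverse p)"
  have a: "0 \<le> ?a" by simp
  have a1: "?a \<le> 1" using p by (cases rule: ennreal_exponent_cases) auto
  obtain M where M: "Lp_bounded ?a f M" using Lp_bounded_of_in_Lp[OF p] f by (auto simp: Lip_def)
  have M0: "M > 0" using M by (simp add: Lp_bounded_def)
  have D: "Lp_bounded ?a (\<lambda>x. f (x + t) - f x) (4 * M)" for t
    by (rule Lp_bounded_diff[OF Lp_bounded_shift[OF M] M a a1])
  have "(\<lambda>\<delta>. omega p f \<delta>) \<in> O[at_right 0](\<lambda>\<delta>. \<delta> powr \<gamma>)" using f by (simp add: Lip_def)
  then obtain c where c: "c > 0" "eventually (\<lambda>\<delta>. norm (omega p f \<delta>) \<le> c * norm (\<delta> powr \<gamma>)) (at_right 0)"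
    by (elim landau_o.bigE) auto
  then obtain d where d: "d > 0" "\<And>\<delta>. 0 < \<delta> \<Longrightarrow> \<delta> < d \<Longrightarrow> norm (omega p f \<delta>) \<le> c * norm (\<delta> powr \<gamma>)"
    unfolding eventually_at_right_field by auto
  define K where "K = c + 4 * M / d powr \<gamma>"
  have K: "K > 0" using c M0 d by (auto simp: K_def intro!: add_pos_nonneg)
  have "Lp_bounded ?a (\<lambda>x. f (x + t) - f x) (K * t powr \<gamma>)" if t: "t > 0" for t
  proof (rule Lp_bounded_of_Lp_norm_le[OF p D])
    show "K * t powr \<gamma> > 0" using K t by simp
    show "Lp_norm p (\<lambda>x. f (x + t) - f x) \<le> K * t powr \<gamma>"
    proof (cases "t < d")
      case True
      have "Lp_norm p (\<lambda>x. f (x + t) - f x) \<le> omega p f t"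
        unfolding omega_def using t Lp_norm_le_of_Lp_bounded[OF p D]
        by (intro cSUP_upper) (auto intro!: bdd_aboveI)
      also have "\<dots> \<le> c * t powr \<gamma>" using d(2)[OF t True] by simp
      also have "\<dots> \<le> K * t powr \<gamma>" using M0 by (intro mult_right_mono) (auto simp: K_def)
      finally show ?thesis .
    next
      case False
      have "Lp_norm p (\<lambda>x. f (x + t) - f x) \<le> 4 * M" by (rule Lp_norm_le_of_Lp_bounded[OF p D])
      also have "\<dots> = 4 * M / d powr \<gamma> * d powr \<gamma>" using d by simp
      also have "\<dots> \<le> K * t powr \<gamma>"
        using False d \<gamma> c M0 by (intro mult_mono powr_mono2) (auto simp: K_def)
      finally show ?thesis .
    qed
  qed
  from Lp_bounded_diff_symmetric[OF this] show ?thesis by (intro exI[of _ K]) auto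
qed

lemma Delta_bigo_of_Lip:
  fixes p :: "nat \<Rightarrow> ennreal"
  assumes n: "n \<ge> 1" and h: "\<forall>i\<in>{1..Suc n}. integrable lborel (h i)"
    and L: "\<forall>i\<in>{1..Suc n}. 1 \<le> p i \<and> h i \<in> Lip (p i) \<gamma>" and sum: "(\<Sum>i\<in>{1..Suc n}. inverse (p i)) \<le> 1"
    and \<gamma>: "0 < \<gamma>" "\<gamma> \<le> 1" and \<epsilon>: "\<epsilon> > 0"
  shows "(\<lambda>T. Delta (Suc n) h T) \<in> O[at_top](\<lambda>T. T powr (\<epsilon> - \<gamma>))"
proof -
  let ?I = "{1..Suc n}"
  define a where "a i = enn2real (inverse (p i))" for i
  have "\<forall>i\<in>?I. \<exists>M. Lp_bounded (a i) (h i) M"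
    unfolding a_def using L Lp_bounded_of_in_Lp by (auto simp: Lip_def)
  then obtain M where M: "\<forall>i\<in>?I. Lp_bounded (a i) (h i) (M i)" by (rule bchoice[THEN exE])
  have "\<forall>i\<in>?I. \<exists>K. \<forall>t. t \<noteq> 0 \<longrightarrow> Lp_bounded (a i) (\<lambda>x. h i (x + t) - h i x) (K * \<bar>t\<bar> powr \<gamma>)"
    unfolding a_def using L \<gamma> Lip_imp_Lp_hoelder by blast
  then obtain K where K: "\<forall>i\<in>?I. \<forall>t. t \<noteq> 0 \<longrightarrow> Lp_bounded (a i) (\<lambda>x. h i (x + t) - h i x) (K i * \<bar>t\<bar> powr \<gamma>)"
    by (rule bchoice[THEN exE])
  have ai: "0 \<le> a i \<and> a i \<le> 1 \<and> inverse (p i) = ennreal (a i)" if "i \<in> ?I" for i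
  proof -
    have "1 \<le> p i" using L that by auto
    thus ?thesis unfolding a_def by (cases rule: ennreal_exponent_cases) (auto simp: inverse_ennreal divide_inverse inverse_le_1_iff)
  qed
  have "ennreal (\<Sum>i\<in>?I. a i) = (\<Sum>i\<in>?I. inverse (p i))"
    using ai by (subst sum_ennreal[symmetric]) (auto intro: sum.cong simp del: sum.cl_ivl_Suc)
  hence "ennreal (\<Sum>i\<in>?I. a i) \<le> ennreal 1" using sum by (simp del: sum.cl_ivl_Suc)
  hence "(\<Sum>i\<in>?I. a i) \<le> 1" by (subst (asm) ennreal_le_iff) auto
  thus ?thesis
    using ai M K by (intro Delta_bigo_of_Lp_hoelder[OF n h, of a M K \<gamma>] \<gamma> \<epsilon>) auto
qed

section \<open>Symbols with a power singularity at the origin\<close>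

lemma nn_integral_powr_near_0:
  assumes a: "0 \<le> a" "a < 1" and R: "R \<ge> 0"
  shows "(\<integral>\<^sup>+x. ennreal (\<bar>x\<bar> powr (- a)) * indicator {-R..R} x \<partial>lborel) < \<infinity>"
proof -
  let ?f = "\<lambda>x::real. ennreal (x powr (- a)) * indicator {0..R} x"
  have "((\<lambda>x. x powr (- a)) has_integral (R powr (- a + 1) / (- a + 1))) {0..R}"
    by (rule has_integral_powr_from_0) (use a R in auto)
  from nn_integral_has_integral_lebesgue[OF _ this]
  have "(\<integral>\<^sup>+x. ennreal (indicator {0..R} x * x powr (- a)) \<partial>lborel) < \<infinity>"
    by (simp add: nn_integral_completion)
  moreover have "ennreal (indicator {0..R} x * x powr (- a)) = ?f x" for x :: real
    by (auto split: split_indicator)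
  ultimately have half: "(\<integral>\<^sup>+x. ?f x \<partial>lborel) < \<infinity>" by simp
  have "(\<integral>\<^sup>+x. ennreal (\<bar>x\<bar> powr (- a)) * indicator {-R..R} x \<partial>lborel) \<le> (\<integral>\<^sup>+x. ?f x + ?f (0 + (-1) * x) \<partial>lborel)"
    by (intro nn_integral_mono) (auto split: split_indicator)
  also have "\<dots> = (\<integral>\<^sup>+x. ?f x \<partial>lborel) + (\<integral>\<^sup>+x. ?f (0 + (-1) * x) \<partial>lborel)"
    by (rule nn_integral_add) measurable
  also have "(\<integral>\<^sup>+x. ?f (0 + (-1) * x) \<partial>lborel) = (\<integral>\<^sup>+x. ?f x \<partial>lborel)"
    by (subst nn_integral_real_affine[of ?f "-1" 0]) auto
  finally show ?thesis using half by (auto simp: less_top[symmetric] top_unique)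
qed

lemma nn_integral_powr_at_infinity:
  assumes b: "b > 1"
  shows "(\<integral>\<^sup>+x. ennreal (\<bar>x\<bar> powr (- b)) * indicator {x. \<bar>x\<bar> > 1} x \<partial>lborel) < \<infinity>"
proof -
  have "(\<integral>\<^sup>+x. ennreal (\<bar>x\<bar> powr (- b)) * indicator {x. \<bar>x\<bar> > 1} x \<partial>lborel) \<le> (\<integral>\<^sup>+x. ennreal (2 powr b) * ennreal (decay b x) \<partial>lborel)"
  proof (intro nn_integral_mono)
    fix x :: real
    have "\<bar>x\<bar> powr (- b) \<le> 2 powr b * decay b x" if "\<bar>x\<bar> > 1"
    proof -
      have "\<bar>x\<bar> powr (- b) \<le> ((1 + \<bar>x\<bar>) / 2) powr (- b)" using that b by (intro powr_mono2') auto
      also have "\<dots> = 2 powr b * decay b x" by (simp add: decay_def powr_divide powr_minus divide_simps)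
      finally show ?thesis .
    qed
    thus "ennreal (\<bar>x\<bar> powr (- b)) * indicator {x. \<bar>x\<bar> > 1} x \<le> ennreal (2 powr b) * ennreal (decay b x)"
      by (auto simp: ennreal_mult[symmetric] intro!: ennreal_leI split: split_indicator)
  qed
  also have "\<dots> = ennreal (2 powr b) * (\<integral>\<^sup>+x. ennreal (decay b x) \<partial>lborel)" by (rule nn_integral_cmult) simp
  also have "\<dots> < \<infinity>" using nn_integral_decay_finite[OF b] by (auto simp: ennreal_mult_less_top)
  finally show ?thesis .
qed

text \<open>The radius 3 makes room for both y and 1 + y when |y| <= 2.\<close>

lemma integrable_powr_near_0:
  assumes "0 \<le> a" "a < 1"
  shows "integrable lborel (\<lambda>x. \<bar>x\<bar> powr (- a) * indicator {-3..3::real} x)"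
proof -
  have "(\<integral>\<^sup>+x. ennreal (norm (\<bar>x\<bar> powr (- a) * indicator {-3..3::real} x)) \<partial>lborel) = (\<integral>\<^sup>+x. ennreal (\<bar>x\<bar> powr (- a)) * indicator {-3..3} x \<partial>lborel)"
    by (intro nn_integral_cong) (auto split: split_indicator)
  thus ?thesis using nn_integral_powr_near_0[OF assms, of 3] by (simp add: integrable_iff_bounded)
qed

lemma integrable_powr_at_infinity:
  assumes "b > 1"
  shows "integrable lborel (\<lambda>x. \<bar>x\<bar> powr (- b) * indicator {x::real. \<bar>x\<bar> > 1} x)"
proof -
  have "(\<integral>\<^sup>+x. ennreal (norm (\<bar>x\<bar> powr (- b) * indicator {x::real. \<bar>x\<bar> > 1} x)) \<partial>lborel) = (\<integral>\<^sup>+x. ennreal (\<bar>x\<bar> powr (- b)) * indicator {x. \<bar>x\<bar> > 1} x \<partial>lborel)"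
    by (intro nn_integral_cong) (auto split: split_indicator)
  thus ?thesis using nn_integral_powr_at_infinity[OF assms] by (simp add: integrable_iff_bounded)
qed

lemma AE_lborel_neq: "AE x in lborel. x \<noteq> (c::real)"
  by (rule AE_lborel_singleton)

lemma powr_add_le:
  fixes x y r :: real
  assumes "x \<ge> 0" "y \<ge> 0" "r \<ge> 0"
  shows "(x + y) powr r \<le> 2 powr r * (x powr r + y powr r)"
proof -
  have "(x + y) powr r \<le> (2 * max x y) powr r" using assms by (intro powr_mono2) auto
  also have "\<dots> = 2 powr r * (max x y) powr r" using assms by (simp add: powr_mult)
  also have "\<dots> \<le> 2 powr r * (x powr r + y powr r)" by (intro mult_left_mono) (auto simp: max_def)
  finally show ?thesis .
qed

text \<open>With r = 1 / (\<sigma> + \<gamma>) one has \<sigma> r < 1, which gives integrability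
  near 0. For |x| > 1 the function is at most C, and |h|^r <= C^(r - 1) |h| falls back on
  integrability of h.\<close>

lemma singular_Lp_bounded:
  assumes h: "integrable lborel h" and s: "\<sigma> > 0" "\<gamma> > 0" "\<sigma> + \<gamma> \<le> 1" and C: "C > 0"
    and b: "\<And>x. x \<noteq> 0 \<Longrightarrow> \<bar>h x\<bar> \<le> C * \<bar>x\<bar> powr (- \<sigma>)"
  shows "\<exists>M. Lp_bounded (\<sigma> + \<gamma>) h M"
proof -
  define r where "r = 1 / (\<sigma> + \<gamma>)"
  have r: "r \<ge> 1" "\<sigma> * r < 1" using s by (simp_all add: r_def divide_simps)
  have [measurable]: "h \<in> borel_measurable borel" using h by auto
  have i: "integrable lborel (\<lambda>x. \<bar>h x\<bar> powr r)"
  proof (rule Bochner_Integration.integrable_bound)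
    show "integrable lborel (\<lambda>x. C powr r * (\<bar>x\<bar> powr (- (\<sigma> * r)) * indicator {-3..3} x) + C powr (r - 1) * \<bar>h x\<bar>)"
      using h s r by (intro Bochner_Integration.integrable_add integrable_mult_right integrable_powr_near_0) auto
    show "AE x in lborel. norm (\<bar>h x\<bar> powr r) \<le> norm (C powr r * (\<bar>x\<bar> powr (- (\<sigma> * r)) * indicator {-3..3} x) + C powr (r - 1) * \<bar>h x\<bar>)"
      using AE_lborel_neq[of 0]
    proof eventually_elim
      case (elim x)
      have "\<bar>h x\<bar> powr r \<le> C powr r * (\<bar>x\<bar> powr (- (\<sigma> * r)) * indicator {-3..3} x) + C powr (r - 1) * \<bar>h x\<bar>"
      proof (cases "\<bar>x\<bar> \<le> 1")
        case True
        have "\<bar>h x\<bar> powr r \<le> (C * \<bar>x\<bar> powr (- \<sigma>)) powr r" using b[OF elim] r by (intro powr_mono2) auto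
        also have "\<dots> = C powr r * \<bar>x\<bar> powr (- (\<sigma> * r))" using C by (simp add: powr_mult powr_powr)
        also have "\<dots> = C powr r * (\<bar>x\<bar> powr (- (\<sigma> * r)) * indicator {-3..3} x)" using True by (simp add: indicator_def abs_le_iff)
        finally show ?thesis by (rule add_increasing2[rotated]) simp
      next
        case False
        have "\<bar>h x\<bar> \<le> C * \<bar>x\<bar> powr (- \<sigma>)" by (rule b[OF elim])
        also have "\<dots> \<le> C * 1 powr (- \<sigma>)" using False s C by (intro mult_left_mono powr_mono2') auto
        finally have hC: "\<bar>h x\<bar> \<le> C" by simp
        have "\<bar>h x\<bar> powr r = \<bar>h x\<bar> powr (r - 1) * \<bar>h x\<bar>" by (cases "h x = 0") (auto simp: powr_diff)
        also have "\<dots> \<le> C powr (r - 1) * \<bar>h x\<bar>" using hC r by (intro mult_right_mono powr_mono2) auto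
        finally show ?thesis by (simp add: add_increasing)
      qed
      thus ?case by simp
    qed
  qed measurable
  define N where "N = (LINT x|lborel. \<bar>h x\<bar> powr r)"
  have N: "N \<ge> 0" unfolding N_def by (rule Bochner_Integration.integral_nonneg) simp
  have "r * (\<sigma> + \<gamma>) = 1" using s by (simp add: r_def)
  hence "N \<le> ((N + 1) powr (\<sigma> + \<gamma>)) powr r" "(N + 1) powr (\<sigma> + \<gamma>) > 0" using N by (simp_all add: powr_powr mult.commute)
  thus ?thesis using i s by (intro exI[of _ "(N + 1) powr (\<sigma> + \<gamma>)"]) (auto simp: Lp_bounded_def r_def N_def)
qed

text \<open>Rescaling by the increment \<open>t\<close>: after the substitution \<open>x = t y\<close> the increment is dominated,
  uniformly in \<open>t\<close>, by a single function of \<open>y\<close> with integrable \<open>r\<close>-th power.\<close>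

lemma singular_Lp_hoelder:
  assumes h: "integrable lborel h" and s: "\<sigma> > 0" "\<gamma> > 0" "\<sigma> + \<gamma> \<le> 1" and C: "C > 0"
    and d: "\<And>x. x \<noteq> 0 \<Longrightarrow> h differentiable (at x)"
    and b: "\<And>x. x \<noteq> 0 \<Longrightarrow> \<bar>h x\<bar> \<le> C * \<bar>x\<bar> powr (- \<sigma>)"
    and b': "\<And>x. x \<noteq> 0 \<Longrightarrow> \<bar>deriv h x\<bar> \<le> C * \<bar>x\<bar> powr (- \<sigma> - 1)"
  shows "\<exists>K. \<forall>t. t \<noteq> 0 \<longrightarrow> Lp_bounded (\<sigma> + \<gamma>) (\<lambda>x. h (x + t) - h x) (K * \<bar>t\<bar> powr \<gamma>)"
proof -
  define r where "r = 1 / (\<sigma> + \<gamma>)"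
  have r: "r \<ge> 1" "\<sigma> * r < 1" "1 - \<sigma> * r = \<gamma> * r" using s by (simp_all add: r_def divide_simps)
  have [measurable]: "h \<in> borel_measurable borel" using h by auto
  \<comment> \<open>One constant for both regions: 2^r from the near one is at most 2^((\<sigma> +
    1) r), which the far one produces.\<close>
  define A where "A = C powr r * 2 powr ((\<sigma> + 1) * r)"
  define w where "w y = \<bar>y\<bar> powr (- (\<sigma> * r)) * indicator {-3..3::real} y" for y
  \<comment> \<open>For |y| <= 2 the two values of h are estimated separately, with singularities at
    y = -1 and y = 0. For |y| > 2 the mean value theorem gives decay of order (\<sigma> + 1) r >
    1.\<close>
  define H where "H y = A * (w (1 + y) + w y + \<bar>y\<bar> powr (- ((\<sigma> + 1) * r)) * indicator {x::real. \<bar>x\<bar> > 1} y)" for y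
  have A: "A > 0" using C by (simp add: A_def)
  have w0: "w y \<ge> 0" for y by (simp add: w_def)
  have iw: "integrable lborel w" unfolding w_def by (rule integrable_powr_near_0) (use s r in auto)
  have sr: "(\<sigma> + 1) * r > 1" using r s by (simp add: distrib_right add_pos_nonneg add_increasing)
    (smt (verit) mult_pos_pos)
  have iH: "integrable lborel H"
    unfolding H_def
    using lborel_integrable_real_affine[OF iw, of 1 1] iw integrable_powr_at_infinity[OF sr]
    by (intro integrable_mult_right Bochner_Integration.integrable_add) auto
  define N where "N = (LINT y|lborel. H y)"
  have N: "N \<ge> 0" unfolding N_def by (rule Bochner_Integration.integral_nonneg) (use A w0 in \<open>auto simp: H_def\<close>)
  have pt: "\<bar>h (t * y + t) - h (t * y)\<bar> powr r \<le> t powr (- (\<sigma> * r)) * H y" if t: "t > 0" and y: "y \<noteq> 0" "y \<noteq> -1" for t y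
  proof (cases "\<bar>y\<bar> \<le> 2")
    case True
    have e: "t * y + t = t * (1 + y)" by (simp add: algebra_simps)
    have "\<bar>h (t * y + t) - h (t * y)\<bar> \<le> \<bar>h (t * (1 + y))\<bar> + \<bar>h (t * y)\<bar>" unfolding e by linarith
    also have "\<dots> \<le> C * \<bar>t * (1 + y)\<bar> powr (- \<sigma>) + C * \<bar>t * y\<bar> powr (- \<sigma>)"
      using t y by (intro add_mono b) auto
    also have "\<dots> = C * t powr (- \<sigma>) * (\<bar>1 + y\<bar> powr (- \<sigma>) + \<bar>y\<bar> powr (- \<sigma>))"
    proof -
      have alg: "c * (p * q) + c * (p * q') = c * p * (q + q')" for c p q q' :: real by (simp add: algebra_simps)
      have "\<bar>t * v\<bar> powr (- \<sigma>) = t powr (- \<sigma>) * \<bar>v\<bar> powr (- \<sigma>)" for v using t by (simp only: abs_mult powr_mult abs_of_pos)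
      thus ?thesis by (simp only: alg)
    qed
    finally have "\<bar>h (t * y + t) - h (t * y)\<bar> powr r \<le> (C * t powr (- \<sigma>) * (\<bar>1 + y\<bar> powr (- \<sigma>) + \<bar>y\<bar> powr (- \<sigma>))) powr r"
      using r by (intro powr_mono2) auto
    also have "\<dots> = C powr r * t powr (- (\<sigma> * r)) * (\<bar>1 + y\<bar> powr (- \<sigma>) + \<bar>y\<bar> powr (- \<sigma>)) powr r"
      using C by (simp add: powr_mult powr_powr)
    also have "\<dots> \<le> C powr r * t powr (- (\<sigma> * r)) * (2 powr r * ((\<bar>1 + y\<bar> powr (- \<sigma>)) powr r + (\<bar>y\<bar> powr (- \<sigma>)) powr r))"
      using r by (intro mult_left_mono powr_add_le) auto
    also have "(\<bar>1 + y\<bar> powr (- \<sigma>)) powr r + (\<bar>y\<bar> powr (- \<sigma>)) powr r = w (1 + y) + w y"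
      using True by (auto simp: w_def powr_powr split: split_indicator)
    also have "C powr r * t powr (- (\<sigma> * r)) * (2 powr r * (w (1 + y) + w y)) = t powr (- (\<sigma> * r)) * (C powr r * 2 powr r * (w (1 + y) + w y))"
      by (simp only: mult_ac)
    also have "\<dots> \<le> t powr (- (\<sigma> * r)) * (A * (w (1 + y) + w y))"
      using s r w0 unfolding A_def by (intro mult_left_mono mult_right_mono powr_mono) (auto simp: distrib_right)
    also have "\<dots> \<le> t powr (- (\<sigma> * r)) * H y"
      using A unfolding H_def by (intro mult_left_mono) auto
    finally show ?thesis .
  next
    case False
    let ?x = "t * y"
    \<comment> \<open>Now |x| > 2 t for x = t y, so the segment from x to x + t keeps half the
      distance of x from the singularity; this also gives differentiability along it.\<close>
    have far: "\<bar>z\<bar> \<ge> \<bar>?x\<bar> / 2" if z: "?x \<le> z" "z \<le> ?x + t" for z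
    proof -
      have "\<bar>?x\<bar> > 2 * t" using False t by (simp add: abs_mult)
      thus ?thesis using z by linarith
    qed
    have x0: "\<bar>?x\<bar> > 0" using t y by simp
    have nz: "z \<noteq> 0" if "?x \<le> z" "z \<le> ?x + t" for z using far[OF that] x0 by auto
    obtain z where z: "?x < z" "z < ?x + t" "h (?x + t) - h ?x = (?x + t - ?x) * deriv h z"
      using MVT2[of ?x "?x + t" h "deriv h"] t d nz by (auto simp: DERIV_deriv_iff_real_differentiable)
    have zz: "?x \<le> z" "z \<le> ?x + t" using z by auto
    have "\<bar>h (?x + t) - h ?x\<bar> = t * \<bar>deriv h z\<bar>" using z(3) t by (simp add: abs_mult)
    also have "\<dots> \<le> t * (C * \<bar>z\<bar> powr (- \<sigma> - 1))" using t b'[OF nz[OF zz]] by (intro mult_left_mono) auto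
    also have "\<dots> \<le> t * (C * (\<bar>?x\<bar> / 2) powr (- \<sigma> - 1))"
      using t C far[OF zz] x0 s by (intro mult_left_mono powr_mono2') auto
    also have "\<dots> = C * 2 powr (\<sigma> + 1) * (t powr (- \<sigma>) * \<bar>y\<bar> powr (- (\<sigma> + 1)))"
    proof -
      have "(\<bar>?x\<bar> / 2) powr (- \<sigma> - 1) = (t * (\<bar>y\<bar> * (1 / 2))) powr (- (\<sigma> + 1))" using t by (simp add: abs_mult)
      also have "\<dots> = t powr (- (\<sigma> + 1)) * (\<bar>y\<bar> powr (- (\<sigma> + 1)) * (1 / 2) powr (- (\<sigma> + 1)))" using t by (simp only: powr_mult)
      also have "(1 / 2) powr (- (\<sigma> + 1)) = (2::real) powr (\<sigma> + 1)" by (simp only: powr_minus powr_divide powr_one_eq_one) simp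
      finally have 1: "(\<bar>?x\<bar> / 2) powr (- \<sigma> - 1) = t powr (- (\<sigma> + 1)) * (\<bar>y\<bar> powr (- (\<sigma> + 1)) * 2 powr (\<sigma> + 1))" .
      have "t * t powr (- (\<sigma> + 1)) = t powr 1 * t powr (- (\<sigma> + 1))" using t by simp
      also have "\<dots> = t powr (- \<sigma>)" by (simp only: powr_add[symmetric]) simp
      finally have 2: "t * t powr (- (\<sigma> + 1)) = t powr (- \<sigma>)" .
      have "t * (C * (\<bar>?x\<bar> / 2) powr (- \<sigma> - 1)) = C * 2 powr (\<sigma> + 1) * (t * t powr (- (\<sigma> + 1)) * \<bar>y\<bar> powr (- (\<sigma> + 1)))"
        unfolding 1 by (simp only: mult_ac)
      thus ?thesis unfolding 2 .
    qed
    finally have "\<bar>h (?x + t) - h ?x\<bar> powr r \<le> (C * 2 powr (\<sigma> + 1) * (t powr (- \<sigma>) * \<bar>y\<bar> powr (- (\<sigma> + 1)))) powr r"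
      using r by (intro powr_mono2) auto
    also have "\<dots> = A * (t powr (- \<sigma> * r) * \<bar>y\<bar> powr (- (\<sigma> + 1) * r))"
      unfolding A_def by (simp only: powr_mult powr_powr)
    also have "\<dots> = t powr (- (\<sigma> * r)) * (A * (\<bar>y\<bar> powr (- ((\<sigma> + 1) * r)) * indicator {x::real. \<bar>x\<bar> > 1} y))"
    proof -
      have "- \<sigma> * r = - (\<sigma> * r)" "- (\<sigma> + 1) * r = - ((\<sigma> + 1) * r)" by (simp_all only: mult_minus_left)
      moreover have "indicat_real {x::real. \<bar>x\<bar> > 1} y = 1" using False by simp
      ultimately show ?thesis by (simp only: mult_1_right mult_ac)
    qed
    also have "\<dots> \<le> t powr (- (\<sigma> * r)) * H y"
      using A w0[of y] w0[of "1 + y"] unfolding H_def by (intro mult_left_mono) auto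
    finally show ?thesis .
  qed
  define K where "K = (N + 1) powr (\<sigma> + \<gamma>)"
  have K: "K > 0" using N by (simp add: K_def)
  have rr: "(\<sigma> + \<gamma>) * r = 1" using s by (simp add: r_def)
  have "Lp_bounded (\<sigma> + \<gamma>) (\<lambda>x. h (x + t) - h x) (K * t powr \<gamma>)" if t: "t > 0" for t
  proof -
    let ?D = "\<lambda>x. \<bar>h (x + t) - h x\<bar> powr r"
    have ae: "AE y in lborel. ?D (0 + t * y) \<le> t powr (- (\<sigma> * r)) * H y"
      using AE_lborel_neq[of 0] AE_lborel_neq[of "-1"] by eventually_elim (use pt[OF t] in simp)
    have iB: "integrable lborel (\<lambda>y. t powr (- (\<sigma> * r)) * H y)" by (intro integrable_mult_right iH)
    have iD': "integrable lborel (\<lambda>y. ?D (0 + t * y))"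
    proof (rule Bochner_Integration.integrable_bound[OF iB])
      show "AE y in lborel. norm (?D (0 + t * y)) \<le> norm (t powr (- (\<sigma> * r)) * H y)"
        using ae by eventually_elim simp
    qed measurable
    hence iD: "integrable lborel ?D" using lborel_integrable_real_affine_iff[of t ?D 0] t by simp
    have "(LINT x|lborel. ?D x) = t * (LINT y|lborel. ?D (0 + t * y))"
      using lborel_integral_real_affine[of t ?D 0] t by simp
    also have "\<dots> \<le> t * (LINT y|lborel. t powr (- (\<sigma> * r)) * H y)"
      using t by (intro mult_left_mono integral_mono_AE iD' iB ae) auto
    also have "\<dots> = t powr 1 * t powr (- (\<sigma> * r)) * N" using t by (simp add: N_def)
    \<comment> \<open>The factor t of dx = t dy and the scaling t^(- \<sigma> r) of the singularity
      combine to t^(\<gamma> r), since 1 - \<sigma> r = \<gamma> r by the choice of r.\<close>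
    also have "t powr 1 * t powr (- (\<sigma> * r)) = t powr (\<gamma> * r)" by (simp only: powr_add[symmetric] r(3)[symmetric]) simp
    also have "t powr (\<gamma> * r) * N \<le> t powr (\<gamma> * r) * (N + 1)" by (intro mult_left_mono) auto
    also have "\<dots> = (K * t powr \<gamma>) powr r" using N by (simp add: K_def powr_mult powr_powr rr)
    finally show ?thesis using iD K t s by (simp add: Lp_bounded_def r_def)
  qed
  from Lp_bounded_diff_symmetric[OF this] show ?thesis by (intro exI[of _ K]) auto
qed

lemma Delta_bigo_of_singular:
  fixes C \<sigma> \<delta> :: "nat \<Rightarrow> real"
  assumes n: "n \<ge> 1" and h: "\<forall>i\<in>{1..Suc n}. integrable lborel (h i)"
    and d: "\<forall>i\<in>{1..Suc n}. \<forall>x. x \<noteq> 0 \<longrightarrow> h i differentiable (at x)"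
    and c: "\<forall>i\<in>{1..Suc n}. C i > 0 \<and> \<sigma> i > 0 \<and> \<delta> i > 1" and s: "(\<Sum>i\<in>{1..Suc n}. \<sigma> i) < 1"
    and b: "\<forall>i\<in>{1..Suc n}. \<forall>x. x \<noteq> 0 \<longrightarrow>
               \<bar>h i x\<bar> \<le> (if \<bar>x\<bar> \<le> 1 then C i * \<bar>x\<bar> powr (- \<sigma> i) else C i * \<bar>x\<bar> powr (- \<delta> i))
             \<and> \<bar>deriv (h i) x\<bar> \<le> (if \<bar>x\<bar> \<le> 1 then C i * \<bar>x\<bar> powr (- \<sigma> i - 1)
                                   else C i * \<bar>x\<bar> powr (- \<delta> i - 1))"
    and \<epsilon>: "\<epsilon> > 0"
  shows "(\<lambda>T. Delta (Suc n) h T) \<in> O[at_top](\<lambda>T. T powr (\<epsilon> - (1 - (\<Sum>i\<in>{1..Suc n}. \<sigma> i)) / real (Suc n)))"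
proof -
  let ?I = "{1..Suc n}"
  \<comment> \<open>Chosen so that the reciprocal exponents \<sigma> i + \<gamma> add up to exactly
    1.\<close>
  define \<gamma> where "\<gamma> = (1 - (\<Sum>i\<in>?I. \<sigma> i)) / real (Suc n)"
  have \<gamma>: "\<gamma> > 0" using s by (simp add: \<gamma>_def del: sum.cl_ivl_Suc)
  have "(\<Sum>i\<in>?I. \<sigma> i + \<gamma>) = (\<Sum>i\<in>?I. \<sigma> i) + real (Suc n) * \<gamma>"
    by (simp add: sum.distrib del: sum.cl_ivl_Suc)
  also have "real (Suc n) * \<gamma> = 1 - (\<Sum>i\<in>?I. \<sigma> i)" unfolding \<gamma>_def by (simp del: sum.cl_ivl_Suc of_nat_Suc)
  finally have sum: "(\<Sum>i\<in>?I. \<sigma> i + \<gamma>) = 1" by (simp del: sum.cl_ivl_Suc)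
  have le1: "\<sigma> i + \<gamma> \<le> 1" if i: "i \<in> ?I" for i
    unfolding sum[symmetric]
  proof (rule member_le_sum[of i ?I "\<lambda>i. \<sigma> i + \<gamma>"])
    fix j assume "j \<in> ?I - {i}"
    hence "\<sigma> j > 0" using c by blast
    thus "0 \<le> \<sigma> j + \<gamma>" using \<gamma> by linarith
  qed (use i in auto)
  have \<gamma>1: "\<gamma> \<le> 1"
  proof -
    have "1 \<in> ?I" by simp
    hence "\<sigma> 1 + \<gamma> \<le> 1" "\<sigma> 1 > 0" using le1 c by blast+
    thus ?thesis by linarith
  qed
  \<comment> \<open>As \<sigma> i < 1 < \<delta> i, the bounds for |x| > 1 imply the ones with
    \<sigma> i, which then hold on the whole punctured line.\<close>
  have si: "\<sigma> i \<le> \<delta> i" if "i \<in> ?I" for i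
  proof -
    have "\<sigma> i + \<gamma> \<le> 1" "\<delta> i > 1" using le1 c that by auto
    thus ?thesis using \<gamma> by linarith
  qed
  have bd: "\<bar>h i x\<bar> \<le> C i * \<bar>x\<bar> powr (- \<sigma> i)" "\<bar>deriv (h i) x\<bar> \<le> C i * \<bar>x\<bar> powr (- \<sigma> i - 1)" if i: "i \<in> ?I" and x: "x \<noteq> 0" for i x
  proof -
    have "C i > 0" using c i by auto
    hence "C i * \<bar>x\<bar> powr (- \<delta> i) \<le> C i * \<bar>x\<bar> powr (- \<sigma> i)" "C i * \<bar>x\<bar> powr (- \<delta> i - 1) \<le> C i * \<bar>x\<bar> powr (- \<sigma> i - 1)" if "\<bar>x\<bar> > 1"
      using si[OF i] that by (auto intro!: mult_left_mono powr_mono)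
    moreover have "\<bar>h i x\<bar> \<le> (if \<bar>x\<bar> \<le> 1 then C i * \<bar>x\<bar> powr (- \<sigma> i) else C i * \<bar>x\<bar> powr (- \<delta> i))"
      "\<bar>deriv (h i) x\<bar> \<le> (if \<bar>x\<bar> \<le> 1 then C i * \<bar>x\<bar> powr (- \<sigma> i - 1) else C i * \<bar>x\<bar> powr (- \<delta> i - 1))"
      using b i x by blast+
    ultimately show "\<bar>h i x\<bar> \<le> C i * \<bar>x\<bar> powr (- \<sigma> i)" "\<bar>deriv (h i) x\<bar> \<le> C i * \<bar>x\<bar> powr (- \<sigma> i - 1)"
      by (cases "\<bar>x\<bar> \<le> 1"; force)+
  qed
  have "\<forall>i\<in>?I. \<exists>M. Lp_bounded (\<sigma> i + \<gamma>) (h i) M"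
  proof
    fix i assume i: "i \<in> ?I"
    show "\<exists>M. Lp_bounded (\<sigma> i + \<gamma>) (h i) M"
      by (rule singular_Lp_bounded[of _ _ _ "C i"]) (use i h c \<gamma> le1 bd in auto)
  qed
  then obtain M where M: "\<forall>i\<in>?I. Lp_bounded (\<sigma> i + \<gamma>) (h i) (M i)" by (rule bchoice[THEN exE])
  have "\<forall>i\<in>?I. \<exists>K. \<forall>t. t \<noteq> 0 \<longrightarrow> Lp_bounded (\<sigma> i + \<gamma>) (\<lambda>x. h i (x + t) - h i x) (K * \<bar>t\<bar> powr \<gamma>)"
  proof
    fix i assume i: "i \<in> ?I"
    show "\<exists>K. \<forall>t. t \<noteq> 0 \<longrightarrow> Lp_bounded (\<sigma> i + \<gamma>) (\<lambda>x. h i (x + t) - h i x) (K * \<bar>t\<bar> powr \<gamma>)"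
      by (rule singular_Lp_hoelder[of _ _ _ "C i"]) (use i h c d \<gamma> le1 bd in auto)
  qed
  then obtain K where K: "\<forall>i\<in>?I. \<forall>t. t \<noteq> 0 \<longrightarrow> Lp_bounded (\<sigma> i + \<gamma>) (\<lambda>x. h i (x + t) - h i x) (K i * \<bar>t\<bar> powr \<gamma>)"
    by (rule bchoice[THEN exE])
  show ?thesis
    unfolding \<gamma>_def[symmetric]
  proof (rule Delta_bigo_of_Lp_hoelder[OF n h, of "\<lambda>i. \<sigma> i + \<gamma>" M K \<gamma>, OF _ _ _ _ \<gamma> \<gamma>1 \<epsilon>])
    show "0 \<le> \<sigma> i + \<gamma> \<and> \<sigma> i + \<gamma> \<le> 1" if "i \<in> ?I" for i 
    proof -
      have "\<sigma> i > 0" using c that by blast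
      thus ?thesis using \<gamma> le1[OF that] by linarith
    qed
    show "(\<Sum>i\<in>?I. \<sigma> i + \<gamma>) \<le> 1" using sum by linarith
  qed (use M K in blast)+
qed

section \<open>Fourier inversion and the trace in the time domain\<close>

text \<open>\<open>ennreal\<close> cuts off negative values, so the densities of r and - r are its
  positive and negative parts. They define finite measures that agree on all half-lines, hence are
  equal, and the densities agree almost everywhere.\<close>

lemma AE_zero_of_tail_integrals:
  fixes r :: "real \<Rightarrow> real"
  assumes r: "integrable lborel r" and z: "\<And>a. (LINT x|lborel. indicator {a<..} x * r x) = 0"
  shows "AE x in lborel. r x = 0"
proof -
  have [measurable]: "r \<in> borel_measurable borel" using r by auto
  have fin: "(\<integral>\<^sup>+x. ennreal (r x) \<partial>lborel) < \<infinity>" "(\<integral>\<^sup>+x. ennreal (- r x) \<partial>lborel) < \<infinity>"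
    using r unfolding real_integrable_def by (auto simp: less_top)
  have em: "emeasure (density lborel (\<lambda>x. ennreal (s * r x))) {a<..} = (\<integral>\<^sup>+x. ennreal (indicator {a<..} x * (s * r x)) \<partial>lborel)" for s a
    by (subst emeasure_density) (auto intro!: nn_integral_cong split: split_indicator)
  have "density lborel (\<lambda>x. ennreal (1 * r x)) = density lborel (\<lambda>x. ennreal (-1 * r x))"
  proof (rule measure_eqI_lessThan)
    fix a
    let ?q = "\<lambda>x. indicator {a<..} x * r x"
    have q: "integrable lborel ?q"
      by (rule Bochner_Integration.integrable_bound[OF r]) (auto split: split_indicator)
    define P where "P = (\<integral>\<^sup>+x. ennreal (?q x) \<partial>lborel)"
    define N where "N = (\<integral>\<^sup>+x. ennreal (- ?q x) \<partial>lborel)"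
    have f: "P < \<top>" "N < \<top>"
      using q unfolding real_integrable_def P_def N_def by (auto simp: less_top)
    have "enn2real P = enn2real N"
      using z[of a] unfolding real_lebesgue_integral_def[OF q] P_def N_def by simp
    hence "ennreal (enn2real P) = ennreal (enn2real N)" by (rule arg_cong)
    hence PN: "P = N" unfolding ennreal_enn2real[OF f(1)] ennreal_enn2real[OF f(2)] .
    show "emeasure (density lborel (\<lambda>x. ennreal (1 * r x))) {a<..} = emeasure (density lborel (\<lambda>x. ennreal (-1 * r x))) {a<..}"
      unfolding em using PN by (simp add: P_def N_def)
    show "emeasure (density lborel (\<lambda>x. ennreal (1 * r x))) {a<..} < \<infinity>"
      unfolding em using f(1) by (simp add: P_def)
  qed auto
  hence "AE x in lborel. ennreal (1 * r x) = ennreal (-1 * r x)"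
    using fin by (subst (asm) finite_density_unique) (auto simp: less_top)
  thus ?thesis
  proof eventually_elim
    case (elim x)
    show "r x = 0"
    proof (rule linorder_cases[of "r x" 0])
      assume "r x < 0"
      thus ?thesis using elim by (auto simp: ennreal_neg dest: sym)
    next
      assume "r x > 0"
      thus ?thesis using elim by (auto simp: ennreal_neg)
    qed
  qed
qed

text \<open>Only local integrability is available, so the previous lemma is applied to the
  restrictions to [-N, N], whose tail integrals are again interval integrals.\<close>

lemma AE_zero_of_interval_integrals:
  fixes d :: "real \<Rightarrow> real"
  assumes i: "\<And>a b. integrable lborel (\<lambda>x. indicator {a..b} x * d x)" and z: "\<And>a b. (LINT x|lborel. indicator {a..b} x * d x) = 0"
  shows "AE x in lborel. d x = 0"
proof -
  have "AE x in lborel. indicator {- real N..real N} x * d x = 0" for N :: nat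
  proof (rule AE_zero_of_tail_integrals[OF i])
    fix a
    have "(LINT x|lborel. indicator {a<..} x * (indicator {- real N..real N} x * d x)) = (LINT x|lborel. indicator {max a (- real N)..real N} x * d x)"
    proof (rule integral_cong_AE)
      show "(\<lambda>x. indicator {a<..} x * (indicator {- real N..real N} x * d x)) \<in> borel_measurable lborel"
        using i[of "- real N" "real N"] by measurable
      show "(\<lambda>x. indicator {max a (- real N)..real N} x * d x) \<in> borel_measurable lborel"
        using i[of "max a (- real N)" "real N"] by auto
      show "AE x in lborel. indicator {a<..} x * (indicator {- real N..real N} x * d x) = indicator {max a (- real N)..real N} x * d x"
        using AE_lborel_neq[of a] by eventually_elim (auto split: split_indicator)
    qed
    thus "(LINT x|lborel. indicator {a<..} x * (indicator {- real N..real N} x * d x)) = 0" by (simp add: z)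
  qed
  hence "AE x in lborel. \<forall>N::nat. indicator {- real N..real N} x * d x = 0" unfolding AE_all_countable by blast
  thus ?thesis
  proof eventually_elim
    case (elim x)
    have "\<bar>x\<bar> \<le> real (nat \<lceil>\<bar>x\<bar>\<rceil>)" by (rule real_nat_ceiling_ge)
    hence "x \<in> {- real (nat \<lceil>\<bar>x\<bar>\<rceil>)..real (nat \<lceil>\<bar>x\<bar>\<rceil>)}" unfolding atLeastAtMost_iff by linarith
    thus ?case using elim[rule_format, of "nat \<lceil>\<bar>x\<bar>\<rceil>"] by simp
  qed
qed

text \<open>Both sides are integrated over an arbitrary interval. The multiplication formula moves
  the transform from \<open>ft h\<close> to the indicator, and Parseval evaluates the result;
  integrability of \<open>ft h\<close> replaces any smoothness of h.\<close>

lemma fourier_inversion_AE: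
  assumes h: "integrable lborel h" and F: "integrable lborel (ft h)"
  shows "AE x in lborel. cft (ft h) (- x) = of_real (2 * pi * h x)"
proof -
  have [measurable]: "h \<in> borel_measurable borel" "ft h \<in> borel_measurable borel" using h F by auto
  let ?D = "\<lambda>x. cft (ft h) (- x) - of_real (2 * pi * h x)"
  have hc: "integrable lborel (\<lambda>x. complex_of_real (h x))" using h by simp
  have I: "integrable lborel (\<lambda>x. indicator {a..b} x * ?D x)" and Z: "(LINT x|lborel. indicator {a..b} x * ?D x) = 0" for a b
  proof -
    let ?f = "\<lambda>x. indicator {a..b} x :: complex"
    have f: "integrable lborel ?f"
    proof -
      have "integrable lborel (\<lambda>x. complex_of_real (indicator {a..b} x))" using integrable_indicator_Icc by simp
      thus ?thesis by (simp add: of_real_indicator)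
    qed
    have i: "integrable lborel (\<lambda>t. cft (\<lambda>x. complex_of_real (h x)) t * cft ?f (- t))"
    proof (rule Bochner_Integration.integrable_bound)
      show "integrable lborel (\<lambda>t. (LINT x|lborel. norm (?f x)) * norm (ft h t))" using F by (intro integrable_mult_right integrable_norm)
      have "norm (cft (\<lambda>x. complex_of_real (h x)) t * cft ?f (- t)) \<le> (LINT x|lborel. norm (?f x)) * norm (ft h t)" for t
        using mult_right_mono[OF norm_cft_le[of ?f "-t"] norm_ge_zero[of "ft h t"]]
        by (simp only: norm_mult ft_eq_cft mult.commute)
      hence "norm (cft (\<lambda>x. complex_of_real (h x)) t * cft ?f (- t)) \<le> norm ((LINT x|lborel. norm (?f x)) * norm (ft h t))" for t
        unfolding real_norm_def using order_trans abs_ge_self by blast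
      thus "AE t in lborel. norm (cft (\<lambda>x. complex_of_real (h x)) t * cft ?f (- t)) \<le> norm ((LINT x|lborel. norm (?f x)) * norm (ft h t))"
        by simp
    qed measurable
    have "(LINT t|lborel. cft (\<lambda>x. complex_of_real (h x)) t * cft ?f (- t)) = 2 * pi * (LINT x|lborel. complex_of_real (h x) * ?f x)"
    proof (rule cft_parseval[OF hc f _ _ i, of 1])
      show "norm (?f x) \<le> 1" for x by (simp add: indicator_def)
      show "AE x in lborel. isCont ?f x"
        using AE_lborel_neq[of a] AE_lborel_neq[of b]
      proof eventually_elim
        case (elim x)
        have "isCont (\<lambda>t. indicator {a..b} t *\<^sub>R (1::complex)) x" by (rule isCont_indicator_Icc) (use elim in auto)
        thus ?case by (simp add: scaleR_conv_of_real of_real_indicator)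
      qed
    qed
    moreover have "(LINT t|lborel. cft (\<lambda>x. complex_of_real (h x)) t * cft ?f (- t)) = (LINT y|lborel. ?f y * cft (ft h) (- y))"
      using cft_multiplication[OF f F, of "-1"] by (simp add: ft_eq_cft mult.commute)
    ultimately have e: "(LINT y|lborel. ?f y * cft (ft h) (- y)) = 2 * pi * (LINT x|lborel. complex_of_real (h x) * ?f x)" by simp
    have i1: "integrable lborel (\<lambda>y. ?f y * cft (ft h) (- y))"
    proof (rule Bochner_Integration.integrable_bound)
      show "integrable lborel (\<lambda>x. indicator {a..b} x * (LINT l|lborel. norm (ft h l)))"
        by (intro integrable_mult_left integrable_indicator_Icc)
      have "norm (?f y * cft (ft h) (- y)) \<le> norm (indicator {a..b} y * (LINT l|lborel. norm (ft h l)))" for y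
        using norm_cft_le[of "ft h" "-y"] by (auto split: split_indicator)
      thus "AE y in lborel. norm (?f y * cft (ft h) (- y)) \<le> norm (indicator {a..b} y * (LINT l|lborel. norm (ft h l)))" by simp
    qed measurable
    have i2: "integrable lborel (\<lambda>x. ?f x * of_real (2 * pi * h x))"
    proof (rule Bochner_Integration.integrable_bound)
      show "integrable lborel (\<lambda>x. 2 * pi * h x)" using h by simp
    qed (auto split: split_indicator simp: norm_mult)
    show "integrable lborel (\<lambda>x. ?f x * ?D x)"
      using Bochner_Integration.integrable_diff[OF i1 i2] by (simp only: right_diff_distrib)
    have "(LINT x|lborel. ?f x * ?D x) = (LINT y|lborel. ?f y * cft (ft h) (- y)) - (LINT x|lborel. ?f x * of_real (2 * pi * h x))"
      unfolding right_diff_distrib by (rule Bochner_Integration.integral_diff[OF i1 i2])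
    also have "(LINT x|lborel. ?f x * of_real (2 * pi * h x)) = (LINT x|lborel. (2 * pi) * (complex_of_real (h x) * ?f x))"
      by (intro Bochner_Integration.integral_cong) auto
    finally show "(LINT x|lborel. ?f x * ?D x) = 0" unfolding e by simp
  qed
  have ri: "Re (indicator {a..b} x * ?D x) = indicator {a..b} x * Re (?D x)" "Im (indicator {a..b} x * ?D x) = indicator {a..b} x * Im (?D x)" for a b x :: real
    by (auto split: split_indicator)
  have "AE x in lborel. Re (?D x) = 0"
  proof (rule AE_zero_of_interval_integrals)
    fix a b
    show "integrable lborel (\<lambda>x. indicator {a..b} x * Re (?D x))" unfolding ri[symmetric] by (rule integrable_Re[OF I])
    show "(LINT x|lborel. indicator {a..b} x * Re (?D x)) = 0" unfolding ri[symmetric] integral_Re[OF I] Z by simp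
  qed
  moreover have "AE x in lborel. Im (?D x) = 0"
  proof (rule AE_zero_of_interval_integrals)
    fix a b
    show "integrable lborel (\<lambda>x. indicator {a..b} x * Im (?D x))" unfolding ri[symmetric] by (rule integrable_Im[OF I])
    show "(LINT x|lborel. indicator {a..b} x * Im (?D x)) = 0" unfolding ri[symmetric] integral_Im[OF I] Z by simp
  qed
  ultimately show ?thesis by eventually_elim (simp add: complex_eq_iff)
qed

section \<open>The trace as an integral over times\<close>

definition cyc_next :: "nat \<Rightarrow> nat \<Rightarrow> nat" where
  "cyc_next m i = (if i = m then 1 else Suc i)"

definition cyc_prev :: "nat \<Rightarrow> nat \<Rightarrow> nat" where
  "cyc_prev m i = (if i = 1 then m else i - 1)"

lemma cyc_dirichlet_prod:
  assumes "m \<ge> 1"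
  shows "cyc_dirichlet T m w = (\<Prod>i\<in>{1..m}. dirichlet T (w (cyc_next m i) - w i))"
proof -
  have ins: "{1..m} = insert m {1..<m}" using assms by auto
  have "(\<Prod>i\<in>{1..<m}. dirichlet T (w (cyc_next m i) - w i)) = (\<Prod>i\<in>{1..<m}. dirichlet T (w (Suc i) - w i))"
    by (intro prod.cong) (auto simp: cyc_next_def)
  thus ?thesis unfolding ins by (subst prod.insert) (auto simp: cyc_dirichlet_def cyc_next_def mult.commute)
qed

lemma cis_sum: "cis (\<Sum>i\<in>A. f i) = (\<Prod>i\<in>A. cis (f i))"
  by (induction A rule: infinite_finite_induct) (auto simp: cis_mult[symmetric])

text \<open>Summation by parts around a cycle, where no boundary terms arise.\<close>

lemma prod_cis_cyc:
  assumes m: "m \<ge> 1"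
  shows "(\<Prod>i\<in>{1..m}. cis ((w (cyc_next m i) - w i) * t i)) = (\<Prod>i\<in>{1..m}. cis (w i * (t (cyc_prev m i) - t i)))"
proof -
  have "(\<Sum>i\<in>{1..m}. w (cyc_next m i) * t i) = (\<Sum>i\<in>{1..m}. w i * t (cyc_prev m i))"
    by (rule sum.reindex_bij_witness[where i = "cyc_prev m" and j = "cyc_next m"])
       (use m in \<open>auto simp: cyc_prev_def cyc_next_def\<close>)
  hence "(\<Sum>i\<in>{1..m}. (w (cyc_next m i) - w i) * t i) = (\<Sum>i\<in>{1..m}. w i * (t (cyc_prev m i) - t i))"
    by (simp add: left_diff_distrib right_diff_distrib sum_subtractf)
  thus ?thesis unfolding cis_sum[symmetric] by simp
qed

text \<open>Derived from the frequency formula: every kernel is expanded into an integral over a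
  time in [0, T]. After summation by parts each frequency occurs in a single factor, and integrating
  it out produces the transform of one symbol.\<close>

lemma trace_time_domain:
  assumes T: "T > 0" and m: "m \<ge> 1" and h: "\<forall>i\<in>{1..m}. integrable lborel (h i)"
  shows "op_trace T (toeplitz_prod T m h) =
    (LINT t|PL {1..m}. (\<Prod>i\<in>{1..m}. indicator {0..T} (t i)) * (\<Prod>i\<in>{1..m}. ft (h i) (t (cyc_prev m i) - t i)))"
proof -
  let ?I = "{1..m}"
  interpret N: sigma_finite_measure "PL ?I" by (rule sigma_finite_PL) simp
  interpret P: pair_sigma_finite "PL ?I" "PL ?I" ..
  define g where "g t = (\<Prod>i\<in>?I. indicator {0..T} (t i) :: complex)" for t :: "nat \<Rightarrow> real"
  have ind: "integrable lborel (\<lambda>x. indicator {0..T} x :: complex)"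
  proof -
    have "integrable lborel (\<lambda>x. complex_of_real (indicator {0..T} x))" using integrable_indicator_Icc by simp
    thus ?thesis by (simp add: of_real_indicator)
  qed
  have ig: "integrable (PL ?I) g" unfolding g_def by (intro PL.product_integrable_prod ind) simp
  have iH: "integrable (PL ?I) (\<lambda>w. \<Prod>i\<in>?I. complex_of_real (h i (w i)))"
    using h by (intro PL.product_integrable_prod) auto
  have D: "cyc_dirichlet T m w = (LINT t|PL ?I. g t * (\<Prod>i\<in>?I. cis (w i * (t (cyc_prev m i) - t i))))" for w
  proof -
    have "cyc_dirichlet T m w = (\<Prod>i\<in>?I. LINT x|lborel. indicator {0..T} x *\<^sub>R cis ((w (cyc_next m i) - w i) * x))"
      unfolding cyc_dirichlet_prod[OF m] dirichlet_def ..
    also have "\<dots> = (LINT t|PL ?I. (\<Prod>i\<in>?I. indicator {0..T} (t i) *\<^sub>R cis ((w (cyc_next m i) - w i) * t i)))"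
      by (rule PL.product_integral_prod[symmetric]) (auto intro: integrable_indicator_cis)
    also have "\<dots> = (LINT t|PL ?I. g t * (\<Prod>i\<in>?I. cis ((w (cyc_next m i) - w i) * t i)))"
      by (simp add: g_def prod.distrib scaleR_conv_of_real of_real_indicator)
    finally show ?thesis unfolding prod_cis_cyc[OF m] .
  qed
  have "op_trace T (toeplitz_prod T m h) = (LINT w|PL ?I. LINT t|PL ?I. (\<Prod>i\<in>?I. of_real (h i (w i))) * (g t * (\<Prod>i\<in>?I. cis (w i * (t (cyc_prev m i) - t i)))))"
    unfolding trace_formula[OF T m h] D by simp
  also have "\<dots> = (LINT t|PL ?I. LINT w|PL ?I. (\<Prod>i\<in>?I. of_real (h i (w i))) * (g t * (\<Prod>i\<in>?I. cis (w i * (t (cyc_prev m i) - t i)))))"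
  proof (rule P.Fubini_pair[OF iH ig])
    have 1: "(\<lambda>z. (\<Prod>i\<in>?I. complex_of_real (h i (fst z i)))) \<in> borel_measurable (PL ?I \<Otimes>\<^sub>M PL ?I)"
      using measurable_compose[OF measurable_fst borel_measurable_integrable[OF iH]] by simp
    have 2: "(\<lambda>z. g (snd z)) \<in> borel_measurable (PL ?I \<Otimes>\<^sub>M PL ?I)"
      using measurable_compose[OF measurable_snd borel_measurable_integrable[OF ig]] by simp
    have c: "(\<lambda>w. w i) \<in> borel_measurable (PL ?I)" if "i \<in> ?I" for i using that by (rule measurable_component_PL)
    have pv: "cyc_prev m i \<in> ?I" if "i \<in> ?I" for i using that by (auto simp: cyc_prev_def)
    have 3: "(\<lambda>z. \<Prod>i\<in>?I. cis (fst z i * (snd z (cyc_prev m i) - snd z i))) \<in> borel_measurable (PL ?I \<Otimes>\<^sub>M PL ?I)"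
      by (intro borel_measurable_prod borel_measurable_cis borel_measurable_times borel_measurable_diff
            measurable_compose[OF measurable_fst c] measurable_compose[OF measurable_snd c] pv)
    show "(\<lambda>(w, t). (\<Prod>i\<in>?I. complex_of_real (h i (w i))) * (g t * (\<Prod>i\<in>?I. cis (w i * (t (cyc_prev m i) - t i))))) \<in> borel_measurable (PL ?I \<Otimes>\<^sub>M PL ?I)"
      unfolding case_prod_unfold by (intro borel_measurable_times 1 2 3)
    show "norm ((\<Prod>i\<in>?I. complex_of_real (h i (w i))) * (g t * (\<Prod>i\<in>?I. cis (w i * (t (cyc_prev m i) - t i)))))
      \<le> norm (\<Prod>i\<in>?I. complex_of_real (h i (w i))) * norm (g t)" for w t
      by (simp add: norm_mult prod_norm[symmetric])
  qed
  also have "\<dots> = (LINT t|PL ?I. g t * (\<Prod>i\<in>?I. ft (h i) (t (cyc_prev m i) - t i)))"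
  proof (intro Bochner_Integration.integral_cong refl)
    fix t :: "nat \<Rightarrow> real"
    have "(LINT w|PL ?I. (\<Prod>i\<in>?I. of_real (h i (w i))) * (g t * (\<Prod>i\<in>?I. cis (w i * (t (cyc_prev m i) - t i)))))
      = (LINT w|PL ?I. g t * (\<Prod>i\<in>?I. cis (w i * (t (cyc_prev m i) - t i)) * of_real (h i (w i))))"
      by (simp only: prod.distrib mult_ac)
    also have "\<dots> = g t * (\<Prod>i\<in>?I. LINT l|lborel. cis (l * (t (cyc_prev m i) - t i)) * of_real (h i l))"
      unfolding integral_mult_right_zero
      using h by (subst PL.product_integral_prod) (auto intro!: integrable_cis_mult)
    finally show "(LINT w|PL ?I. (\<Prod>i\<in>?I. of_real (h i (w i))) * (g t * (\<Prod>i\<in>?I. cis (w i * (t (cyc_prev m i) - t i)))))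
      = g t * (\<Prod>i\<in>?I. ft (h i) (t (cyc_prev m i) - t i))" by (simp only: ft_cis)
  qed
  finally show ?thesis by (simp only: g_def)
qed

text \<open>Functions of the increments v_i - v_(i - 1) with v_0 = 0. The value type is left open so
  that the norm of a complex product is again such a product, with real factors.\<close>

definition chain_incr :: "nat \<Rightarrow> (nat \<Rightarrow> real \<Rightarrow> 'a::comm_monoid_mult) \<Rightarrow> (nat \<Rightarrow> real) \<Rightarrow> 'a" where
  "chain_incr n g v = (\<Prod>i\<in>{1..n}. g i ((v(0 := 0)) i - (v(0 := 0)) (i - 1)))"

lemma chain_incr_Suc: "chain_incr (Suc n) g (v(Suc n := y)) = chain_incr n g v * g (Suc n) (y - (v(0 := 0)) n)"
proof -
  have "(\<Prod>i\<in>{1..n}. g i (((v(Suc n := y))(0 := 0)) i - ((v(Suc n := y))(0 := 0)) (i - 1))) = chain_incr n g v"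
    unfolding chain_incr_def by (intro prod.cong) auto
  thus ?thesis by (simp add: chain_incr_def)
qed

lemma measurable_chain_incr:
  fixes g :: "nat \<Rightarrow> real \<Rightarrow> 'a::{real_normed_field, second_countable_topology}"
  assumes "\<And>i. i \<in> {1..n} \<Longrightarrow> g i \<in> borel_measurable borel"
  shows "chain_incr n g \<in> borel_measurable (PL {1..n})"
  unfolding chain_incr_def[abs_def]
  by (intro borel_measurable_prod measurable_compose[OF _ assms] borel_measurable_diff measurable_update_component) auto

text \<open>With w = y - v_n and S = 1 + |v_1| + ... + |v_n|, adding the variable y gives S + |y| <=
  2 S (1 + |w|). The weight therefore factorizes, and one variable can be integrated out at a
  time.\<close>

lemma chain_incr_moment:
  fixes G :: "nat \<Rightarrow> real \<Rightarrow> real"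
  assumes m: "\<And>i. i \<in> {1..n} \<Longrightarrow> G i \<in> borel_measurable borel" and nn: "\<And>i w. G i w \<ge> 0"
    and fin: "\<And>i. i \<in> {1..n} \<Longrightarrow> (\<integral>\<^sup>+w. ennreal ((1 + \<bar>w\<bar>) * G i w) \<partial>lborel) < \<infinity>"
  shows "(\<integral>\<^sup>+v. ennreal ((1 + (\<Sum>j\<in>{1..n}. \<bar>v j\<bar>)) * chain_incr n G v) \<partial>PL {1..n}) < \<infinity>"
  using m fin
proof (induction n)
  case 0
  show ?case by (simp add: PiM_empty nn_integral_count_space_finite chain_incr_def)
next
  case (Suc n)
  define S where "S v = 1 + (\<Sum>j\<in>{1..n}. \<bar>v j\<bar>)" for v :: "nat \<Rightarrow> real"
  have Sv: "S v \<ge> 1" for v by (simp add: S_def sum_nonneg)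
  have [measurable]: "G (Suc n) \<in> borel_measurable borel" using Suc.prems by auto
  have c0: "chain_incr n G v \<ge> 0" for v unfolding chain_incr_def by (intro prod_nonneg nn)
  have mS: "S \<in> borel_measurable (PL {1..n})" unfolding S_def[abs_def]
    by (intro borel_measurable_add borel_measurable_sum borel_measurable_abs measurable_component_PL) auto
  have mc: "chain_incr n G \<in> borel_measurable (PL {1..n})"
    by (rule measurable_chain_incr) (use Suc.prems in auto)
  have ins: "{1..Suc n} = insert (Suc n) {1..n}" by auto
  let ?c = "\<integral>\<^sup>+w. ennreal ((1 + \<bar>w\<bar>) * G (Suc n) w) \<partial>lborel"
  have mm: "(\<lambda>v. ennreal ((1 + (\<Sum>j\<in>{1..Suc n}. \<bar>v j\<bar>)) * chain_incr (Suc n) G v)) \<in> borel_measurable (PL (insert (Suc n) {1..n}))"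
    unfolding ins[symmetric]
    by (intro measurable_compose[OF _ measurable_ennreal] borel_measurable_times borel_measurable_add borel_measurable_sum borel_measurable_abs
          measurable_component_PL measurable_chain_incr) (use Suc.prems in auto)
  have "(\<integral>\<^sup>+v. ennreal ((1 + (\<Sum>j\<in>{1..Suc n}. \<bar>v j\<bar>)) * chain_incr (Suc n) G v) \<partial>PL {1..Suc n})
    = (\<integral>\<^sup>+v. \<integral>\<^sup>+y. ennreal ((1 + (\<Sum>j\<in>{1..Suc n}. \<bar>(v(Suc n := y)) j\<bar>)) * chain_incr (Suc n) G (v(Suc n := y))) \<partial>lborel \<partial>PL {1..n})"
    using PL.product_nn_integral_insert[OF _ _ mm] by (simp only: ins) simp
  also have "\<dots> \<le> (\<integral>\<^sup>+v. \<integral>\<^sup>+y. ennreal (2 * (S v * chain_incr n G v)) * ennreal ((1 + \<bar>- (v(0 := 0)) n + 1 * y\<bar>) * G (Suc n) (- (v(0 := 0)) n + 1 * y)) \<partial>lborel \<partial>PL {1..n})"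
  proof (intro nn_integral_mono)
    fix v :: "nat \<Rightarrow> real" and y :: real
    let ?w = "- (v(0 := 0)) n + 1 * y"
    have last: "\<bar>(v(0 := 0)) n\<bar> \<le> S v"
    proof (cases "n = 0")
      case False
      hence "\<bar>v n\<bar> \<le> (\<Sum>j\<in>{1..n}. \<bar>v j\<bar>)" by (intro member_le_sum) auto
      thus ?thesis using False by (simp add: S_def)
    qed (simp add: S_def)
    have "1 + (\<Sum>j\<in>{1..Suc n}. \<bar>(v(Suc n := y)) j\<bar>) = S v + \<bar>y\<bar>"
    proof -
      have "(\<Sum>j\<in>{1..n}. \<bar>(v(Suc n := y)) j\<bar>) = (\<Sum>j\<in>{1..n}. \<bar>v j\<bar>)" by (intro sum.cong) auto
      thus ?thesis by (simp add: S_def)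
    qed
    also have "\<bar>y\<bar> \<le> \<bar>(v(0 := 0)) n\<bar> + \<bar>?w\<bar>" by linarith
    also have "S v + (\<bar>(v(0 := 0)) n\<bar> + \<bar>?w\<bar>) \<le> 2 * S v + \<bar>?w\<bar>" using last by simp
    also have "\<dots> \<le> 2 * S v + (2 * S v) * \<bar>?w\<bar>"
      using Sv[of v] mult_right_mono[of 1 "2 * S v" "\<bar>?w\<bar>"] by simp
    also have "\<dots> = 2 * S v * (1 + \<bar>?w\<bar>)" by (simp only: distrib_left mult_1_right)
    finally have le: "1 + (\<Sum>j\<in>{1..Suc n}. \<bar>(v(Suc n := y)) j\<bar>) \<le> 2 * S v * (1 + \<bar>?w\<bar>)" by simp
    have "y - (v(0 := 0)) n = ?w" by simp
    hence "(1 + (\<Sum>j\<in>{1..Suc n}. \<bar>(v(Suc n := y)) j\<bar>)) * chain_incr (Suc n) G (v(Suc n := y)) \<le> (2 * S v * (1 + \<bar>?w\<bar>)) * (chain_incr n G v * G (Suc n) ?w)"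
      unfolding chain_incr_Suc using c0 nn by (simp only:) (intro mult_right_mono le mult_nonneg_nonneg)
    also have "\<dots> = (2 * (S v * chain_incr n G v)) * ((1 + \<bar>?w\<bar>) * G (Suc n) ?w)" by (simp only: mult_ac)
    finally show "ennreal ((1 + (\<Sum>j\<in>{1..Suc n}. \<bar>(v(Suc n := y)) j\<bar>)) * chain_incr (Suc n) G (v(Suc n := y)))
      \<le> ennreal (2 * (S v * chain_incr n G v)) * ennreal ((1 + \<bar>?w\<bar>) * G (Suc n) ?w)"
      using Sv[of v] c0[of v] nn by (subst ennreal_mult[symmetric]) (auto intro!: ennreal_leI mult_nonneg_nonneg)
  qed
  also have "\<dots> = (\<integral>\<^sup>+v. ennreal (2 * (S v * chain_incr n G v)) * ?c \<partial>PL {1..n})"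
  proof (intro nn_integral_cong)
    fix v :: "nat \<Rightarrow> real"
    have "?c = ennreal \<bar>1::real\<bar> * (\<integral>\<^sup>+y. ennreal ((1 + \<bar>- (v(0 := 0)) n + 1 * y\<bar>) * G (Suc n) (- (v(0 := 0)) n + 1 * y)) \<partial>lborel)"
      by (rule nn_integral_real_affine) auto
    thus "(\<integral>\<^sup>+y. ennreal (2 * (S v * chain_incr n G v)) * ennreal ((1 + \<bar>- (v(0 := 0)) n + 1 * y\<bar>) * G (Suc n) (- (v(0 := 0)) n + 1 * y)) \<partial>lborel)
      = ennreal (2 * (S v * chain_incr n G v)) * ?c"
      by (subst nn_integral_cmult) auto
  qed
  also have "\<dots> = (\<integral>\<^sup>+v. ennreal 2 * ennreal (S v * chain_incr n G v) \<partial>PL {1..n}) * ?c"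
  proof -
    have "ennreal (2 * (S v * chain_incr n G v)) = ennreal 2 * ennreal (S v * chain_incr n G v)" for v
      using c0[of v] order_trans[OF zero_le_one Sv[of v]] by (intro ennreal_mult) auto
    hence "(\<integral>\<^sup>+v. ennreal (2 * (S v * chain_incr n G v)) * ?c \<partial>PL {1..n}) = (\<integral>\<^sup>+v. (ennreal 2 * ennreal (S v * chain_incr n G v)) * ?c \<partial>PL {1..n})"
      by (simp only:)
    also have "\<dots> = (\<integral>\<^sup>+v. ennreal 2 * ennreal (S v * chain_incr n G v) \<partial>PL {1..n}) * ?c"
      using mS mc by (intro nn_integral_multc) auto
    finally show ?thesis .
  qed
  also have "\<dots> = ennreal 2 * (\<integral>\<^sup>+v. ennreal (S v * chain_incr n G v) \<partial>PL {1..n}) * ?c"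
    using mS mc by (subst nn_integral_cmult) auto
  also have "\<dots> < \<infinity>"
  proof -
    have "(\<integral>\<^sup>+v. ennreal (S v * chain_incr n G v) \<partial>PL {1..n}) < \<infinity>"
      unfolding S_def by (rule Suc.IH) (use Suc.prems in auto)
    moreover have "?c < \<infinity>" by (rule Suc.prems(2)) auto
    ultimately show ?thesis by (auto simp: ennreal_mult_less_top)
  qed
  finally show ?case .
qed

lemma norm_chain_incr: "norm (chain_incr n g v :: 'a::real_normed_field) = chain_incr n (\<lambda>i w. norm (g i w)) v"
  by (simp add: chain_incr_def prod_norm)

lemma
  fixes g :: "nat \<Rightarrow> real \<Rightarrow> complex"
  assumes m: "\<And>i. i \<in> {1..n} \<Longrightarrow> g i \<in> borel_measurable borel"
    and fin: "\<And>i. i \<in> {1..n} \<Longrightarrow> integrable lborel (\<lambda>w. (1 + \<bar>w\<bar>) * norm (g i w))"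
  shows integrable_chain_incr: "integrable (PL {1..n}) (chain_incr n g)"
    and integrable_chain_incr_moment: "integrable (PL {1..n}) (\<lambda>v. (\<Sum>j\<in>{1..n}. \<bar>v j\<bar>) * norm (chain_incr n g v))"
proof -
  let ?G = "\<lambda>i w. norm (g i w)"
  have f: "(\<integral>\<^sup>+w. ennreal ((1 + \<bar>w\<bar>) * ?G i w) \<partial>lborel) < \<infinity>" if "i \<in> {1..n}" for i
    using fin[OF that] by (simp add: integrable_iff_bounded abs_mult)
  have "(\<integral>\<^sup>+v. ennreal ((1 + (\<Sum>j\<in>{1..n}. \<bar>v j\<bar>)) * chain_incr n ?G v) \<partial>PL {1..n}) < \<infinity>"
    by (rule chain_incr_moment) (use m f in auto)
  hence b: "(\<integral>\<^sup>+v. ennreal ((1 + (\<Sum>j\<in>{1..n}. \<bar>v j\<bar>)) * norm (chain_incr n g v)) \<partial>PL {1..n}) < \<infinity>"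
    by (simp only: norm_chain_incr)
  have mg: "chain_incr n g \<in> borel_measurable (PL {1..n})" by (rule measurable_chain_incr[OF m])
  have ms: "(\<lambda>v. \<Sum>j\<in>{1..n}. \<bar>v j\<bar>) \<in> borel_measurable (PL {1..n})"
    by (intro borel_measurable_sum borel_measurable_abs measurable_component_PL) auto
  have s0: "(\<Sum>j\<in>{1..n}. \<bar>v j\<bar>) \<ge> 0" for v :: "nat \<Rightarrow> real" by (intro sum_nonneg) auto
  have "(\<integral>\<^sup>+v. ennreal (norm (chain_incr n g v)) \<partial>PL {1..n}) < \<infinity>"
  proof (rule le_less_trans[OF nn_integral_mono b])
    fix v :: "nat \<Rightarrow> real"
    show "ennreal (norm (chain_incr n g v)) \<le> ennreal ((1 + (\<Sum>j\<in>{1..n}. \<bar>v j\<bar>)) * norm (chain_incr n g v))"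
      using s0[of v] mult_right_mono[of 1 "1 + (\<Sum>j\<in>{1..n}. \<bar>v j\<bar>)" "norm (chain_incr n g v)"] by (intro ennreal_leI) auto
  qed
  thus "integrable (PL {1..n}) (chain_incr n g)" using mg by (simp add: integrable_iff_bounded)
  have "(\<integral>\<^sup>+v. ennreal (norm ((\<Sum>j\<in>{1..n}. \<bar>v j\<bar>) * norm (chain_incr n g v))) \<partial>PL {1..n}) < \<infinity>"
  proof (rule le_less_trans[OF nn_integral_mono b])
    fix v :: "nat \<Rightarrow> real"
    have "norm ((\<Sum>j\<in>{1..n}. \<bar>v j\<bar>) * norm (chain_incr n g v)) = (\<Sum>j\<in>{1..n}. \<bar>v j\<bar>) * norm (chain_incr n g v)"
      using s0[of v] by (simp add: abs_mult)
    also have "\<dots> \<le> (1 + (\<Sum>j\<in>{1..n}. \<bar>v j\<bar>)) * norm (chain_incr n g v)" by (intro mult_right_mono) auto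
    finally show "ennreal (norm ((\<Sum>j\<in>{1..n}. \<bar>v j\<bar>) * norm (chain_incr n g v))) \<le> ennreal ((1 + (\<Sum>j\<in>{1..n}. \<bar>v j\<bar>)) * norm (chain_incr n g v))"
      by (rule ennreal_leI)
  qed
  moreover have "(\<lambda>v. (\<Sum>j\<in>{1..n}. \<bar>v j\<bar>) * norm (chain_incr n g v)) \<in> borel_measurable (PL {1..n})"
    using mg by (intro borel_measurable_times ms) simp
  ultimately show "integrable (PL {1..n}) (\<lambda>v. (\<Sum>j\<in>{1..n}. \<bar>v j\<bar>) * norm (chain_incr n g v))"
    by (simp only: integrable_iff_bounded)
qed

text \<open>For fixed earlier variables the last factor is a translate, so integrating it out leaves
  a constant.\<close>

lemma integral_chain_incr:
  fixes g :: "nat \<Rightarrow> real \<Rightarrow> complex"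
  assumes m: "\<And>i. i \<in> {1..n} \<Longrightarrow> g i \<in> borel_measurable borel"
    and fin: "\<And>i. i \<in> {1..n} \<Longrightarrow> integrable lborel (\<lambda>w. (1 + \<bar>w\<bar>) * norm (g i w))"
  shows "(LINT v|PL {1..n}. chain_incr n g v) = (\<Prod>i\<in>{1..n}. LINT w|lborel. g i w)"
  using m fin
proof (induction n)
  case 0
  show ?case by (simp add: PiM_empty lebesgue_integral_count_space_finite chain_incr_def)
next
  case (Suc n)
  have ins: "{1..Suc n} = insert (Suc n) {1..n}" by auto
  have "integrable (PL {1..Suc n}) (chain_incr (Suc n) g)" by (rule integrable_chain_incr[OF Suc.prems])
  hence i: "integrable (PL (insert (Suc n) {1..n})) (chain_incr (Suc n) g)" by (simp only: ins)
  have "(LINT v|PL {1..Suc n}. chain_incr (Suc n) g v) = (LINT v|PL {1..n}. LINT y|lborel. chain_incr (Suc n) g (v(Suc n := y)))"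
    unfolding ins by (rule PL.product_integral_insert[OF _ _ i]) auto
  also have "\<dots> = (LINT v|PL {1..n}. chain_incr n g v * (LINT w|lborel. g (Suc n) w))"
  proof (intro Bochner_Integration.integral_cong refl)
    fix v :: "nat \<Rightarrow> real"
    have "(LINT w|lborel. g (Suc n) w) = (LINT y|lborel. g (Suc n) (y - (v(0 := 0)) n))"
      using lborel_integral_real_affine[of 1 "g (Suc n)" "- (v(0 := 0)) n"] by (simp add: algebra_simps)
    thus "(LINT y|lborel. chain_incr (Suc n) g (v(Suc n := y))) = chain_incr n g v * (LINT w|lborel. g (Suc n) w)"
      unfolding chain_incr_Suc by simp
  qed
  also have "\<dots> = (\<Prod>i\<in>{1..n}. LINT w|lborel. g i w) * (LINT w|lborel. g (Suc n) w)"
    using Suc by simp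
  finally show ?case by simp
qed

text \<open>For indicators, \<open>phi\<close> is the length of an intersection of translates of
  [0, T]. A point x of [0, T] is lost only if some x - v_j leaves the interval.\<close>

lemma overlap_bound:
  assumes T: "T \<ge> 0"
  shows "\<bar>phi (Suc n) (\<lambda>_. indicator {0..T}) v - T\<bar> \<le> (\<Sum>j\<in>{1..n}. \<bar>v j\<bar>)"
proof -
  let ?i = "indicator {0..T} :: real \<Rightarrow> real"
  \<comment> \<open>Covers the points of [0, T] lost through the translation by y: at the left end
    if y > 0, at the right end if y < 0. Its integral is |y| in either case.\<close>
  define E where "E y x = (indicator {0..y} x + indicator {T + y..T} x :: real)" for y x
  have iE: "integrable lborel (E y)" for y unfolding E_def by (intro Bochner_Integration.integrable_add integrable_indicator_Icc)
  have E: "(LINT x|lborel. E y x) = \<bar>y\<bar>" for y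
  proof -
    have "(LINT x|lborel. E y x) = (LINT x|lborel. indicator {0..y} x) + (LINT x|lborel. indicator {T + y..T} x)"
      unfolding E_def by (intro Bochner_Integration.integral_add integrable_indicator_Icc)
    also have "\<dots> = \<bar>y\<bar>" by (cases "y \<ge> 0") auto
    finally show ?thesis .
  qed
  define P where "P x = ?i x * (\<Prod>i\<in>{2..Suc n}. ?i (x - v (i - 1)))" for x
  have P01: "0 \<le> (\<Prod>i\<in>{2..Suc n}. ?i (x - v (i - 1)))" "(\<Prod>i\<in>{2..Suc n}. ?i (x - v (i - 1))) \<le> 1" for x
    by (auto intro!: prod_nonneg prod_le_1 simp: indicator_def)
  have Pi: "0 \<le> P x" "P x \<le> ?i x" for x
    using P01[of x] by (auto simp: P_def split: split_indicator)
  have iP: "integrable lborel P"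
  proof (rule Bochner_Integration.integrable_bound[OF integrable_indicator_Icc[of 0 T]])
    show "P \<in> borel_measurable lborel" unfolding P_def by measurable
    show "AE x in lborel. norm (P x) \<le> norm (?i x)" using Pi by (intro AE_I2) auto
  qed
  have pt: "\<bar>P x - ?i x\<bar> \<le> (\<Sum>j\<in>{1..n}. E (v j) x)" for x
  proof (cases "P x = ?i x")
    case True
    thus ?thesis by (auto simp: E_def intro!: sum_nonneg)
  next
    case False
    hence x: "x \<in> {0..T}" and "(\<Prod>i\<in>{2..Suc n}. ?i (x - v (i - 1))) \<noteq> 1" by (auto simp: P_def split: split_indicator_asm)
    then obtain i where i: "i \<in> {2..Suc n}" "?i (x - v (i - 1)) \<noteq> 1" by (metis (no_types, lifting) prod.neutral)
    hence "x - v (i - 1) \<notin> {0..T}" by (auto split: split_indicator_asm)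
    hence "E (v (i - 1)) x \<ge> 1" using x by (auto simp: E_def split: split_indicator)
    also have "E (v (i - 1)) x \<le> (\<Sum>j\<in>{1..n}. E (v j) x)"
      using i by (intro member_le_sum[of "i - 1" "{1..n}" "\<lambda>j. E (v j) x"]) (auto simp: E_def)
    finally show ?thesis using Pi[of x] x by simp
  qed
  have "phi (Suc n) (\<lambda>_. indicator {0..T}) v - T = (LINT x|lborel. P x - ?i x)"
    unfolding phi_def P_def[symmetric] using T iP integrable_indicator_Icc[of 0 T] by simp
  also have "\<bar>\<dots>\<bar> \<le> (LINT x|lborel. \<bar>P x - ?i x\<bar>)"
    using integral_norm_bound[of lborel "\<lambda>x. P x - ?i x"] by simp
  also have "\<dots> \<le> (LINT x|lborel. (\<Sum>j\<in>{1..n}. E (v j) x))"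
    by (intro integral_mono integrable_abs Bochner_Integration.integrable_diff Bochner_Integration.integrable_sum iP iE integrable_indicator_Icc pt)
  also have "\<dots> = (\<Sum>j\<in>{1..n}. \<bar>v j\<bar>)"
    by (simp add: Bochner_Integration.integral_sum iE E)
  finally show ?thesis .
qed

text \<open>With the times t_i = x - v_(i - 1), consecutive differences are increments of v and x
  cancels. The index 1 closes the cycle and contributes - v_n.\<close>

lemma prod_ft_anchored:
  assumes n: "n \<ge> 1"
  shows "(\<Prod>i\<in>{1..Suc n}. F i (anchored n x v (cyc_prev (Suc n) i) - anchored n x v i))
    = F 1 (- (v(0 := 0)) n) * chain_incr n (\<lambda>i. F (Suc i)) v"
proof -
  have "(\<Prod>i\<in>{1..Suc n}. F i (anchored n x v (cyc_prev (Suc n) i) - anchored n x v i))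
    = F 1 (anchored n x v (cyc_prev (Suc n) 1) - anchored n x v 1) * (\<Prod>i\<in>{1..n}. F (Suc i) (anchored n x v (cyc_prev (Suc n) (Suc i)) - anchored n x v (Suc i)))"
    by (subst prod.atLeast_Suc_atMost) (auto simp: prod.shift_bounds_cl_Suc_ivl simp del: prod.cl_ivl_Suc)
  also have "anchored n x v (cyc_prev (Suc n) 1) - anchored n x v 1 = - (v(0 := 0)) n"
    by (simp add: anchored_def cyc_prev_def)
  also have "(\<Prod>i\<in>{1..n}. F (Suc i) (anchored n x v (cyc_prev (Suc n) (Suc i)) - anchored n x v (Suc i))) = chain_incr n (\<lambda>i. F (Suc i)) v"
    unfolding chain_incr_def by (intro prod.cong refl) (auto simp: anchored_def cyc_prev_def)
  finally show ?thesis .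
qed

text \<open>The weight |t| gives no control near 0; for |t| <= 1 the transform is bounded by the L^1
  norm of h instead.\<close>

lemma F1_moment:
  assumes "h \<in> F1"
  shows "integrable lborel (\<lambda>w. (1 + \<bar>w\<bar>) * norm (ft h w))" "integrable lborel (ft h)"
proof -
  have h: "integrable lborel h" and w: "integrable lborel (\<lambda>t. \<bar>t\<bar> * norm (ft h t))" using assms by (auto simp: F1_def)
  have [measurable]: "h \<in> borel_measurable borel" using h by auto
  let ?N = "LINT l|lborel. \<bar>h l\<bar>"
  have N: "?N \<ge> 0" by (rule Bochner_Integration.integral_nonneg) simp
  have b: "integrable lborel (\<lambda>t. 2 * ?N * indicator {-1..1} t + 2 * (\<bar>t\<bar> * norm (ft h t)))"
    using w by (intro Bochner_Integration.integrable_add integrable_mult_right integrable_indicator_Icc)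
  have le: "(1 + \<bar>t\<bar>) * norm (ft h t) \<le> 2 * ?N * indicator {-1..1} t + 2 * (\<bar>t\<bar> * norm (ft h t))" for t
  proof (cases "\<bar>t\<bar> \<le> 1")
    case True
    have "(1 + \<bar>t\<bar>) * norm (ft h t) \<le> 2 * ?N" using True norm_ft_le[of h t] by (intro mult_mono) auto
    moreover have "indicat_real {-1..1} t = 1" using True by (simp add: abs_le_iff)
    ultimately show ?thesis by (simp add: add_increasing2)
  next
    case False
    have "norm (ft h t) * 1 \<le> norm (ft h t) * \<bar>t\<bar>" using False by (intro mult_left_mono) auto
    hence "(1 + \<bar>t\<bar>) * norm (ft h t) \<le> 2 * (\<bar>t\<bar> * norm (ft h t))" by (simp add: algebra_simps)
    thus ?thesis using N by (simp add: add_increasing)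
  qed
  show 1: "integrable lborel (\<lambda>w. (1 + \<bar>w\<bar>) * norm (ft h w))"
  proof (rule Bochner_Integration.integrable_bound[OF b])
    have "norm ((1 + \<bar>t\<bar>) * norm (ft h t)) \<le> norm (2 * ?N * indicator {-1..1} t + 2 * (\<bar>t\<bar> * norm (ft h t)))" for t
    proof -
      have "norm ((1 + \<bar>t\<bar>) * norm (ft h t)) = (1 + \<bar>t\<bar>) * norm (ft h t)" by (simp add: abs_mult)
      thus ?thesis using le[of t] unfolding real_norm_def by linarith
    qed
    thus "AE t in lborel. norm ((1 + \<bar>t\<bar>) * norm (ft h t)) \<le> norm (2 * ?N * indicator {-1..1} t + 2 * (\<bar>t\<bar> * norm (ft h t)))"
      by (intro AE_I2)
  qed simp
  show "integrable lborel (ft h)"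
  proof (rule Bochner_Integration.integrable_bound[OF 1])
    have "norm (ft h t) \<le> norm ((1 + \<bar>t\<bar>) * norm (ft h t))" for t
      using mult_right_mono[of 1 "1 + \<bar>t\<bar>" "norm (ft h t)"] by (simp add: abs_mult)
    thus "AE t in lborel. norm (ft h t) \<le> norm ((1 + \<bar>t\<bar>) * norm (ft h t))" by simp
  qed simp
qed

lemma Delta_bigo_of_F1:
  assumes n: "n \<ge> 1" and F: "\<forall>i\<in>{1..Suc n}. h i \<in> F1"
  shows "(\<lambda>T. Delta (Suc n) h T) \<in> O[at_top](\<lambda>T. 1 / T)"
proof -
  let ?I = "{1..Suc n}"
  have h: "\<forall>i\<in>?I. integrable lborel (h i)" using F by (auto simp: F1_def)
  have hm: "h i \<in> borel_measurable borel" if "i \<in> ?I" for i using h that by force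
  define G where "G i = ft (h (Suc i))" for i
  have Gm: "G i \<in> borel_measurable borel" if "i \<in> {1..n}" for i
    unfolding G_def by (intro measurable_ft hm) (use that in auto)
  have Gi: "integrable lborel (\<lambda>w. (1 + \<bar>w\<bar>) * norm (G i w))" if "i \<in> {1..n}" for i
    unfolding G_def by (intro F1_moment) (use that F in auto)
  \<comment> \<open>The product of all m transforms as a function of the time differences.\<close>
  define \<Psi> where "\<Psi> v = ft (h 1) (- (v(0 := 0)) n) * chain_incr n G v" for v
  define N where "N = (LINT l|lborel. \<bar>h 1 l\<bar>)"
  have h1: "integrable lborel (h 1)" "h 1 \<in> borel_measurable borel" using h hm by auto
  have c0: "(\<lambda>v. (v(0 := 0)) i) \<in> borel_measurable (PL {1..n})" if "i \<le> n" for i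
    using that by (intro measurable_update_component) auto
  have N0: "N \<ge> 0" unfolding N_def by (rule Bochner_Integration.integral_nonneg) simp
  have m\<Psi>: "\<Psi> \<in> borel_measurable (PL {1..n})"
    unfolding \<Psi>_def
    by (intro borel_measurable_times measurable_compose[OF _ measurable_ft[OF h1(2)]] borel_measurable_uminus c0 measurable_chain_incr Gm) auto
  have \<Psi>le: "norm (\<Psi> v) \<le> N * norm (chain_incr n G v)" for v
    unfolding \<Psi>_def N_def norm_mult by (intro mult_right_mono norm_ft_le) auto
  have i\<Psi>: "integrable (PL {1..n}) \<Psi>"
  proof (rule Bochner_Integration.integrable_bound)
    show "integrable (PL {1..n}) (\<lambda>v. N * norm (chain_incr n G v))"
      by (intro integrable_mult_right integrable_norm integrable_chain_incr Gm Gi)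
    show "AE v in PL {1..n}. norm (\<Psi> v) \<le> norm (N * norm (chain_incr n G v))"
      unfolding real_norm_def by (intro AE_I2 order_trans[OF \<Psi>le abs_ge_self])
  qed (rule m\<Psi>)
  \<comment> \<open>A first moment of the transforms; N X / T will bound the error for every T >
    0.\<close>
  define X where "X = (LINT v|PL {1..n}. (\<Sum>j\<in>{1..n}. \<bar>v j\<bar>) * norm (chain_incr n G v))"
  have iX: "integrable (PL {1..n}) (\<lambda>v. (\<Sum>j\<in>{1..n}. \<bar>v j\<bar>) * norm (chain_incr n G v))"
    by (rule integrable_chain_incr_moment[OF Gm Gi])
  \<comment> \<open>The transform of h_1 is opened by its definition; its phase at - v_n splits over
    the increments because they telescope. Each remaining transform is then inverted, which gives n
    factors 2 pi.\<close>
  have main: "(LINT v|PL {1..n}. \<Psi> v) = complex_of_real (2 * pi) ^ n * complex_of_real (LINT l|lborel. (\<Prod>i\<in>?I. h i l))"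
  proof -
    interpret M: sigma_finite_measure "PL {1..n}" by (rule sigma_finite_PL) simp
    interpret P: pair_sigma_finite "PL {1..n}" lborel ..
    have "(LINT v|PL {1..n}. \<Psi> v) = (LINT v|PL {1..n}. LINT l|lborel. cis (l * - (v(0 := 0)) n) * of_real (h 1 l) * chain_incr n G v)"
      unfolding \<Psi>_def ft_cis by simp
    also have "\<dots> = (LINT l|lborel. LINT v|PL {1..n}. cis (l * - (v(0 := 0)) n) * of_real (h 1 l) * chain_incr n G v)"
    proof (rule P.Fubini_pair[OF integrable_chain_incr[OF Gm Gi] h1(1)])
      have m1: "(\<lambda>z. chain_incr n G (fst z)) \<in> borel_measurable (PL {1..n} \<Otimes>\<^sub>M lborel)"
        using measurable_compose[OF measurable_fst measurable_chain_incr[OF Gm]] by simp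
      have m2: "(\<lambda>z. complex_of_real (h 1 (snd z))) \<in> borel_measurable (PL {1..n} \<Otimes>\<^sub>M lborel)"
        using h1(2) by measurable
      have m3: "(\<lambda>z. ((fst z)(0 := 0)) n) \<in> borel_measurable (PL {1..n} \<Otimes>\<^sub>M lborel)"
        using measurable_compose[OF measurable_fst c0[of n]] by simp
      have m4: "(\<lambda>z. snd z) \<in> borel_measurable (PL {1..n} \<Otimes>\<^sub>M lborel)" by measurable
      show "(\<lambda>(v, l). cis (l * - (v(0 := 0)) n) * complex_of_real (h 1 l) * chain_incr n G v) \<in> borel_measurable (PL {1..n} \<Otimes>\<^sub>M lborel)"
        unfolding case_prod_unfold by (intro borel_measurable_times borel_measurable_cis borel_measurable_uminus m1 m2 m3 m4)
      show "norm (cis (l * - (v(0 := 0)) n) * complex_of_real (h 1 l) * chain_incr n G v) \<le> norm (chain_incr n G v) * norm (h 1 l)" for v l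
        by (simp add: norm_mult)
    qed
    also have "\<dots> = (LINT l|lborel. of_real (h 1 l) * (\<Prod>i\<in>{1..n}. cft (G i) (- l)))"
    proof (intro Bochner_Integration.integral_cong refl)
      fix l :: real
      let ?g = "\<lambda>i w. cis (w * - l) * G i w"
      have tele: "(\<Sum>i\<in>{1..n}. (v(0 := 0)) i - (v(0 := 0)) (i - 1)) = (v(0 := 0)) n" for v :: "nat \<Rightarrow> real"
      proof (induction n)
        case (Suc k)
        thus ?case by (simp only: sum.cl_ivl_Suc) simp
      qed simp
      have c: "cis (l * - (v(0 := 0)) n) * chain_incr n G v = chain_incr n ?g v" for v
      proof -
        have "l * - (v(0 := 0)) n = (\<Sum>i\<in>{1..n}. ((v(0 := 0)) i - (v(0 := 0)) (i - 1)) * - l)"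
          unfolding tele[of v, symmetric] by (simp only: sum_distrib_right[symmetric]) simp
        hence "cis (l * - (v(0 := 0)) n) = (\<Prod>i\<in>{1..n}. cis (((v(0 := 0)) i - (v(0 := 0)) (i - 1)) * - l))"
          by (simp only: cis_sum)
        thus ?thesis by (simp only: chain_incr_def prod.distrib)
      qed
      have "(LINT v|PL {1..n}. cis (l * - (v(0 := 0)) n) * of_real (h 1 l) * chain_incr n G v)
        = (LINT v|PL {1..n}. of_real (h 1 l) * chain_incr n ?g v)"
        unfolding c[symmetric] by (simp only: mult_ac)
      also have "\<dots> = of_real (h 1 l) * (\<Prod>i\<in>{1..n}. LINT w|lborel. ?g i w)"
        unfolding integral_mult_right_zero
      proof (subst integral_chain_incr)
        fix i assume i: "i \<in> {1..n}"
        have [measurable]: "G i \<in> borel_measurable borel" by (rule Gm[OF i])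
        show "?g i \<in> borel_measurable borel" by measurable
        show "integrable lborel (\<lambda>w. (1 + \<bar>w\<bar>) * norm (?g i w))" using Gi[OF i] by (simp add: norm_mult)
      qed simp
      finally show "(LINT v|PL {1..n}. cis (l * - (v(0 := 0)) n) * of_real (h 1 l) * chain_incr n G v)
        = of_real (h 1 l) * (\<Prod>i\<in>{1..n}. cft (G i) (- l))" by (simp only: cft_def)
    qed
    also have "\<dots> = (LINT l|lborel. complex_of_real (2 * pi) ^ n * complex_of_real (\<Prod>i\<in>?I. h i l))"
    proof (rule integral_cong_AE)
      have [measurable]: "(\<lambda>l. complex_of_real (h 1 l)) \<in> borel_measurable lborel" using h1 by simp
      show "(\<lambda>l. of_real (h 1 l) * (\<Prod>i\<in>{1..n}. cft (G i) (- l))) \<in> borel_measurable lborel"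
      proof (intro borel_measurable_times borel_measurable_prod)
        fix i assume "i \<in> {1..n}"
        hence [measurable]: "G i \<in> borel_measurable borel" by (rule Gm)
        show "(\<lambda>l. cft (G i) (- l)) \<in> borel_measurable lborel" by measurable
      qed measurable
      have "(\<lambda>l. \<Prod>i\<in>?I. h i l) \<in> borel_measurable lborel" by (intro borel_measurable_prod) (use hm in simp)
      thus "(\<lambda>l. complex_of_real (2 * pi) ^ n * complex_of_real (\<Prod>i\<in>?I. h i l)) \<in> borel_measurable lborel" by measurable
      have "AE l in lborel. \<forall>i\<in>{1..n}. cft (G i) (- l) = of_real (2 * pi * h (Suc i) l)"
        unfolding G_def by (intro AE_finite_allI fourier_inversion_AE F1_moment) (use h F in auto)
      thus "AE l in lborel. of_real (h 1 l) * (\<Prod>i\<in>{1..n}. cft (G i) (- l)) = complex_of_real (2 * pi) ^ n * complex_of_real (\<Prod>i\<in>?I. h i l)"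
      proof eventually_elim
        case (elim l)
        have "(\<Prod>i\<in>{1..n}. cft (G i) (- l)) = (\<Prod>i\<in>{1..n}. of_real (2 * pi) * complex_of_real (h (Suc i) l))"
          using elim by (intro prod.cong) auto
        also have "\<dots> = complex_of_real (2 * pi) ^ n * (\<Prod>i\<in>{1..n}. complex_of_real (h (Suc i) l))" by (simp add: prod.distrib)
        finally have e: "(\<Prod>i\<in>{1..n}. cft (G i) (- l)) = complex_of_real (2 * pi) ^ n * (\<Prod>i\<in>{1..n}. complex_of_real (h (Suc i) l))" .
        have "(\<Prod>i\<in>?I. complex_of_real (h i l)) = of_real (h 1 l) * (\<Prod>i\<in>{1..n}. complex_of_real (h (Suc i) l))"
          by (subst prod.atLeast_Suc_atMost) (auto simp: prod.shift_bounds_cl_Suc_ivl simp del: prod.cl_ivl_Suc)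
        thus ?case unfolding e of_real_prod by (simp only: mult_ac)
      qed
    qed
    finally show ?thesis unfolding integral_mult_right_zero integral_complex_of_real by simp
  qed
  have key: "Delta (Suc n) h T \<le> N * X / T" if T: "T > 0" for T
  proof -
    let ?ind = "\<lambda>_::nat. indicator {0..T} :: real \<Rightarrow> real"
    let ?p = "phi (Suc n) ?ind"
    let ?R = "\<lambda>t. \<Prod>i\<in>?I. ft (h i) (t (cyc_prev (Suc n) i) - t i)"
    let ?J = "\<lambda>t. (\<Prod>i\<in>?I. indicator {0..T} (t i) :: complex) * ?R t"
    have iJ: "integrable (PL ?I) ?J"
    proof (rule integrable_prod_components)
      show "integrable lborel (\<lambda>x. indicator {0..T} x :: complex)"
      proof -
        have "integrable lborel (\<lambda>x. complex_of_real (indicator {0..T} x))" using integrable_indicator_Icc by simp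
        thus ?thesis by (simp add: of_real_indicator)
      qed
      show "?R \<in> borel_measurable (PL ?I)"
        by (intro borel_measurable_prod measurable_compose[OF _ measurable_ft] borel_measurable_diff measurable_component_PL hm)
           (auto simp: cyc_prev_def)
      show "norm (?R t) \<le> (\<Prod>i\<in>?I. LINT l|lborel. \<bar>h i l\<bar>)" for t
        unfolding prod_norm[symmetric] by (intro prod_mono conjI norm_ge_zero norm_ft_le)
    qed
    \<comment> \<open>Since \<Psi> does not involve x, the integral over x acts on the indicators
      alone and yields the overlap length.\<close>
    have e: "(LINT x|lborel. ?J (anchored n x v)) = of_real (?p v) * \<Psi> v" for v
    proof -
      have "?J (anchored n x v) = complex_of_real (\<Prod>i\<in>?I. ?ind i (anchored n x v i)) * \<Psi> v" for x
        unfolding prod_ft_anchored[OF n, of "\<lambda>i. ft (h i)"] \<Psi>_def G_def by (simp only: of_real_prod of_real_indicator)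
      thus ?thesis unfolding phi_anchored by (simp only: integral_mult_left_zero integral_complex_of_real)
    qed
    have "(LINT t|PL ?I. ?J t) = (LINT v|PL {1..n}. of_real (?p v) * \<Psi> v)"
      unfolding integral_anchored[OF iJ] e ..
    hence tr: "op_trace T (toeplitz_prod T (Suc n) h) = (LINT v|PL {1..n}. of_real (?p v) * \<Psi> v)"
      using trace_time_domain[OF T _ h] by simp
    have i1: "integrable (PL {1..n}) (\<lambda>v. of_real (?p v) * \<Psi> v)"
      using integrable_anchored[OF iJ] unfolding e .
    have i2: "integrable (PL {1..n}) (\<lambda>v. of_real T * \<Psi> v)" by (intro integrable_mult_right i\<Psi>)
    have "op_trace T (toeplitz_prod T (Suc n) h) - complex_of_real T * (complex_of_real (2 * pi) ^ n * complex_of_real (LINT l|lborel. (\<Prod>i\<in>?I. h i l)))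
      = (LINT v|PL {1..n}. of_real (?p v) * \<Psi> v - of_real T * \<Psi> v)"
      unfolding tr main[symmetric] integral_mult_right_zero[symmetric] by (rule Bochner_Integration.integral_diff[OF i1 i2, symmetric])
    also have "norm \<dots> \<le> (LINT v|PL {1..n}. norm (of_real (?p v) * \<Psi> v - of_real T * \<Psi> v))" by (rule integral_norm_bound)
    also have "\<dots> \<le> (LINT v|PL {1..n}. N * ((\<Sum>j\<in>{1..n}. \<bar>v j\<bar>) * norm (chain_incr n G v)))"
    proof (intro integral_mono integrable_norm Bochner_Integration.integrable_diff i1 i2 integrable_mult_right iX)
      fix v :: "nat \<Rightarrow> real"
      have "norm (of_real (?p v) * \<Psi> v - of_real T * \<Psi> v) = \<bar>?p v - T\<bar> * norm (\<Psi> v)"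
        unfolding left_diff_distrib[symmetric] norm_mult of_real_diff[symmetric] norm_of_real ..
      also have "\<dots> \<le> (\<Sum>j\<in>{1..n}. \<bar>v j\<bar>) * (N * norm (chain_incr n G v))"
        using T by (intro mult_mono overlap_bound \<Psi>le sum_nonneg) auto
      finally show "norm (of_real (?p v) * \<Psi> v - of_real T * \<Psi> v) \<le> N * ((\<Sum>j\<in>{1..n}. \<bar>v j\<bar>) * norm (chain_incr n G v))"
        by (simp only: mult_ac)
    qed
    also have "\<dots> = N * X" by (simp add: X_def)
    finally have b: "norm (op_trace T (toeplitz_prod T (Suc n) h) - complex_of_real T * (complex_of_real (2 * pi) ^ n * complex_of_real (LINT l|lborel. (\<Prod>i\<in>?I. h i l)))) \<le> N * X" .
    have "Delta (Suc n) h T = norm ((op_trace T (toeplitz_prod T (Suc n) h) - complex_of_real T * (complex_of_real (2 * pi) ^ n * complex_of_real (LINT l|lborel. (\<Prod>i\<in>?I. h i l)))) / of_real T)"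
      unfolding Delta_def using T by (simp add: diff_divide_distrib del: prod.cl_ivl_Suc)
    also have "\<dots> = norm (op_trace T (toeplitz_prod T (Suc n) h) - complex_of_real T * (complex_of_real (2 * pi) ^ n * complex_of_real (LINT l|lborel. (\<Prod>i\<in>?I. h i l)))) / T"
      using T by (simp only: norm_divide norm_of_real abs_of_pos)
    also have "\<dots> \<le> N * X / T" using b T by (intro divide_right_mono) auto
    finally show ?thesis .
  qed
  have "norm (Delta (Suc n) h T) \<le> \<bar>N * X\<bar> * norm (1 / T)" if T: "T > 0" for T
  proof -
    have "Delta (Suc n) h T \<le> N * X / T" by (rule key[OF T])
    also have "\<dots> \<le> \<bar>N * X\<bar> / T" using T by (intro divide_right_mono) auto
    finally show ?thesis using Delta_nonneg[of "Suc n" h T] T by simp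
  qed
  thus ?thesis
    by (intro bigoI[where c = "\<bar>N * X\<bar>"] eventually_mono[OF eventually_gt_at_top[of 0]]) auto
qed

theorem theorem3p2:
  fixes m :: nat and h :: "nat \<Rightarrow> real \<Rightarrow> real"
  assumes m2: "m \<ge> 2"
    and integ: "\<forall>i\<in>{1..m}. integrable lborel (h i)"
    and even: "\<forall>i\<in>{1..m}. \<forall>x. h i (- x) = h i x"
  shows
    "((\<forall>i\<in>{1..m}. h i \<in> F1) \<longrightarrow> (\<lambda>T. Delta m h T) \<in> O[at_top](\<lambda>T. 1 / T))
   \<and> (\<forall>C \<gamma>. ((\<forall>u. integrable lborel (\<lambda>l. h 1 l * (\<Prod>i\<in>{2..m}. h i (l - u (i - 1)))))
          \<and> (\<exists>B. AE u in PiM {1..m-1} (\<lambda>_. lborel). \<bar>phi m h u\<bar> \<le> B)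
          \<and> C > 0 \<and> 0 < \<gamma> \<and> \<gamma> \<le> 1
          \<and> (\<forall>u. \<bar>phi m h u - phi m h (\<lambda>_. 0)\<bar> \<le> C * (\<Sum>i\<in>{1..m-1}. \<bar>u i\<bar>) powr \<gamma>))
        \<longrightarrow> (\<forall>\<epsilon>>0. (\<lambda>T. Delta m h T) \<in> O[at_top](\<lambda>T. T powr (\<epsilon> - \<gamma>))))
   \<and> (\<forall>(p :: nat \<Rightarrow> ennreal) \<gamma>. ((\<forall>i\<in>{1..m}. 1 \<le> p i \<and> h i \<in> Lip (p i) \<gamma>)
          \<and> (\<Sum>i\<in>{1..m}. inverse (p i)) \<le> 1 \<and> 0 < \<gamma> \<and> \<gamma> \<le> 1)
        \<longrightarrow> (\<forall>\<epsilon>>0. (\<lambda>T. Delta m h T) \<in> O[at_top](\<lambda>T. T powr (\<epsilon> - \<gamma>))))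
   \<and> (\<forall>C \<sigma> \<delta> :: nat \<Rightarrow> real.
        ((\<forall>i\<in>{1..m}. \<forall>x. x \<noteq> 0 \<longrightarrow> h i differentiable (at x))
          \<and> (\<forall>i\<in>{1..m}. C i > 0 \<and> \<sigma> i > 0 \<and> \<delta> i > 1)
          \<and> (\<Sum>i\<in>{1..m}. \<sigma> i) < 1
          \<and> (\<forall>i\<in>{1..m}. \<forall>x. x \<noteq> 0 \<longrightarrow>
               \<bar>h i x\<bar> \<le> (if \<bar>x\<bar> \<le> 1 then C i * \<bar>x\<bar> powr (- \<sigma> i) else C i * \<bar>x\<bar> powr (- \<delta> i))
             \<and> \<bar>deriv (h i) x\<bar> \<le> (if \<bar>x\<bar> \<le> 1 then C i * \<bar>x\<bar> powr (- \<sigma> i - 1)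
                                   else C i * \<bar>x\<bar> powr (- \<delta> i - 1))))
        \<longrightarrow> (\<forall>\<epsilon>>0. (\<lambda>T. Delta m h T) \<in>
               O[at_top](\<lambda>T. T powr (\<epsilon> - (1 - (\<Sum>i\<in>{1..m}. \<sigma> i)) / real m))))"
proof -
  \<comment> \<open>n is the number of difference variables u_1, ..., u_n; that it is at least 1 is
    used for (B1), (B3) and (B4).\<close>
  obtain n where mn: "m = Suc n" and n: "n \<ge> 1" using m2 by (cases m) auto
  note h = integ[unfolded mn]
  have m1: "Suc n - 1 = n" by simp
  show ?thesis
    unfolding mn m1
  proof (intro conjI allI impI)
    assume "\<forall>i\<in>{1..Suc n}. h i \<in> F1"
    thus "(\<lambda>T. Delta (Suc n) h T) \<in> O[at_top](\<lambda>T. 1 / T)" by (rule Delta_bigo_of_F1[OF n])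
  next
    fix C \<gamma> \<epsilon> :: real
    assume A: "(\<forall>u. integrable lborel (\<lambda>l. h 1 l * (\<Prod>i\<in>{2..Suc n}. h i (l - u (i - 1)))))
          \<and> (\<exists>B. AE u in PL {1..n}. \<bar>phi (Suc n) h u\<bar> \<le> B)
          \<and> C > 0 \<and> 0 < \<gamma> \<and> \<gamma> \<le> 1
          \<and> (\<forall>u. \<bar>phi (Suc n) h u - phi (Suc n) h (\<lambda>_. 0)\<bar> \<le> C * (\<Sum>i\<in>{1..n}. \<bar>u i\<bar>) powr \<gamma>)" and \<epsilon>: "\<epsilon> > 0"
    then obtain B where B: "AE u in PL {1..n}. \<bar>phi (Suc n) h u\<bar> \<le> B" by blast
    show "(\<lambda>T. Delta (Suc n) h T) \<in> O[at_top](\<lambda>T. T powr (\<epsilon> - \<gamma>))"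
      by (rule Delta_bigo_of_hoelder[OF h _ _ _ \<epsilon> _ B, of C]) (use A in auto)
  next
    fix p :: "nat \<Rightarrow> ennreal" and \<gamma> \<epsilon> :: real
    assume A: "(\<forall>i\<in>{1..Suc n}. 1 \<le> p i \<and> h i \<in> Lip (p i) \<gamma>)
          \<and> (\<Sum>i\<in>{1..Suc n}. inverse (p i)) \<le> 1 \<and> 0 < \<gamma> \<and> \<gamma> \<le> 1" and \<epsilon>: "\<epsilon> > 0"
    show "(\<lambda>T. Delta (Suc n) h T) \<in> O[at_top](\<lambda>T. T powr (\<epsilon> - \<gamma>))"
      by (rule Delta_bigo_of_Lip[OF n h, of p]) (use A \<epsilon> in blast)+
  next
    fix C \<sigma> \<delta> :: "nat \<Rightarrow> real" and \<epsilon> :: real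
    assume A: "(\<forall>i\<in>{1..Suc n}. \<forall>x. x \<noteq> 0 \<longrightarrow> h i differentiable (at x))
          \<and> (\<forall>i\<in>{1..Suc n}. C i > 0 \<and> \<sigma> i > 0 \<and> \<delta> i > 1)
          \<and> (\<Sum>i\<in>{1..Suc n}. \<sigma> i) < 1
          \<and> (\<forall>i\<in>{1..Suc n}. \<forall>x. x \<noteq> 0 \<longrightarrow>
               \<bar>h i x\<bar> \<le> (if \<bar>x\<bar> \<le> 1 then C i * \<bar>x\<bar> powr (- \<sigma> i) else C i * \<bar>x\<bar> powr (- \<delta> i))
             \<and> \<bar>deriv (h i) x\<bar> \<le> (if \<bar>x\<bar> \<le> 1 then C i * \<bar>x\<bar> powr (- \<sigma> i - 1)
                                   else C i * \<bar>x\<bar> powr (- \<delta> i - 1)))" and \<epsilon>: "\<epsilon> > 0"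
    show "(\<lambda>T. Delta (Suc n) h T) \<in> O[at_top](\<lambda>T. T powr (\<epsilon> - (1 - (\<Sum>i\<in>{1..Suc n}. \<sigma> i)) / real (Suc n)))"
      by (rule Delta_bigo_of_singular[OF n h, of C \<sigma> \<delta>]) (use A \<epsilon> in blast)+
  qed
qed

end
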